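(* Let $d$ be the order of the tensor $A(t)$ (i.e. the number of leaves of the tree $\bar\tau$), $l<d$ the number of levels (i.e. the height of the tree $\bar\tau$), and let $n=\max_\ell n_\ell$ be the maximal dimension, $r=\max_\tau r_\tau$ the maximal rank, and $m+1$ the maximal order of the connection tensors. Assume that for every tree tensor network $X_{\bar\tau}$ on $\bar\tau$ the tensor $Z_{\bar\tau}=F(t,X_{\bar\tau})$ is again a tree tensor network on $\bar\tau$, with ranks $s_\tau\le cr$ for all subtrees $\tau\le\bar\tau$ with a moderate constant $c$. Then one time step of the recursive TTN integrator can be implemented such that it requires - $O(dr(n+r^m))$ storage, - $O(ld)$ tensorizations/matricizations of matrices/tensors with $\le r^{m+1}$ entries, - $O(ld^2r^2(n+r^m))$ arithmetical operations, and - $O(d)$ evaluations of the function $F$, provided the differential equations in the subflows $\Phi_\tau^{(i)}$ and $\Psi_\tau$ of the integrator are solved approximately using a fixed number of function evaluations per time step.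
   Context: **Tensor notation.** For a tensor $A$ with modes of dimensions $n_j$, $\mathrm{Mat}_i(A)\in\mathbb R^{n_i\times\prod_{j\ne i}n_j}$ is the $i$th matricization (its $k$th row lists, in a fixed co-lexicographic order, all entries of $A$ with $i$th index equal to $k$), and $\mathrm{Ten}_i$ is the inverse operation. For a matrix $\mathbf M$, $A\times_i\mathbf M$ is defined by $\mathrm{Mat}_i(A\times_i \mathbf M)=\mathbf M\,\mathrm{Mat}_i(A)$, and $A\,\mathsf X_{i=1}^m\mathbf M_i:=A\times_1\mathbf M_1\cdots\times_m\mathbf M_m$. For tensors of order $m+1$ associated with a tree with $m$ direct subtrees the modes are numbered $0,1,\dots,m$. **Trees.** Given a finite set $\mathcal L$ of leaves, trees $\tau$ with leaf sets $L(\tau)\subseteq\mathcal L$ are defined recursively: each $\ell\in\mathcal L$ is a tree with $L(\ell)=\{\ell\}$; if $m\ge2$ and $\tau_1,\dots,\tau_m$ are trees with pairwise disjoint leaf sets, then $\tau=(\tau_1,\dots,\tau_m)$ is a tree with $L(\tau)=\bigcup_iL(\tau_i)$; $\tau_1,\dots,\tau_m$ are its direct subtrees. The set of subtrees is $T(\ell)=\{\ell\}$, $T(\tau)=\{\tau\}\cup\bigcup_iT(\tau_i)$; $\sigma\le\tau$ means $\sigma\in T(\tau)$. Leaves have height $0$, and the height of $(\tau_1,\dots,\tau_m)$ is $1$ plus the maximal height of the $\tau_i$. Fix a tree $\bar\tau$ with $L(\bar\tau)=\mathcal L$. **Tree tensor networks (TTN).** To each leaf $\ell$ belong a dimension $n_\ell$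 and a rank $r_\ell\le n_\ell$; to each other subtree $\tau\le\bar\tau$ a rank $r_\tau$; $r_{\bar\tau}=1$. For $\tau=(\tau_1,\dots,\tau_m)$ put $n_\tau=\prod_in_{\tau_i}$ and $\mathcal V_\tau=\mathbb R^{r_\tau\times n_{\tau_1}\times\dots\times n_{\tau_m}}$; for a leaf, $\mathcal V_\ell=\mathbb R^{r_\ell\times n_\ell}$ (with $\mathrm{Mat}_0,\mathrm{Ten}_0$ the identity). From basis matrices $\mathbf U_\ell\in\mathbb R^{n_\ell\times r_\ell}$ and connection tensors $C_\sigma\in\mathbb R^{r_\sigma\times r_{\sigma_1}\times\dots\times r_{\sigma_m}}$, a TTN is defined recursively by $X_\ell=\mathbf U_\ell^\top$, $X_\sigma=C_\sigma\,\mathsf X_{i=1}^m\mathbf U_{\sigma_i}\in\mathcal V_\sigma$, $\mathbf U_\sigma=\mathrm{Mat}_0(X_\sigma)^\top$. Unless stated otherwise TTNs are in orthonormal representation ($\mathbf U_\sigma$ with orthonormal columns for all subtrees other than the whole tree), with basis matrices and connection tensors of full (multilinear) rank. TTNs are stored and processed only through their factors (basis matrices at the leaves and connection tensors). $F(t,X_{\bar\tau})$ being a TTN with ranks $s_\tau$ means that it has such a factorized representation on the same tree with the same dimensions $n_\ell$ and ranks $s_\tau$ in place of $r_\tau$ (full ranks and orthonormality not required); an evaluation of $F$ returns these factors. **Prolongation and restriction.** Let $\tau=(\tau_1,\dots,\tau_m)$, $1\le i\le m$, and let $Y_\tau^0=C_\tau^0\,\mathsf X_{j=1}^m\mathbf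 U_{\tau_j}^0$ with $\mathbf U^0_{\tau_j}$ having orthonormal columns. Take a QR decomposition $\mathrm{Mat}_i(C_\tau^0)^\top=\mathbf Q_{\tau_i}^0\mathbf S_{\tau_i}^{0,\top}$, $\mathbf Q^0_{\tau_i}$ with $r_{\tau_i}$ orthonormal columns, $\mathbf S^0_{\tau_i}\in\mathbb R^{r_{\tau_i}\times r_{\tau_i}}$, and set $\mathbf V_{\tau_i}^0=\mathrm{Mat}_i\big(\mathrm{Ten}_i(\mathbf Q_{\tau_i}^{0,\top})\,\mathsf X_{j\ne i}\mathbf U_{\tau_j}^0\big)^\top$. The associated maps are $\pi_{\tau,i}(Y)=\mathrm{Ten}_i\big((\mathbf V_{\tau_i}^0\mathrm{Mat}_0(Y))^\top\big)\in\mathcal V_\tau$ for $Y\in\mathcal V_{\tau_i}$, and $\pi_{\tau,i}^\dagger(Z)=\mathrm{Ten}_0\big((\mathrm{Mat}_i(Z)\mathbf V_{\tau_i}^0)^\top\big)\in\mathcal V_{\tau_i}$ for $Z\in\mathcal V_\tau$. **Recursive TTN integrator** for $\dot A=F(t,A)$, $A(t)\in\mathcal V_{\bar\tau}$. One time step $t_0\to t_1$ for $\tau=(\tau_1,\dots,\tau_m)$, a function $F_\tau:[t_0,t_1]\times\mathcal V_\tau\to\mathcal V_\tau$ and a TTN $Y_\tau^0=C_\tau^0\,\mathsf X_{j}\mathbf U_{\tau_j}^0$ with $\mathbf U_{\tau_j}^0=\mathrm{Mat}_0(X_{\tau_j}^0)^\top$: set $Y_\tau^{[0]}=Y_\tau^0$;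 for $i=1,\dots,m$ set $Y_\tau^{[i]}=\Phi_\tau^{(i)}(Y_\tau^{[i-1]})$; return $Y_\tau^1=\Psi_\tau(Y_\tau^{[m]})$. For the full tree one takes $F_{\bar\tau}=F$. *Subflow $\Phi_\tau^{(i)}$*, applied to an input again denoted $Y_\tau^0=C_\tau^0\,\mathsf X_j\mathbf U_{\tau_j}^0$: (1) keep $\mathbf U_{\tau_j}^1=\mathbf U_{\tau_j}^0$ for $j\ne i$. (2) Compute the QR decomposition $\mathrm{Mat}_i(C_\tau^0)^\top=\mathbf Q_{\tau_i}^0\mathbf S_{\tau_i}^{0,\top}$; let $\pi_{\tau,i},\pi_{\tau,i}^\dagger$ be the maps associated with this input and $F_{\tau_i}(t,\cdot)=\pi_{\tau,i}^\dagger\circ F_\tau(t,\cdot)\circ\pi_{\tau,i}$. (3) Set $Y_{\tau_i}^0=X_{\tau_i}^0\times_0\mathbf S_{\tau_i}^{0,\top}$. (4) If $\tau_i$ is a leaf, solve $\dot Y_{\tau_i}=F_{\tau_i}(t,Y_{\tau_i})$, $Y_{\tau_i}(t_0)=Y_{\tau_i}^0$, and set $Y_{\tau_i}^1=Y_{\tau_i}(t_1)$; otherwise let $Y_{\tau_i}^1$ be the result of the recursive TTN integrator applied to $(\tau_i,Y_{\tau_i}^0,F_{\tau_i},t_0,t_1)$. (5) If $\tau_i$ is not a leaf, compute the QR decomposition $\mathrm{Mat}_0(C_{\tau_i}^1)^\top=\widehat{\mathbf Q}_{\tau_i}^1\widehat{\mathbf S}_{\tau_i}^1$ of the connection tensor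 at the root of $Y_{\tau_i}^1$, let $X_{\tau_i}^1$ be $Y_{\tau_i}^1$ with this connection tensor replaced by $\mathrm{Ten}_0(\widehat{\mathbf Q}_{\tau_i}^{1,\top})$, and $\mathbf U_{\tau_i}^1=\mathrm{Mat}_0(X_{\tau_i}^1)^\top$; if $\tau_i$ is a leaf, compute the QR decomposition $(Y_{\tau_i}^1)^\top=\mathbf U_{\tau_i}^1\widehat{\mathbf S}_{\tau_i}^1$ and set $X_{\tau_i}^1=\mathbf U_{\tau_i}^{1,\top}$. (6) Solve $\dot{\mathbf S}(t)=-\mathbf U_{\tau_i}^{1,\top}\mathrm{Mat}_0\big(F_{\tau_i}(t,X_{\tau_i}^1\times_0\mathbf S(t)^\top)\big)^\top$, $\mathbf S(t_0)=\widehat{\mathbf S}_{\tau_i}^1$, and put $\widetilde{\mathbf S}_{\tau_i}^0=\mathbf S(t_1)$. (7) Return $C_\tau^1\,\mathsf X_j\mathbf U_{\tau_j}^1$ with $C_\tau^1=\mathrm{Ten}_i(\widetilde{\mathbf S}_{\tau_i}^0\mathbf Q_{\tau_i}^{0,\top})$. *Subflow $\Psi_\tau$*, applied to $C_\tau^0\,\mathsf X_j\mathbf U_{\tau_j}$: solve $\dot C(t)=F_\tau\big(t,C(t)\,\mathsf X_j\mathbf U_{\tau_j}\big)\,\mathsf X_j\mathbf U_{\tau_j}^\top$, $C(t_0)=C_\tau^0$, and return $C(t_1)\,\mathsf X_j\mathbf U_{\tau_j}$. *)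

theory Defs
  imports Complex_Main "Jordan_Normal_Form.Matrix" "Jordan_Normal_Form.DL_Rank"
begin

section \<open>Tensors\<close>

text \<open>A tensor is stored with its mode dimensions and its entries in co-lexicographic order
  (first index running fastest). Modes are numbered from 0.\<close>

datatype tensor = Tensor (dims: "nat list") (vals: "real vec")

definition numel :: "tensor \<Rightarrow> nat" where
  "numel A = prod_list (dims A)"

definition carrier_tensor :: "nat list \<Rightarrow> tensor set" where
  "carrier_tensor ds = {A. dims A = ds \<and> dim_vec (vals A) = prod_list ds}"

fun colex :: "nat list \<Rightarrow> nat list \<Rightarrow> nat" where
  "colex (d # ds) (i # js) = i + d * colex ds js"
| "colex _ _ = 0"

primrec uncolex :: "nat list \<Rightarrow> nat \<Rightarrow> nat list" where
  "uncolex [] k = []"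
| "uncolex (d # ds) k = (k mod d) # uncolex ds (k div d)"

definition entry :: "tensor \<Rightarrow> nat list \<Rightarrow> real" where
  "entry A js = vals A $ colex (dims A) js"

definition drop_nth :: "nat \<Rightarrow> 'a list \<Rightarrow> 'a list" where
  "drop_nth i xs = take i xs @ drop (Suc i) xs"

definition insert_nth :: "nat \<Rightarrow> 'a \<Rightarrow> 'a list \<Rightarrow> 'a list" where
  "insert_nth i x xs = take i xs @ x # drop i xs"

definition Mat :: "nat \<Rightarrow> tensor \<Rightarrow> real mat" where
  "Mat i A = (let ds = drop_nth i (dims A) in
     mat (dims A ! i) (prod_list ds) (\<lambda>(k, q). entry A (insert_nth i k (uncolex ds q))))"

text \<open>\<open>Ten i ds\<close> is the inverse of \<open>Mat i\<close> on tensors with mode dimensions \<open>ds\<close>.\<close>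

definition Ten :: "nat \<Rightarrow> nat list \<Rightarrow> real mat \<Rightarrow> tensor" where
  "Ten i ds M = Tensor ds (vec (prod_list ds) (\<lambda>q. let js = uncolex ds q in
     M $$ (js ! i, colex (drop_nth i ds) (drop_nth i js))))"

definition mode_prod :: "nat \<Rightarrow> tensor \<Rightarrow> real mat \<Rightarrow> tensor" where
  "mode_prod i A M = Ten i ((dims A)[i := dim_row M]) (M * Mat i A)"

definition mode_prods :: "tensor \<Rightarrow> (nat \<Rightarrow> real mat) \<Rightarrow> nat list \<Rightarrow> tensor" where
  "mode_prods A M is = fold (\<lambda>i B. mode_prod i B (M i)) is A"

text \<open>Matrices are identified with tensors of order 2 (on which \<open>Mat 0\<close> is the identity),
  scalars with tensors of order 0.\<close>

definition of_mat :: "real mat \<Rightarrow> tensor" where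
  "of_mat M = Ten 0 [dim_row M, dim_col M] M"

definition scalar :: "real \<Rightarrow> tensor" where
  "scalar x = Tensor [] (vec 1 (\<lambda>_. x))"

definition scalar_of :: "tensor \<Rightarrow> real" where
  "scalar_of A = vals A $ 0"

definition axpy :: "real \<Rightarrow> tensor \<Rightarrow> tensor \<Rightarrow> tensor" where
  "axpy a A B = Tensor (dims B) (a \<cdot>\<^sub>v vals A + vals B)"

definition is_QR :: "real mat \<Rightarrow> real mat \<times> real mat \<Rightarrow> bool" where
  "is_QR A = (\<lambda>(Q, R). Q \<in> carrier_mat (dim_row A) (dim_col A) \<and>
     R \<in> carrier_mat (dim_col A) (dim_col A) \<and>
     Q\<^sup>T * Q = 1\<^sub>m (dim_col A) \<and> upper_triangular R \<and> A = Q * R)"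

text \<open>QR decompositions are not unique (signs, rank deficiency); a QR routine fixes one
  for every matrix that is not wider than high.\<close>

definition QR_routine :: "(real mat \<Rightarrow> real mat \<times> real mat) \<Rightarrow> bool" where
  "QR_routine qr \<longleftrightarrow> (\<forall>A. dim_col A \<le> dim_row A \<longrightarrow> is_QR A (qr A))"


section \<open>Trees\<close>

datatype (leaves: 'l) tree = Leaf 'l | Node "'l tree list"

primrec is_tree :: "'l tree \<Rightarrow> bool" where
  "is_tree (Leaf l) \<longleftrightarrow> True"
| "is_tree (Node ts) \<longleftrightarrow> 2 \<le> length ts \<and> list_all (\<lambda>b. b) (map is_tree ts) \<and>
     (\<forall>i<length ts. \<forall>j<i. leaves (ts ! i) \<inter> leaves (ts ! j) = {})"

primrec subtrees :: "'l tree \<Rightarrow> 'l tree set" where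
  "subtrees (Leaf l) = {Leaf l}"
| "subtrees (Node ts) = insert (Node ts) (\<Union> (set (map subtrees ts)))"

primrec height :: "'l tree \<Rightarrow> nat" where
  "height (Leaf l) = 0"
| "height (Node ts) = Suc (Max (set (map height ts)))"


section \<open>Tree tensor networks\<close>

text \<open>Dimensions \<open>n\<close> are attached to leaves, ranks \<open>r\<close> to subtrees; in a tree the direct subtrees
  have disjoint leaf sets, so that a subtree occurs only once.\<close>

primrec tree_dim :: "('l \<Rightarrow> nat) \<Rightarrow> 'l tree \<Rightarrow> nat" where
  "tree_dim n (Leaf l) = n l"
| "tree_dim n (Node ts) = prod_list (map (tree_dim n) ts)"

fun V_space :: "('l \<Rightarrow> nat) \<Rightarrow> ('l tree \<Rightarrow> nat) \<Rightarrow> 'l tree \<Rightarrow> tensor set" where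
  "V_space n r (Leaf l) = carrier_tensor [r (Leaf l), n l]"
| "V_space n r (Node ts) = carrier_tensor (r (Node ts) # map (tree_dim n) ts)"

text \<open>The factors of a TTN: the basis matrix (with \<open>n l\<close> rows) at a leaf, the connection tensor
  at any other subtree.\<close>

type_synonym 'l factors = "'l tree \<Rightarrow> tensor"

fun factor_dims :: "('l \<Rightarrow> nat) \<Rightarrow> ('l tree \<Rightarrow> nat) \<Rightarrow> 'l tree \<Rightarrow> nat list" where
  "factor_dims n r (Leaf l) = [n l, r (Leaf l)]"
| "factor_dims n r (Node ts) = r (Node ts) # map r ts"

definition ttn_factors ::
    "('l \<Rightarrow> nat) \<Rightarrow> ('l tree \<Rightarrow> nat) \<Rightarrow> 'l tree \<Rightarrow> 'l factors \<Rightarrow> bool" where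
  "ttn_factors n r \<tau> C \<longleftrightarrow> (\<forall>\<sigma>\<in>subtrees \<tau>. C \<sigma> \<in> carrier_tensor (factor_dims n r \<sigma>))"

definition modes :: "'l tree list \<Rightarrow> nat list" where
  "modes ts = [1..<Suc (length ts)]"

text \<open>The tensors \<open>X\<^sub>\<sigma>\<close> of a TTN; \<open>basis\<close> gives the matrices \<open>U\<^sub>\<sigma>\<close>.\<close>

primrec ttn :: "'l factors \<Rightarrow> 'l tree \<Rightarrow> tensor" where
  "ttn C (Leaf l) = of_mat ((Mat 0 (C (Leaf l)))\<^sup>T)"
| "ttn C (Node ts) = mode_prods (C (Node ts))
     (\<lambda>i. (Mat 0 (map (ttn C) ts ! (i - 1)))\<^sup>T) (modes ts)"

definition basis :: "'l factors \<Rightarrow> 'l tree \<Rightarrow> real mat" where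
  "basis C \<sigma> = (Mat 0 (ttn C \<sigma>))\<^sup>T"

definition is_ttn :: "('l \<Rightarrow> nat) \<Rightarrow> ('l tree \<Rightarrow> nat) \<Rightarrow> 'l tree \<Rightarrow> tensor \<Rightarrow> bool" where
  "is_ttn n r \<tau> X \<longleftrightarrow> (\<exists>C. ttn_factors n r \<tau> C \<and> X = ttn C \<tau>)"

definition full_rank_factors :: "'l tree \<Rightarrow> 'l factors \<Rightarrow> bool" where
  "full_rank_factors \<tau> C \<longleftrightarrow>
     (\<forall>l. Leaf l \<in> subtrees \<tau> \<longrightarrow>
        vec_space.rank (dims (C (Leaf l)) ! 0) (Mat 0 (C (Leaf l))) = dims (C (Leaf l)) ! 1) \<and>
     (\<forall>ts. Node ts \<in> subtrees \<tau> \<longrightarrow> (\<forall>i\<le>length ts.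
        vec_space.rank (dims (C (Node ts)) ! i) (Mat i (C (Node ts))) = dims (C (Node ts)) ! i))"

definition orthonormal_rep :: "('l tree \<Rightarrow> nat) \<Rightarrow> 'l tree \<Rightarrow> 'l factors \<Rightarrow> bool" where
  "orthonormal_rep r \<tau> C \<longleftrightarrow>
     (\<forall>\<sigma>\<in>subtrees \<tau> - {\<tau>}. (basis C \<sigma>)\<^sup>T * basis C \<sigma> = 1\<^sub>m (r \<sigma>))"

text \<open>A procedure evaluating \<open>F\<close> in factored form: from the factors of \<open>X\<close> (ranks \<open>r\<close>) it
  returns factors of \<open>F t X\<close> (ranks \<open>s\<close>). Neither full rank nor orthonormality is required of
  the argument, since the arguments occurring in a time step need not have them.\<close>

definition evaluates :: "('l \<Rightarrow> nat) \<Rightarrow> ('l tree \<Rightarrow> nat) \<Rightarrow> ('l tree \<Rightarrow> nat) \<Rightarrow> 'l tree \<Rightarrow>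
    (real \<Rightarrow> 'l factors \<Rightarrow> 'l factors) \<Rightarrow> (real \<Rightarrow> tensor \<Rightarrow> tensor) \<Rightarrow> bool" where
  "evaluates n r s \<tau> ev F \<longleftrightarrow> (\<forall>t C. ttn_factors n r \<tau> C \<longrightarrow>
     ttn_factors n s \<tau> (ev t C) \<and> ttn (ev t C) \<tau> = F t (ttn C \<tau>))"


section \<open>Approximate solution of initial value problems\<close>

datatype arith_op = Add | Sub | Mul | Div | Sqrt

text \<open>\<open>Sqrt\<close> ignores its second operand. Division by 0 yields 0, as everywhere in HOL.\<close>

primrec arith :: "arith_op \<Rightarrow> real \<Rightarrow> real \<Rightarrow> real" where
  "arith Add x y = x + y"
| "arith Sub x y = x - y"
| "arith Mul x y = x * y"
| "arith Div x y = x / y"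
| "arith Sqrt x y = sqrt x"

text \<open>A solver that uses a fixed number of evaluations of the right-hand side is a fixed sequence
  of operations on numbered vector registers \<open>v\<close> and scalar registers \<open>a\<close>: evaluation of the
  right-hand side, vector update, inner product, scalar arithmetic. Explicit Runge--Kutta
  methods are of this form; the scalar coefficients may also depend on the data (as in Krylov
  methods).\<close>

datatype solver_op =
    Rhs nat nat nat                  \<comment> \<open>\<open>v\<^sub>i := f(a\<^sub>j, v\<^sub>k)\<close>\<close>
  | Update nat nat nat nat           \<comment> \<open>\<open>v\<^sub>i := a\<^sub>j v\<^sub>k + v\<^sub>l\<close>\<close>
  | Dot nat nat nat                  \<comment> \<open>\<open>a\<^sub>i := \<langle>v\<^sub>j, v\<^sub>k\<rangle>\<close>\<close>
  | Lit nat real                     \<comment> \<open>\<open>a\<^sub>i := x\<close>\<close>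
  | Scal nat arith_op nat nat        \<comment> \<open>\<open>a\<^sub>i := a\<^sub>j op a\<^sub>k\<close>\<close>

type_synonym solver = "solver_op list"

primrec solver_step :: "(real \<Rightarrow> tensor \<Rightarrow> tensor) \<Rightarrow> solver_op \<Rightarrow>
    (nat \<Rightarrow> real) \<times> (nat \<Rightarrow> tensor) \<Rightarrow> (nat \<Rightarrow> real) \<times> (nat \<Rightarrow> tensor)" where
  "solver_step f (Rhs i j k) = (\<lambda>(a, v). (a, v(i := f (a j) (v k))))"
| "solver_step f (Update i j k l) = (\<lambda>(a, v). (a, v(i := axpy (a j) (v k) (v l))))"
| "solver_step f (Dot i j k) = (\<lambda>(a, v). (a(i := vals (v j) \<bullet> vals (v k)), v))"
| "solver_step f (Lit i x) = (\<lambda>(a, v). (a(i := x), v))"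
| "solver_step f (Scal i opr j k) = (\<lambda>(a, v). (a(i := arith opr (a j) (a k)), v))"

text \<open>Initially \<open>a\<^sub>0 = t0\<close>, \<open>a\<^sub>1 = t1\<close>, and all vector registers hold the initial value; the
  approximation at \<open>t1\<close> is returned in \<open>v\<^sub>0\<close>.\<close>

definition solve :: "solver \<Rightarrow> real \<Rightarrow> real \<Rightarrow> (real \<Rightarrow> tensor \<Rightarrow> tensor) \<Rightarrow> tensor \<Rightarrow> tensor" where
  "solve S t0 t1 f y0 =
     snd (fold (solver_step f) S ((\<lambda>_. 0)(0 := t0, 1 := t1), \<lambda>_. y0)) 0"


section \<open>The recursive TTN integrator\<close>

definition prol :: "real mat \<Rightarrow> nat \<Rightarrow> nat list \<Rightarrow> tensor \<Rightarrow> tensor" where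
  "prol V i ds Y = Ten i ds ((V * Mat 0 Y)\<^sup>T)"

definition restr :: "real mat \<Rightarrow> nat \<Rightarrow> nat list \<Rightarrow> tensor \<Rightarrow> tensor" where
  "restr V i ds Z = Ten 0 ds ((Mat i Z * V)\<^sup>T)"

definition prol_mat :: "'l factors \<Rightarrow> 'l tree list \<Rightarrow> nat \<Rightarrow> real mat \<Rightarrow> real mat" where
  "prol_mat C ts i Q = (Mat i (mode_prods (Ten i (dims (C (Node ts))) (Q\<^sup>T))
     (\<lambda>j. basis C (ts ! (j - 1))) (filter (\<lambda>j. j \<noteq> i) (modes ts))))\<^sup>T"

text \<open>\<open>X\<^sub>\<sigma> \<times>\<^sub>0 M\<close> in terms of factors. Since the basis matrix stored at a leaf is the transpose
  of \<open>X\<^sub>\<sigma>\<close>, the product there is with mode 1.\<close>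

fun mult_root :: "'l tree \<Rightarrow> real mat \<Rightarrow> 'l factors \<Rightarrow> 'l factors" where
  "mult_root (Leaf l) M C = C(Leaf l := mode_prod 1 (C (Leaf l)) M)"
| "mult_root (Node ts) M C = C(Node ts := mode_prod 0 (C (Node ts)) M)"

text \<open>Orthonormalization at the root, with the triangular factor as second component.\<close>

fun orth_root :: "(real mat \<Rightarrow> real mat \<times> real mat) \<Rightarrow> 'l tree \<Rightarrow> 'l factors \<Rightarrow>
    'l factors \<times> real mat" where
  "orth_root qr (Leaf l) C =
     (let (Q, S) = qr (Mat 0 (C (Leaf l))) in (C(Leaf l := of_mat Q), S))"
| "orth_root qr (Node ts) C =
     (let (Q, S) = qr ((Mat 0 (C (Node ts)))\<^sup>T)
      in (C(Node ts := Ten 0 (dims (C (Node ts))) (Q\<^sup>T)), S))"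

text \<open>The subflows. \<open>sol\<close> solves initial value problems on the time interval considered, and
  \<open>sub\<close> is the solution operator used for the \<open>i\<close>th direct subtree.\<close>

definition Phi :: "(real mat \<Rightarrow> real mat \<times> real mat) \<Rightarrow>
    ((real \<Rightarrow> tensor \<Rightarrow> tensor) \<Rightarrow> tensor \<Rightarrow> tensor) \<Rightarrow> 'l tree list \<Rightarrow> nat \<Rightarrow>
    ((real \<Rightarrow> tensor \<Rightarrow> tensor) \<Rightarrow> 'l factors \<Rightarrow> 'l factors) \<Rightarrow>
    (real \<Rightarrow> tensor \<Rightarrow> tensor) \<Rightarrow> 'l factors \<Rightarrow> 'l factors" where
  "Phi qr sol ts i sub f C =
    (let \<tau> = Node ts; \<sigma> = ts ! (i - 1);
         (Q, ST) = qr ((Mat i (C \<tau>))\<^sup>T);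
         V = prol_mat C ts i Q;
         g = (\<lambda>t Y. restr V i (dims (ttn C \<sigma>)) (f t (prol V i (dims (ttn C \<tau>)) Y)));
         C1 = sub g (mult_root \<sigma> ST C);
         (C2, S1) = orth_root qr \<sigma> C1;
         U = basis C2 \<sigma>;
         S2 = Mat 0 (sol (\<lambda>t S. of_mat (- (U\<^sup>T * (Mat 0 (g t
                (mode_prod 0 (ttn C2 \<sigma>) ((Mat 0 S)\<^sup>T))))\<^sup>T))) (of_mat S1))
     in C2(\<tau> := Ten i (dims (C \<tau>)) (S2 * Q\<^sup>T)))"

definition Psi :: "((real \<Rightarrow> tensor \<Rightarrow> tensor) \<Rightarrow> tensor \<Rightarrow> tensor) \<Rightarrow> 'l tree list \<Rightarrow>
    (real \<Rightarrow> tensor \<Rightarrow> tensor) \<Rightarrow> 'l factors \<Rightarrow> 'l factors" where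
  "Psi sol ts f C =
    (let U = (\<lambda>i. basis C (ts ! (i - 1)))
     in C(Node ts := sol (\<lambda>t A. mode_prods (f t (mode_prods A U (modes ts)))
            (\<lambda>i. (U i)\<^sup>T) (modes ts)) (C (Node ts))))"

text \<open>One time step, acting on factors. At a leaf, where the integrator itself is not defined,
  this is the solution of the differential equation in the first part of \<open>Phi\<close>.\<close>

primrec ttn_step :: "(real mat \<Rightarrow> real mat \<times> real mat) \<Rightarrow>
    ((real \<Rightarrow> tensor \<Rightarrow> tensor) \<Rightarrow> tensor \<Rightarrow> tensor) \<Rightarrow> 'l tree \<Rightarrow>
    (real \<Rightarrow> tensor \<Rightarrow> tensor) \<Rightarrow> 'l factors \<Rightarrow> 'l factors" where
  "ttn_step qr sol (Leaf l) =
     (\<lambda>f C. C(Leaf l := of_mat ((Mat 0 (sol f (ttn C (Leaf l))))\<^sup>T)))"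
| "ttn_step qr sol (Node ts) =
     (\<lambda>f C. Psi sol ts f
        (fold (\<lambda>i. Phi qr sol ts i (map (ttn_step qr sol) ts ! (i - 1)) f) (modes ts) C))"


section \<open>Model of computation\<close>

text \<open>Programs are straight-line programs on registers holding tensors; the tree, dimensions
  and ranks are known when the program is written, the data (initial factors, times, the right-hand
  side) are not. Mode products and contractions are evaluated entrywise and are charged for their
  arithmetic only; a program can pass from a tensor of order other than 2 to a matrix and back only
  by the instructions \<open>Matricize\<close> and \<open>Tensorize\<close>, which are counted separately.\<close>

datatype 'l reg = Time0 | Time1 | Factor "'l tree" | Work "'l tree" nat

type_synonym 'l memory = "'l reg \<Rightarrow> tensor"

datatype 'l instr =
    Const "'l reg" real
  | Arith "'l reg" arith_op "'l reg" "'l reg"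
  | Axpy "'l reg" "'l reg" "'l reg" "'l reg"
  | Inner "'l reg" "'l reg" "'l reg"
  | Transpose "'l reg" "'l reg"
  | ModeProd "'l reg" nat "'l reg" "'l reg"
  | Contract "'l reg" nat "'l reg" "'l reg"
  | QR "'l reg" "'l reg" "'l reg"
  | Matricize "'l reg" nat "'l reg"
  | Tensorize "'l reg" nat "nat list" "'l reg"
  | EvalF "'l reg" "'l tree \<Rightarrow> 'l reg" "'l tree \<Rightarrow> 'l reg"
      \<comment> \<open>time, locations of the argument's factors, locations for the result's factors\<close>
  | Clear "'l reg"

definition empty_tensor :: tensor where
  "empty_tensor = Tensor [0] (vec 0 (\<lambda>_. 0))"

definition init_memory :: "'l tree \<Rightarrow> real \<Rightarrow> real \<Rightarrow> 'l factors \<Rightarrow> 'l memory" where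
  "init_memory \<tau> t0 t1 C a = (case a of
     Time0 \<Rightarrow> scalar t0 | Time1 \<Rightarrow> scalar t1
   | Factor \<sigma> \<Rightarrow> if \<sigma> \<in> subtrees \<tau> then C \<sigma> else empty_tensor
   | Work \<sigma> k \<Rightarrow> empty_tensor)"

primrec exec :: "(real mat \<Rightarrow> real mat \<times> real mat) \<Rightarrow> (real \<Rightarrow> 'l factors \<Rightarrow> 'l factors) \<Rightarrow>
    'l tree \<Rightarrow> 'l instr \<Rightarrow> 'l memory \<Rightarrow> 'l memory" where
  "exec qr ev \<tau> (Const d x) M = M(d := scalar x)"
| "exec qr ev \<tau> (Arith d opr a b) M =
     M(d := scalar (arith opr (scalar_of (M a)) (scalar_of (M b))))"
| "exec qr ev \<tau> (Axpy d s a b) M = M(d := axpy (scalar_of (M s)) (M a) (M b))"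
| "exec qr ev \<tau> (Inner d a b) M = M(d := scalar (vals (M a) \<bullet> vals (M b)))"
| "exec qr ev \<tau> (Transpose d a) M = M(d := of_mat ((Mat 0 (M a))\<^sup>T))"
| "exec qr ev \<tau> (ModeProd d i a b) M = M(d := mode_prod i (M a) (Mat 0 (M b)))"
| "exec qr ev \<tau> (Contract d i a b) M = M(d := of_mat (Mat i (M a) * (Mat i (M b))\<^sup>T))"
| "exec qr ev \<tau> (QR d e a) M =
     (let (Q, R) = qr (Mat 0 (M a)) in M(d := of_mat Q, e := of_mat R))"
| "exec qr ev \<tau> (Matricize d i a) M = M(d := of_mat (Mat i (M a)))"
| "exec qr ev \<tau> (Tensorize d i ds a) M = M(d := Ten i ds (Mat 0 (M a)))"
| "exec qr ev \<tau> (EvalF s arg res) M =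
     (let Z = ev (scalar_of (M s)) (\<lambda>\<sigma>. M (arg \<sigma>)) in
      (\<lambda>a. if a \<in> res ` subtrees \<tau> then Z (inv_into (subtrees \<tau>) res a) else M a))"
| "exec qr ev \<tau> (Clear d) M = M(d := empty_tensor)"

text \<open>\<open>legal n r \<tau> I M\<close>: the operands of the instruction \<open>I\<close> have admissible dimensions in the
  memory state \<open>M\<close>.\<close>

primrec legal :: "('l \<Rightarrow> nat) \<Rightarrow> ('l tree \<Rightarrow> nat) \<Rightarrow> 'l tree \<Rightarrow> 'l instr \<Rightarrow> 'l memory \<Rightarrow> bool" where
  "legal n r \<tau> (Const d x) M \<longleftrightarrow> True"
| "legal n r \<tau> (Arith d opr a b) M \<longleftrightarrow> dims (M a) = [] \<and> dims (M b) = []"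
| "legal n r \<tau> (Axpy d s a b) M \<longleftrightarrow> dims (M s) = [] \<and> dims (M a) = dims (M b)"
| "legal n r \<tau> (Inner d a b) M \<longleftrightarrow> dims (M a) = dims (M b)"
| "legal n r \<tau> (Transpose d a) M \<longleftrightarrow> length (dims (M a)) = 2"
| "legal n r \<tau> (ModeProd d i a b) M \<longleftrightarrow> i < length (dims (M a)) \<and>
     length (dims (M b)) = 2 \<and> dims (M b) ! 1 = dims (M a) ! i"
| "legal n r \<tau> (Contract d i a b) M \<longleftrightarrow> i < length (dims (M a)) \<and>
     i < length (dims (M b)) \<and> drop_nth i (dims (M a)) = drop_nth i (dims (M b))"
| "legal n r \<tau> (QR d e a) M \<longleftrightarrow> d \<noteq> e \<and> length (dims (M a)) = 2 \<and>
     dims (M a) ! 1 \<le> dims (M a) ! 0"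
| "legal n r \<tau> (Matricize d i a) M \<longleftrightarrow> i < length (dims (M a))"
| "legal n r \<tau> (Tensorize d i ds a) M \<longleftrightarrow> i < length ds \<and>
     dims (M a) = [ds ! i, prod_list (drop_nth i ds)]"
| "legal n r \<tau> (EvalF s arg res) M \<longleftrightarrow> dims (M s) = [] \<and>
     ttn_factors n r \<tau> (\<lambda>\<sigma>. M (arg \<sigma>)) \<and> inj_on res (subtrees \<tau>)"
| "legal n r \<tau> (Clear d) M \<longleftrightarrow> True"

text \<open>Number of arithmetical operations. For the QR decomposition of a \<open>p \<times> k\<close> matrix this is a
  bound for Householder's algorithm with explicit computation of the \<open>k\<close> orthonormal columns.
  The cost of an evaluation of \<open>F\<close> is not included.\<close>

primrec flops :: "'l instr \<Rightarrow> 'l memory \<Rightarrow> nat" where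
  "flops (Const d x) M = 0"
| "flops (Arith d opr a b) M = 1"
| "flops (Axpy d s a b) M = 2 * numel (M a)"
| "flops (Inner d a b) M = 2 * numel (M a)"
| "flops (Transpose d a) M = 0"
| "flops (ModeProd d i a b) M = 2 * dims (M b) ! 0 * numel (M a)"
| "flops (Contract d i a b) M = 2 * dims (M b) ! i * numel (M a)"
| "flops (QR d e a) M = (let p = dims (M a) ! 0; k = dims (M a) ! 1 in 4 * p * k\<^sup>2 + 7 * p * k)"
| "flops (Matricize d i a) M = 0"
| "flops (Tensorize d i ds a) M = 0"
| "flops (EvalF s arg res) M = 0"
| "flops (Clear d) M = 0"

text \<open>Number of entries reshaped, \<open>None\<close> for all instructions other than matricizations and
  tensorizations.\<close>

fun reshaped :: "'l instr \<Rightarrow> 'l memory \<Rightarrow> nat option" where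
  "reshaped (Matricize d i a) M = Some (numel (M a))"
| "reshaped (Tensorize d i ds a) M = Some (numel (M a))"
| "reshaped _ M = None"

fun is_eval :: "'l instr \<Rightarrow> bool" where
  "is_eval (EvalF s arg res) = True"
| "is_eval _ = False"

text \<open>Number of real numbers stored. Only finitely many registers are ever nonempty.\<close>

definition storage :: "'l memory \<Rightarrow> nat" where
  "storage M = (\<Sum>a | numel (M a) \<noteq> 0. numel (M a))"

text \<open>All memory states, from the initial to the final one.\<close>

primrec states :: "('l instr \<Rightarrow> 'l memory \<Rightarrow> 'l memory) \<Rightarrow> 'l instr list \<Rightarrow> 'l memory \<Rightarrow>
    'l memory list" where
  "states ex [] M = [M]"
| "states ex (I # P) M = M # states ex P (ex I M)"

end

theory Submission
  imports Defs "HOL-Library.Countable"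
begin

text \<open>Every projected right-hand side that occurs in the recursion is an evaluation of \<open>F\<close> in
  disguise. The prolongations only replace the connection tensors on the way to the root by
  orthonormalized ones, so the factors of the argument are at hand; the restrictions multiply the
  root of the relevant part of the factors of the result by a small matrix, which is obtained from the
  Gram matrices \<open>U\<^sub>\<sigma>\<^sup>T W\<^sub>\<sigma>\<close> of the bases of argument and result. One evaluation therefore costs one
  evaluation of \<open>F\<close> and \<open>O(d)\<close> mode products and contractions of factors, but no reshaping;
  reshapings occur only in the \<open>O(d)\<close> QR decompositions. Since a tree with \<open>d\<close> leaves has less
  than \<open>2 d\<close> subtrees, with at most two differential equations for each of them, there are \<open>O(d)\<close>
  evaluations and \<open>O(d\<^sup>2)\<close> instructions, each with \<open>O(r\<^sup>2 (n + r\<^sup>m))\<close> operations. Neither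
  orthonormality nor full rank matters for the exactness of the projections; full rank only guarantees
  that the matrices to be decomposed are not wider than high.\<close>

section \<open>Multi-indices\<close>

text \<open>The obstacle is that the definitions speak of tensors of full size: right-hand sides are
  functions on \<open>V_space\<close>, nested through prolongations and restrictions, and solvers
  treat them as black boxes. The predicate \<open>represents\<close> translates: it freezes the
  factors outside a subtree and says what the function does on every network with these factors.
  Steps inside the subtree do not affect it, so it can be passed down the recursion and reused for
  every equation at a node. One small matrix suffices because contracting the bases of argument and
  result in all modes but one leaves Gram matrices, while the remaining mode keeps the form of a
  network.

  For the machine, fixed dimensions for each register replace reasoning about states by a check of
  the program text. Full rank may be lost during a step, but the inequalities between dimensions
  drawn from it cannot. Sizes are measured by \<open>q = cc * R\<close>, a common bound for the
  ranks \<open>r\<close> and \<open>s\<close>, reshapings by \<open>R\<close> itself.\<close>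

abbreviation valid_index :: "nat list \<Rightarrow> nat list \<Rightarrow> bool" where
  "valid_index ds js \<equiv> list_all2 (<) js ds"

definition indices :: "nat list \<Rightarrow> nat list set" where
  "indices ds = {js. valid_index ds js}"

lemma colex_less: "valid_index ds js \<Longrightarrow> colex ds js < prod_list ds"
proof (induction ds js rule: colex.induct)
  case (1 d ds i js)
  then have "i < d" and *: "colex ds js < prod_list ds" by auto
  have "i + d * colex ds js < d + d * colex ds js" using \<open>i < d\<close> by simp
  also have "\<dots> = d * Suc (colex ds js)" by simp
  also have "\<dots> \<le> d * prod_list ds" using * by (intro mult_le_mono2) simp
  finally show ?case by simp
qed auto

lemma uncolex_valid: "k < prod_list ds \<Longrightarrow> valid_index ds (uncolex ds k)"
proof (induction ds arbitrary: k)
  case (Cons d ds)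
  then have "0 < d" by (cases d) auto
  then show ?case using Cons by (simp add: less_mult_imp_div_less mult.commute)
qed simp

lemma colex_uncolex: "k < prod_list ds \<Longrightarrow> colex ds (uncolex ds k) = k"
proof (induction ds arbitrary: k)
  case (Cons d ds)
  then show ?case by (simp add: less_mult_imp_div_less mult.commute)
qed simp

lemma uncolex_colex: "valid_index ds js \<Longrightarrow> uncolex ds (colex ds js) = js"
  by (induction ds js rule: colex.induct) auto

text \<open>\<open>colex ds\<close> and \<open>uncolex ds\<close> are inverse bijections between
  valid multi-indices and numbers below \<open>prod_list ds\<close>. Sums over column numbers of a
  matricization thus become sums over multi-indices, in which the linear order has
  disappeared.\<close>

lemma sum_uncolex: "(\<Sum>q<prod_list ds. g (uncolex ds q)) = sum g (indices ds)"
  by (rule sum.reindex_bij_witness[where i = "colex ds" and j = "uncolex ds"])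
     (auto simp: indices_def colex_less uncolex_valid colex_uncolex uncolex_colex)

lemma valid_index_iff:
  "valid_index ds js \<longleftrightarrow> length js = length ds \<and> (\<forall>i<length ds. js ! i < ds ! i)"
  by (auto simp: list_all2_conv_all_nth)

lemma valid_index_update:
  "valid_index ds js \<Longrightarrow> k < p \<Longrightarrow> valid_index (ds[i := p]) (js[i := k])"
  by (cases "i < length ds") (auto simp: valid_index_iff nth_list_update)


lemma drop_nth_valid: "valid_index ds js \<Longrightarrow> valid_index (drop_nth i ds) (drop_nth i js)"
  by (simp add: drop_nth_def list_all2_appendI list_all2_takeI list_all2_dropI)

lemma drop_nth_update: "drop_nth i (xs[i := x]) = drop_nth i xs"
  by (simp add: drop_nth_def)

lemma drop_nth_eqI:
  assumes "length xs = length ys" "\<And>k. k < length ys \<Longrightarrow> k \<noteq> i \<Longrightarrow> xs ! k = ys ! k"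
  shows "drop_nth i xs = drop_nth i ys"
  using assms by (auto simp: drop_nth_def intro!: arg_cong2[where f = "(@)"] nth_equalityI)

lemma length_drop_nth: "i < length xs \<Longrightarrow> length (drop_nth i xs) = length xs - 1"
  by (auto simp: drop_nth_def)

lemma insert_nth_drop_nth: "i < length xs \<Longrightarrow> insert_nth i x (drop_nth i xs) = xs[i := x]"
  by (simp add: drop_nth_def insert_nth_def upd_conv_take_nth_drop min_def)

lemma drop_nth_insert_nth: "i \<le> length xs \<Longrightarrow> drop_nth i (insert_nth i x xs) = xs"
  by (simp add: drop_nth_def insert_nth_def min_def)

lemma nth_insert_nth: "i \<le> length xs \<Longrightarrow> insert_nth i x xs ! i = x"
  by (simp add: insert_nth_def nth_append min_def)

lemma valid_index_insert_nth:
  assumes "i < length ds" "k < ds ! i" "valid_index (drop_nth i ds) js"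
  shows "valid_index ds (insert_nth i k js)"
proof -
  have l: "length js = length ds - 1"
    using assms by (metis length_drop_nth list_all2_lengthD)
  have ds: "ds = take i ds @ ds ! i # drop (Suc i) ds" using assms(1) by (rule id_take_nth_drop)
  have "valid_index (take i ds @ drop (Suc i) ds) (take i js @ drop i js)"
    using assms(3) by (simp add: drop_nth_def)
  then have "valid_index (take i ds) (take i js) \<and> valid_index (drop (Suc i) ds) (drop i js)"
    using l assms(1) by (subst (asm) list_all2_append) auto
  then have "valid_index (take i ds @ ds ! i # drop (Suc i) ds) (take i js @ k # drop i js)"
    using assms(2) by (intro list_all2_appendI) auto
  then show ?thesis using ds by (simp add: insert_nth_def)
qed

lemma prod_list_drop_nth: "i < length ds \<Longrightarrow> ds ! i * prod_list (drop_nth i ds) = prod_list ds"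
  for ds :: "nat list"
  by (subst (3) id_take_nth_drop[of i ds]) (auto simp: drop_nth_def)

text \<open>Deleting position \<open>i\<close> shifts all later positions, which is awkward once a
  second mode is involved. A column index is therefore represented by a full multi-index whose
  \<open>i\<close>th entry can only be 0. Updates at two different positions then simply
  commute.\<close>

lemma indices_drop_nth:
  assumes "i < length ds"
  shows "sum g (indices (drop_nth i ds)) = (\<Sum>js\<in>indices (ds[i := 1]). g (drop_nth i js))"
proof (rule sum.reindex_bij_witness[where j = "insert_nth i 0" and i = "drop_nth i"])
  fix js assume js: "js \<in> indices (drop_nth i ds)"
  then have l: "length js = length ds - 1"
    using assms by (metis indices_def length_drop_nth list_all2_lengthD mem_Collect_eq)
  then show *: "drop_nth i (insert_nth i 0 js) = js"
    using assms by (intro drop_nth_insert_nth) simp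
  then show "g (drop_nth i (insert_nth i 0 js)) = g js" by simp
  show "insert_nth i 0 js \<in> indices (ds[i := 1])"
    using js assms by (auto simp: indices_def drop_nth_update intro!: valid_index_insert_nth)
next
  fix js assume "js \<in> indices (ds[i := 1])"
  then have v: "valid_index (ds[i := 1]) js" by (simp add: indices_def)
  show "drop_nth i js \<in> indices (drop_nth i ds)"
    using drop_nth_valid[OF v, of i] by (simp add: indices_def drop_nth_update)
  have "js ! i = 0" "i < length js" using v assms by (auto simp: valid_index_iff)
  then show "insert_nth i 0 (drop_nth i js) = js"
    by (metis insert_nth_drop_nth list_update_id)
qed


section \<open>Matricizations and mode products\<close>

lemma carrier_tensorD: "A \<in> carrier_tensor ds \<Longrightarrow> dims A = ds"
  by (simp add: carrier_tensor_def)

lemma tensor_eqI: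
  assumes "A \<in> carrier_tensor ds" "B \<in> carrier_tensor ds"
    and "\<And>js. valid_index ds js \<Longrightarrow> entry A js = entry B js"
  shows "A = B"
proof (rule tensor.expand, intro conjI eq_vecI)
  fix k assume "k < dim_vec (vals B)"
  then have k: "k < prod_list ds" using assms(2) by (simp add: carrier_tensor_def)
  show "vals A $ k = vals B $ k"
    using assms(3)[OF uncolex_valid[OF k]] assms(1,2) k
    by (simp add: entry_def colex_uncolex carrier_tensor_def)
qed (use assms in \<open>auto simp: carrier_tensor_def\<close>)

lemma Ten_carrier [simp]: "Ten i ds M \<in> carrier_tensor ds"
  by (simp add: Ten_def carrier_tensor_def)

lemma dims_Ten [simp]: "dims (Ten i ds M) = ds"
  by (simp add: Ten_def)

lemma entry_Ten:
  "valid_index ds js \<Longrightarrow> entry (Ten i ds M) js = M $$ (js ! i, colex (drop_nth i ds) (drop_nth i js))"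
  by (simp add: entry_def Ten_def Let_def colex_less uncolex_colex)

lemma dim_Mat: "A \<in> carrier_tensor ds \<Longrightarrow> Mat i A \<in> carrier_mat (ds ! i) (prod_list (drop_nth i ds))"
  by (simp add: Mat_def Let_def carrier_tensor_def)

lemma Mat_index:
  "A \<in> carrier_tensor ds \<Longrightarrow> k < ds ! i \<Longrightarrow> q < prod_list (drop_nth i ds) \<Longrightarrow>
    Mat i A $$ (k, q) = entry A (insert_nth i k (uncolex (drop_nth i ds) q))"
  by (simp add: Mat_def Let_def carrier_tensor_def)

lemma Mat_Ten:
  assumes i: "i < length ds" and M: "M \<in> carrier_mat (ds ! i) (prod_list (drop_nth i ds))"
  shows "Mat i (Ten i ds M) = M"
proof (rule eq_matI)
  fix k q assume "k < dim_row M" "q < dim_col M"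
  then have k: "k < ds ! i" and q: "q < prod_list (drop_nth i ds)" using M by auto
  have v: "valid_index (drop_nth i ds) (uncolex (drop_nth i ds) q)" using q by (rule uncolex_valid)
  then have "length (uncolex (drop_nth i ds) q) = length ds - 1"
    using i by (metis length_drop_nth list_all2_lengthD)
  then show "Mat i (Ten i ds M) $$ (k, q) = M $$ (k, q)"
    using i k q v
    by (simp add: Mat_index[OF Ten_carrier] entry_Ten valid_index_insert_nth nth_insert_nth
        drop_nth_insert_nth colex_uncolex)
qed (use M dim_Mat[where A = "Ten i ds M" and ds = ds and i = i] in auto)

lemma Ten_Mat:
  assumes A: "A \<in> carrier_tensor ds" and i: "i < length ds"
  shows "Ten i ds (Mat i A) = A"
proof (rule tensor_eqI[OF Ten_carrier A])
  fix js assume v: "valid_index ds js"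
  then have l: "length js = length ds" "js ! i < ds ! i" using i by (auto simp: valid_index_iff)
  have v': "valid_index (drop_nth i ds) (drop_nth i js)" using v by (rule drop_nth_valid)
  show "entry (Ten i ds (Mat i A)) js = entry A js"
    using l i by (simp add: entry_Ten[OF v] Mat_index[OF A] colex_less[OF v'] uncolex_colex[OF v']
        insert_nth_drop_nth)
qed

lemma mode_prod_carrier:
  "A \<in> carrier_tensor ds \<Longrightarrow> M \<in> carrier_mat p q \<Longrightarrow> mode_prod i A M \<in> carrier_tensor (ds[i := p])"
  by (simp add: mode_prod_def carrier_tensorD)

lemma mode_prod_carrier':
  "A \<in> carrier_tensor ds \<Longrightarrow> M \<in> carrier_mat (ds ! i) q \<Longrightarrow> mode_prod i A M \<in> carrier_tensor ds"
  using mode_prod_carrier[of A ds M "ds ! i" q i] by simp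

lemma Mat_mode_prod:
  assumes A: "A \<in> carrier_tensor ds" and i: "i < length ds" and M: "M \<in> carrier_mat p (ds ! i)"
  shows "Mat i (mode_prod i A M) = M * Mat i A"
  using assms dim_Mat[OF A, of i]
  by (auto simp: mode_prod_def carrier_tensorD drop_nth_update intro!: Mat_Ten)

lemma mode_prod_Mat_eq:
  "A \<in> carrier_tensor ds \<Longrightarrow> M \<in> carrier_mat p (ds ! i) \<Longrightarrow>
    mode_prod i A M = Ten i (ds[i := p]) (M * Mat i A)"
  by (simp add: mode_prod_def carrier_tensorD)

text \<open>The basis for all statements about two different modes, whose matricizations arrange the
  columns in incompatible ways.\<close>

lemma entry_mode_prod:
  assumes A: "A \<in> carrier_tensor ds" and i: "i < length ds" and M: "M \<in> carrier_mat p (ds ! i)"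
    and v: "valid_index (ds[i := p]) js"
  shows "entry (mode_prod i A M) js = (\<Sum>k<ds ! i. M $$ (js ! i, k) * entry A (js[i := k]))"
proof -
  have l: "length js = length ds" "js ! i < p"
    using v i by (auto simp: valid_index_iff nth_list_update)
  have v': "valid_index (drop_nth i ds) (drop_nth i js)"
    using drop_nth_valid[OF v, of i] by (simp add: drop_nth_update)
  have q: "colex (drop_nth i ds) (drop_nth i js) < prod_list (drop_nth i ds)" using v' by (rule colex_less)
  have "entry (mode_prod i A M) js = (M * Mat i A) $$ (js ! i, colex (drop_nth i ds) (drop_nth i js))"
    using v by (simp add: mode_prod_Mat_eq[OF A M] entry_Ten drop_nth_update)
  also have "\<dots> = (\<Sum>k<ds ! i. M $$ (js ! i, k) * Mat i A $$ (k, colex (drop_nth i ds) (drop_nth i js)))"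
    using l M dim_Mat[OF A, of i] q
    by (simp add: scalar_prod_def atLeast0LessThan)
  also have "\<dots> = (\<Sum>k<ds ! i. M $$ (js ! i, k) * entry A (js[i := k]))"
    using q v' i l by (intro sum.cong) (auto simp: Mat_index[OF A] uncolex_colex insert_nth_drop_nth)
  finally show ?thesis .
qed

lemma mode_prod_one:
  assumes "A \<in> carrier_tensor ds" "i < length ds"
  shows "mode_prod i A (1\<^sub>m (ds ! i)) = A"
  using assms dim_Mat[of A ds i] by (simp add: mode_prod_Mat_eq[where p = "ds ! i"] Ten_Mat)

text \<open>Within a single mode this is associativity of matrix multiplication after
  matricization.\<close>

lemma mode_prod_mode_prod:
  assumes A: "A \<in> carrier_tensor ds" and i: "i < length ds"
    and M: "M \<in> carrier_mat p (ds ! i)" and N: "N \<in> carrier_mat p' p"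
  shows "mode_prod i (mode_prod i A M) N = mode_prod i A (N * M)"
proof -
  have "mode_prod i (mode_prod i A M) N = Ten i (ds[i := p']) (N * Mat i (mode_prod i A M))"
    using mode_prod_Mat_eq[OF mode_prod_carrier[OF A M], of N p' i] i N by simp
  also have "\<dots> = Ten i (ds[i := p']) (N * M * Mat i A)"
    using assms dim_Mat[OF A, of i] by (simp add: Mat_mode_prod[OF A i M] assoc_mult_mat[of N p' p M "ds ! i"])
  also have "\<dots> = mode_prod i A (N * M)"
    using mode_prod_Mat_eq[OF A, of "N * M" p' i] M N by simp
  finally show ?thesis .
qed

text \<open>Entrywise, the two sides differ by an interchange of two finite sums.\<close>

lemma mode_prod_commute:
  assumes A: "A \<in> carrier_tensor ds" and i: "i < length ds" and j: "j < length ds" and ij: "i \<noteq> j"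
    and M: "M \<in> carrier_mat p (ds ! i)" and N: "N \<in> carrier_mat p' (ds ! j)"
  shows "mode_prod j (mode_prod i A M) N = mode_prod i (mode_prod j A N) M"
proof (rule tensor_eqI)
  have AM: "mode_prod i A M \<in> carrier_tensor (ds[i := p])" using A M by (rule mode_prod_carrier)
  have AN: "mode_prod j A N \<in> carrier_tensor (ds[j := p'])" using A N by (rule mode_prod_carrier)
  show "mode_prod j (mode_prod i A M) N \<in> carrier_tensor (ds[i := p, j := p'])"
    using AM N by (rule mode_prod_carrier)
  show "mode_prod i (mode_prod j A N) M \<in> carrier_tensor (ds[i := p, j := p'])"
    using mode_prod_carrier[OF AN M, of i] ij by (simp add: list_update_swap)
  fix js assume v: "valid_index (ds[i := p, j := p']) js"
  then have v': "valid_index (ds[j := p', i := p]) js" using ij by (simp add: list_update_swap)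
  have l: "length js = length ds" using v by (auto simp: valid_index_iff)
  have vi: "valid_index (ds[i := p]) (js[j := k])" if "k < ds ! j" for k
    using v that ij i j by (auto simp: valid_index_iff nth_list_update split: if_splits)
  have vj: "valid_index (ds[j := p']) (js[i := k])" if "k < ds ! i" for k
    using v that ij i j by (auto simp: valid_index_iff nth_list_update split: if_splits)
  have "entry (mode_prod j (mode_prod i A M) N) js
      = (\<Sum>k<ds ! j. N $$ (js ! j, k) * entry (mode_prod i A M) (js[j := k]))"
    using entry_mode_prod[OF AM, of j N p' js] j ij N v by simp
  also have "\<dots> = (\<Sum>k<ds ! j. N $$ (js ! j, k) *
      (\<Sum>k'<ds ! i. M $$ (js ! i, k') * entry A (js[j := k, i := k'])))"
    using ij by (intro sum.cong refl) (simp add: entry_mode_prod[OF A i M vi])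
  also have "\<dots> = (\<Sum>k<ds ! j. \<Sum>k'<ds ! i. M $$ (js ! i, k') * (N $$ (js ! j, k) * entry A (js[i := k', j := k])))"
    using ij by (simp add: sum_distrib_left list_update_swap mult.left_commute)
  also have "\<dots> = (\<Sum>k'<ds ! i. \<Sum>k<ds ! j. M $$ (js ! i, k') * (N $$ (js ! j, k) * entry A (js[i := k', j := k])))"
    by (rule sum.swap)
  also have "\<dots> = (\<Sum>k'<ds ! i. M $$ (js ! i, k') *
      (\<Sum>k<ds ! j. N $$ (js ! j, k) * entry A (js[i := k', j := k])))"
    by (simp add: sum_distrib_left)
  also have "\<dots> = (\<Sum>k'<ds ! i. M $$ (js ! i, k') * entry (mode_prod j A N) (js[i := k']))"
    using ij by (intro sum.cong refl) (simp add: entry_mode_prod[OF A j N vj])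
  also have "\<dots> = entry (mode_prod i (mode_prod j A N) M) js"
    using entry_mode_prod[OF AN, of i M p js] i ij M v' by simp
  finally show "entry (mode_prod j (mode_prod i A M) N) js = entry (mode_prod i (mode_prod j A N) M) js" .
qed

text \<open>Each entry is the inner product of two slices. Letting the multi-indices run over
  \<open>ds[i := 1]\<close> makes one index set serve both tensors, although their dimensions differ
  in mode \<open>i\<close>.\<close>

lemma contraction_index:
  assumes A: "A \<in> carrier_tensor ds" and B: "B \<in> carrier_tensor ds'" and i: "i < length ds"
    and eq: "drop_nth i ds' = drop_nth i ds" and len: "length ds' = length ds"
    and a: "a < ds ! i" and b: "b < ds' ! i"
  shows "(Mat i A * (Mat i B)\<^sup>T) $$ (a, b) =
    (\<Sum>js\<in>indices (ds[i := 1]). entry A (js[i := a]) * entry B (js[i := b]))"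
proof -
  let ?P = "prod_list (drop_nth i ds)"
  have "(Mat i A * (Mat i B)\<^sup>T) $$ (a, b) = (\<Sum>q<?P. Mat i A $$ (a, q) * Mat i B $$ (b, q))"
    using a b dim_Mat[OF A, of i] dim_Mat[OF B, of i] eq
    by (simp add: scalar_prod_def atLeast0LessThan)
  also have "\<dots> = (\<Sum>q<?P. entry A (insert_nth i a (uncolex (drop_nth i ds) q)) *
      entry B (insert_nth i b (uncolex (drop_nth i ds) q)))"
    using a b eq by (intro sum.cong) (auto simp: Mat_index[OF A] Mat_index[OF B])
  also have "\<dots> = (\<Sum>js\<in>indices (drop_nth i ds). entry A (insert_nth i a js) * entry B (insert_nth i b js))"
    by (rule sum_uncolex)
  also have "\<dots> = (\<Sum>js\<in>indices (ds[i := 1]). entry A (insert_nth i a (drop_nth i js)) *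
      entry B (insert_nth i b (drop_nth i js)))"
    using i by (rule indices_drop_nth)
  also have "\<dots> = (\<Sum>js\<in>indices (ds[i := 1]). entry A (js[i := a]) * entry B (js[i := b]))"
    using i by (intro sum.cong) (auto simp: indices_def valid_index_iff insert_nth_drop_nth)
  finally show ?thesis .
qed

text \<open>The transfer of a mode product to the other factor of a contraction is what makes the
  integrator computable in factored form.\<close>

lemma contraction_mode_prod:
  assumes A: "A \<in> carrier_tensor ds" and B: "B \<in> carrier_tensor ds'"
    and len: "length ds' = length ds" and i: "i < length ds" and j: "j < length ds" and ij: "i \<noteq> j"
    and eq: "\<And>k. k < length ds \<Longrightarrow> k \<noteq> i \<Longrightarrow> k \<noteq> j \<Longrightarrow> ds' ! k = ds ! k"
    and M: "M \<in> carrier_mat (ds' ! j) (ds ! j)"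
  shows "Mat i (mode_prod j A M) * (Mat i B)\<^sup>T = Mat i A * (Mat i (mode_prod j B M\<^sup>T))\<^sup>T"
proof -
  let ?A = "mode_prod j A M" and ?B = "mode_prod j B M\<^sup>T"
  let ?p = "ds' ! j" and ?q = "ds ! j"
  have MT: "M\<^sup>T \<in> carrier_mat ?q ?p" using M by simp
  have AM: "?A \<in> carrier_tensor (ds[j := ?p])" using A M by (rule mode_prod_carrier)
  have BM: "?B \<in> carrier_tensor (ds'[j := ?q])" using B MT by (rule mode_prod_carrier)
  have e1: "drop_nth i ds' = drop_nth i (ds[j := ?p])"
    using len eq j by (intro drop_nth_eqI) (auto simp: nth_list_update)
  have e2: "drop_nth i (ds'[j := ?q]) = drop_nth i ds"
    using len eq j by (intro drop_nth_eqI) (auto simp: nth_list_update)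
  show ?thesis
  proof (rule eq_matI)
    fix a b assume "a < dim_row (Mat i A * (Mat i ?B)\<^sup>T)" "b < dim_col (Mat i A * (Mat i ?B)\<^sup>T)"
    then have a: "a < ds ! i" and b: "b < ds' ! i"
      using dim_Mat[OF A, of i] dim_Mat[OF BM, of i] ij by auto
    let ?I = "indices (ds[j := ?p, i := 1])" and ?J = "indices (ds[i := 1])"
    have swap: "ds[j := ?p, i := 1] = ds[i := 1, j := ?p]" using ij by (simp add: list_update_swap)
    have "(Mat i ?A * (Mat i B)\<^sup>T) $$ (a, b) = (\<Sum>js\<in>?I. entry ?A (js[i := a]) * entry B (js[i := b]))"
      using contraction_index[OF AM B, of i a b] i ij a b len e1 by simp
    also have "\<dots> = (\<Sum>js\<in>?I. \<Sum>k<?q. M $$ (js ! j, k) * entry A (js[i := a, j := k]) * entry B (js[i := b]))"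
    proof (intro sum.cong refl)
      fix js assume "js \<in> ?I"
      then have "valid_index (ds[j := ?p]) (js[i := a])"
        using a ij i by (auto simp: indices_def valid_index_iff nth_list_update split: if_splits)
      from entry_mode_prod[OF A j M this]
      show "entry ?A (js[i := a]) * entry B (js[i := b]) =
          (\<Sum>k<?q. M $$ (js ! j, k) * entry A (js[i := a, j := k]) * entry B (js[i := b]))"
        using ij by (simp add: sum_distrib_right)
    qed
    also have "\<dots> = (\<Sum>(js, k)\<in>?I \<times> {..<?q}. M $$ (js ! j, k) * entry A (js[i := a, j := k]) * entry B (js[i := b]))"
      by (simp add: sum.cartesian_product)
    also have "\<dots> = (\<Sum>(js, k)\<in>?J \<times> {..<?p}. M $$ (k, js ! j) * entry A (js[i := a]) * entry B (js[i := b, j := k]))"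
    \<comment> \<open>The map exchanges the free index in mode \<open>j\<close> with the summation
      index. It is an involution up to the roles of the two index sets, so the same term is the
      witness in both directions.\<close>
    proof (rule sum.reindex_bij_witness[where i = "\<lambda>(js, k). (js[j := k], js ! j)"
            and j = "\<lambda>(js, k). (js[j := k], js ! j)"])
      fix x assume "x \<in> ?I \<times> {..<?q}"
      then obtain js k where x: "x = (js, k)" and js: "js \<in> ?I" and k: "k < ?q" by auto
      have v: "valid_index (ds[j := ?p, i := 1]) js" using js by (simp add: indices_def)
      then have l: "length js = length ds" "js ! j < ?p"
        using j ij by (auto simp: valid_index_iff)
      have "valid_index (ds[i := 1]) (js[j := k])"
        using valid_index_update[OF v[unfolded swap], of k ?q j] k j ij
        by (simp add: list_update_swap[OF ij])
      then show "(case x of (js, k) \<Rightarrow> (js[j := k], js ! j)) \<in> ?J \<times> {..<?p}"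
        using x l by (simp add: indices_def)
      show "(case case x of (js, k) \<Rightarrow> (js[j := k], js ! j) of (js, k) \<Rightarrow> (js[j := k], js ! j)) = x"
        using x l j by simp
      have "js[j := k, i := a] = js[i := a, j := k]" using ij by (simp add: list_update_swap)
      moreover have "js[j := k, i := b, j := js ! j] = js[i := b]"
        using ij by (metis list_update_id list_update_overwrite list_update_swap)
      ultimately show "(case case x of (js, k) \<Rightarrow> (js[j := k], js ! j) of
          (js, k) \<Rightarrow> M $$ (k, js ! j) * entry A (js[i := a]) * entry B (js[i := b, j := k])) =
          (case x of (js, k) \<Rightarrow> M $$ (js ! j, k) * entry A (js[i := a, j := k]) * entry B (js[i := b]))"
        using x l j by simp
    next
      fix x assume "x \<in> ?J \<times> {..<?p}"
      then obtain js k where x: "x = (js, k)" and js: "js \<in> ?J" and k: "k < ?p" by auto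
      have v: "valid_index (ds[i := 1]) js" using js by (simp add: indices_def)
      then have l: "length js = length ds" "js ! j < ?q"
        using j ij by (auto simp: valid_index_iff)
      have "valid_index (ds[j := ?p, i := 1]) (js[j := k])"
        using valid_index_update[OF v, of k ?p j] k swap by simp
      then show "(case x of (js, k) \<Rightarrow> (js[j := k], js ! j)) \<in> ?I \<times> {..<?q}"
        using x l by (simp add: indices_def)
      show "(case case x of (js, k) \<Rightarrow> (js[j := k], js ! j) of (js, k) \<Rightarrow> (js[j := k], js ! j)) = x"
        using x l j by simp
    qed
    also have "\<dots> = (\<Sum>js\<in>?J. \<Sum>k<?p. M $$ (k, js ! j) * entry A (js[i := a]) * entry B (js[i := b, j := k]))"
      by (simp add: sum.cartesian_product)
    also have "\<dots> = (\<Sum>js\<in>?J. entry A (js[i := a]) * entry ?B (js[i := b]))"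
    proof (intro sum.cong refl)
      fix js assume js: "js \<in> ?J"
      then have "valid_index (ds'[j := ?q]) (js[i := b])"
        using b i j ij len eq by (auto simp: indices_def valid_index_iff nth_list_update split: if_splits)
      moreover have "js ! j < ?q" using js ij j by (auto simp: indices_def valid_index_iff)
      ultimately show "(\<Sum>k<?p. M $$ (k, js ! j) * entry A (js[i := a]) * entry B (js[i := b, j := k])) =
          entry A (js[i := a]) * entry ?B (js[i := b])"
        using entry_mode_prod[OF B _ MT, of "js[i := b]"] j len ij M
        by (simp add: sum_distrib_left mult.assoc mult.left_commute)
    qed
    also have "\<dots> = (Mat i A * (Mat i ?B)\<^sup>T) $$ (a, b)"
      using contraction_index[OF A BM, of i a b] i ij a b len e2 by simp
    finally show "(Mat i ?A * (Mat i B)\<^sup>T) $$ (a, b) = (Mat i A * (Mat i ?B)\<^sup>T) $$ (a, b)" .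
  qed (use dim_Mat[OF A, of i] dim_Mat[OF AM, of i] dim_Mat[OF B, of i] dim_Mat[OF BM, of i] ij in auto)
qed

section \<open>Products in several modes\<close>

lemma mode_prods_Nil [simp]: "mode_prods A M [] = A"
  by (simp add: mode_prods_def)

lemma mode_prods_Cons [simp]: "mode_prods A M (i # is) = mode_prods (mode_prod i A (M i)) M is"
  by (simp add: mode_prods_def)

lemma mode_prods_append: "mode_prods A M (is @ js) = mode_prods (mode_prods A M is) M js"
  by (simp add: mode_prods_def)

lemma mode_prods_cong: "(\<And>i. i \<in> set is \<Longrightarrow> M i = N i) \<Longrightarrow> mode_prods A M is = mode_prods A N is"
  by (induction "is" arbitrary: A) auto

text \<open>As the modes are distinct, each \<open>M i\<close> still meets the original dimension
  \<open>ds ! i\<close>. Recording the new dimensions in \<open>p\<close> makes the dimensions of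
  the result depend only on the set of modes.\<close>

definition fits :: "nat list \<Rightarrow> (nat \<Rightarrow> real mat) \<Rightarrow> (nat \<Rightarrow> nat) \<Rightarrow> nat list \<Rightarrow> bool" where
  "fits ds M p is \<longleftrightarrow> distinct is \<and> (\<forall>i\<in>set is. i < length ds \<and> M i \<in> carrier_mat (p i) (ds ! i))"

definition upd_dims :: "nat list \<Rightarrow> (nat \<Rightarrow> nat) \<Rightarrow> nat set \<Rightarrow> nat list" where
  "upd_dims ds p J = map (\<lambda>k. if k \<in> J then p k else ds ! k) [0..<length ds]"

lemma length_upd_dims [simp]: "length (upd_dims ds p J) = length ds"
  by (simp add: upd_dims_def)

lemma nth_upd_dims: "k < length ds \<Longrightarrow> upd_dims ds p J ! k = (if k \<in> J then p k else ds ! k)"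
  by (simp add: upd_dims_def)

lemma upd_dims_empty [simp]: "upd_dims ds p {} = ds"
  by (simp add: upd_dims_def map_nth)

lemma upd_dims_insert: "i \<notin> J \<Longrightarrow> upd_dims (ds[i := p i]) p J = upd_dims ds p (insert i J)"
  by (cases "i < length ds") (auto intro!: nth_equalityI simp: nth_upd_dims nth_list_update)

lemma fits_Cons: "fits ds M p (i # is) \<longleftrightarrow>
    i \<notin> set is \<and> i < length ds \<and> M i \<in> carrier_mat (p i) (ds ! i) \<and> fits (ds[i := p i]) M p is"
  by (fastforce simp: fits_def nth_list_update split: if_splits)

lemma fits_list_update: "i \<notin> set is \<Longrightarrow> fits (ds[i := q]) M p is \<longleftrightarrow> fits ds M p is"
  by (auto simp: fits_def nth_list_update) (metis nth_list_update_neq)+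

lemma mode_prods_carrier:
  "A \<in> carrier_tensor ds \<Longrightarrow> fits ds M p is \<Longrightarrow> mode_prods A M is \<in> carrier_tensor (upd_dims ds p (set is))"
proof (induction "is" arbitrary: A ds)
  case (Cons i "is")
  then show ?case
    using Cons.IH[of "mode_prod i A (M i)" "ds[i := p i]"]
    by (auto simp: fits_Cons upd_dims_insert mode_prod_carrier)
qed simp

lemma mode_prods_commute:
  assumes "A \<in> carrier_tensor ds" "fits ds M p is" "i < length ds" "i \<notin> set is" "N \<in> carrier_mat q (ds ! i)"
  shows "mode_prod i (mode_prods A M is) N = mode_prods (mode_prod i A N) M is"
  using assms
proof (induction "is" arbitrary: A ds)
  case (Cons j "is")
  then have "mode_prod i (mode_prods A M (j # is)) N = mode_prods (mode_prod i (mode_prod j A (M j)) N) M is"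
    using Cons.IH[of "mode_prod j A (M j)" "ds[j := p j]"] mode_prod_carrier[of A ds "M j" "p j" "ds ! j" j]
    by (auto simp: fits_Cons)
  also have "mode_prod i (mode_prod j A (M j)) N = mode_prod j (mode_prod i A N) (M j)"
    using Cons.prems by (intro mode_prod_commute) (auto simp: fits_Cons)
  finally show ?case by simp
qed simp

lemma mode_prods_mode_prods:
  assumes "A \<in> carrier_tensor ds" "fits ds M p is" "\<And>i. i \<in> set is \<Longrightarrow> N i \<in> carrier_mat (p' i) (p i)"
  shows "mode_prods (mode_prods A M is) N is = mode_prods A (\<lambda>i. N i * M i) is"
  using assms
proof (induction "is" arbitrary: A ds)
  case (Cons i "is")
  let ?A = "mode_prod i A (M i)"
  have i: "i \<notin> set is" "i < length ds" "M i \<in> carrier_mat (p i) (ds ! i)" and f: "fits (ds[i := p i]) M p is"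
    using Cons.prems by (auto simp: fits_Cons)
  have A: "?A \<in> carrier_tensor (ds[i := p i])" using Cons.prems(1) i(3) by (rule mode_prod_carrier)
  have N: "N i \<in> carrier_mat (p' i) (p i)" using Cons.prems(3) by simp
  have AN: "mode_prod i ?A (N i) \<in> carrier_tensor (ds[i := p' i])"
    using mode_prod_carrier[OF A N, of i] by simp
  have f': "fits (ds[i := p' i]) M p is" using f i(1) by (simp add: fits_list_update)
  have "mode_prods (mode_prods A M (i # is)) N (i # is) = mode_prods (mode_prods (mode_prod i ?A (N i)) M is) N is"
    using mode_prods_commute[OF A f, of i "N i" "p' i"] i N by simp
  also have "\<dots> = mode_prods (mode_prod i ?A (N i)) (\<lambda>i. N i * M i) is"
    using Cons.IH[OF AN f'] Cons.prems(3) by simp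
  also have "mode_prod i ?A (N i) = mode_prod i A (N i * M i)"
    using Cons.prems(1) i N by (intro mode_prod_mode_prod)
  finally show ?case by simp
qed simp

lemma fits_filter: "fits ds M p is \<Longrightarrow> fits ds M p (filter P is)"
  by (auto simp: fits_def)

text \<open>Once the factor of mode \<open>i\<close> is outermost, it becomes a plain matrix product
  in the matricization for that mode. This is how both prolongation and restriction are opened
  up.\<close>

lemma mode_prods_extract:
  assumes "A \<in> carrier_tensor ds" "fits ds M p is" "i \<in> set is"
  shows "mode_prods A M is = mode_prod i (mode_prods A M (filter (\<lambda>j. j \<noteq> i) is)) (M i)"
  using assms
proof (induction "is" arbitrary: A ds)
  case (Cons j "is")
  have A: "mode_prod j A (M j) \<in> carrier_tensor (ds[j := p j])"
    using Cons.prems by (auto simp: fits_Cons mode_prod_carrier)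
  show ?case
  proof (cases "j = i")
    case True
    then have "filter (\<lambda>j. j \<noteq> i) (j # is) = is"
      using Cons.prems by (auto simp: fits_Cons intro!: filter_True)
    then show ?thesis using True Cons.prems
      by (subst mode_prods_commute[of _ ds M p _ _ _ "p i"]) (auto simp: fits_Cons fits_list_update)
  next
    case False
    then show ?thesis using Cons.IH[OF A] Cons.prems by (simp add: fits_Cons)
  qed
qed simp

text \<open>The modes are moved one at a time, and \<open>ds\<close> is adapted to
  \<open>ds'\<close> in each treated mode. The transposes arrive at the other factor in reverse
  order, which is repaired by commuting products in different modes.\<close>

lemma contraction_mode_prods:
  assumes "A \<in> carrier_tensor ds" "B \<in> carrier_tensor ds'" "length ds' = length ds" "i < length ds"
    and "i \<notin> set is" "fits ds M (\<lambda>j. ds' ! j) is"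
    and "\<And>k. k < length ds \<Longrightarrow> k \<noteq> i \<Longrightarrow> k \<notin> set is \<Longrightarrow> ds' ! k = ds ! k"
  shows "Mat i (mode_prods A M is) * (Mat i B)\<^sup>T = Mat i A * (Mat i (mode_prods B (\<lambda>j. (M j)\<^sup>T) is))\<^sup>T"
  using assms
proof (induction "is" arbitrary: A ds)
  case (Cons j "is")
  let ?A = "mode_prod j A (M j)" and ?B = "mode_prods B (\<lambda>j. (M j)\<^sup>T) is"
  have j: "j \<notin> set is" "j < length ds" "M j \<in> carrier_mat (ds' ! j) (ds ! j)"
    and f: "fits (ds[j := ds' ! j]) M (\<lambda>j. ds' ! j) is"
    using Cons.prems(6) by (auto simp: fits_Cons)
  have A: "?A \<in> carrier_tensor (ds[j := ds' ! j])"
    using Cons.prems(1) j(3) by (rule mode_prod_carrier)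
  have f': "fits ds' (\<lambda>j. (M j)\<^sup>T) (\<lambda>j. ds ! j) is"
    using f j Cons.prems(3) by (auto simp: fits_def nth_list_update split: if_splits)
  have B: "?B \<in> carrier_tensor (upd_dims ds' (\<lambda>j. ds ! j) (set is))"
    using Cons.prems(2) f' by (rule mode_prods_carrier)
  have "Mat i (mode_prods A M (j # is)) * (Mat i B)\<^sup>T = Mat i ?A * (Mat i ?B)\<^sup>T"
    using Cons.IH[OF A Cons.prems(2) _ _ _ f] Cons.prems(3-5,7) j(2)
    by (auto simp: nth_list_update split: if_splits)
  also have "\<dots> = Mat i A * (Mat i (mode_prod j ?B (M j)\<^sup>T))\<^sup>T"
    using Cons.prems j by (intro contraction_mode_prod[OF _ B]) (auto simp: nth_upd_dims)
  also have "mode_prod j ?B (M j)\<^sup>T = mode_prods B (\<lambda>j. (M j)\<^sup>T) (j # is)"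
    using mode_prods_commute[OF Cons.prems(2) f', of j "(M j)\<^sup>T" "ds ! j"] j Cons.prems(3) by simp
  finally show ?case .
qed simp


section \<open>Tensors of order 2\<close>

lemma of_mat_carrier: "M \<in> carrier_mat a b \<Longrightarrow> of_mat M \<in> carrier_tensor [a, b]"
  by (auto simp: of_mat_def)

lemma drop_nth_2 [simp]: "drop_nth 0 [a, b] = [b]" "drop_nth (Suc 0) [a, b] = [a]"
  by (simp_all add: drop_nth_def)

lemma drop_nth_0 [simp]: "drop_nth 0 (a # xs) = xs"
  by (simp add: drop_nth_def)

lemma Mat_of_mat [simp]: "Mat 0 (of_mat M) = M"
  unfolding of_mat_def by (rule Mat_Ten) auto

lemma dim_Mat_0_2: "A \<in> carrier_tensor [a, b] \<Longrightarrow> Mat 0 A \<in> carrier_mat a b"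
  using dim_Mat[of A "[a, b]" 0] by simp

lemma of_mat_Mat: "A \<in> carrier_tensor [a, b] \<Longrightarrow> of_mat (Mat 0 A) = A"
  using Ten_Mat[of A "[a, b]" 0] dim_Mat_0_2[of A a b] by (auto simp: of_mat_def)

lemma Mat_1_2: 
  assumes "A \<in> carrier_tensor [a, b]"
  shows "Mat 1 A = (Mat 0 A)\<^sup>T"
  using assms dim_Mat[of A "[a, b]" 0] dim_Mat[of A "[a, b]" 1]
  by (intro eq_matI) (auto simp: Mat_index[OF assms] insert_nth_def)

lemma mode_prod_0_2:
  "A \<in> carrier_tensor [a, b] \<Longrightarrow> M \<in> carrier_mat p a \<Longrightarrow> mode_prod 0 A M = of_mat (M * Mat 0 A)"
  using dim_Mat_0_2[of A a b] by (auto simp: mode_prod_def of_mat_def carrier_tensorD)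

lemma mode_prod_1_2:
  assumes A: "A \<in> carrier_tensor [a, b]" and M: "M \<in> carrier_mat p b"
  shows "mode_prod 1 A M = of_mat (Mat 0 A * M\<^sup>T)"
proof -
  have *: "mode_prod 1 A M \<in> carrier_tensor [a, p]"
    using mode_prod_carrier[OF A M, of 1] by simp
  have m: "Mat 0 A \<in> carrier_mat a b" using A by (rule dim_Mat_0_2)
  have "Mat 0 (mode_prod 1 A M) = (Mat 1 (mode_prod 1 A M))\<^sup>T"
    by (simp add: Mat_1_2[OF *, simplified])
  also have "\<dots> = (M * (Mat 0 A)\<^sup>T)\<^sup>T"
    using Mat_mode_prod[OF A, of 1 M p] M by (simp add: Mat_1_2[OF A, simplified])
  also have "\<dots> = Mat 0 A * M\<^sup>T"
    using m M by (simp add: transpose_mult[of M p b "(Mat 0 A)\<^sup>T" a])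
  finally show ?thesis using of_mat_Mat[OF *] by simp
qed


section \<open>Evaluation of the projected right-hand side in factored form\<close>

fun ttn_dims :: "('l \<Rightarrow> nat) \<Rightarrow> ('l tree \<Rightarrow> nat) \<Rightarrow> 'l tree \<Rightarrow> nat list" where
  "ttn_dims n r (Leaf l) = [r (Leaf l), n l]"
| "ttn_dims n r (Node ts) = r (Node ts) # map (tree_dim n) ts"

lemma V_space_ttn_dims: "V_space n r \<tau> = carrier_tensor (ttn_dims n r \<tau>)"
  by (cases \<tau>) auto

lemma subtrees_refl [simp]: "\<tau> \<in> subtrees \<tau>"
  by (cases \<tau>) auto

lemma subtrees_trans: "\<sigma> \<in> subtrees \<rho> \<Longrightarrow> \<rho> \<in> subtrees \<tau> \<Longrightarrow> \<sigma> \<in> subtrees \<tau>"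
  by (induction \<tau>) auto

lemma set_modes: "set (modes ts) = {1..length ts}"
  by (auto simp: modes_def)

lemma mode_nth_mem: "i \<in> set (modes ts) \<Longrightarrow> ts ! (i - 1) \<in> set ts"
  by (auto simp: set_modes intro!: nth_mem)

lemma child_subtree: "\<sigma> \<in> set ts \<Longrightarrow> \<sigma> \<in> subtrees (Node ts)"
  using subtrees_refl[of \<sigma>] by (auto simp del: subtrees_refl)

lemma ttn_factors_subtree: "ttn_factors n r \<tau> C \<Longrightarrow> \<sigma> \<in> subtrees \<tau> \<Longrightarrow> ttn_factors n r \<sigma> C"
  by (auto simp: ttn_factors_def intro: subtrees_trans)

lemma ttn_factorsD: "ttn_factors n r \<tau> C \<Longrightarrow> C \<tau> \<in> carrier_tensor (factor_dims n r \<tau>)"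
  by (auto simp: ttn_factors_def)

lemma ttn_Node: "ttn C (Node ts) = mode_prods (C (Node ts)) (\<lambda>i. basis C (ts ! (i - 1))) (modes ts)"
  by (auto simp: basis_def set_modes intro!: mode_prods_cong)

declare ttn.simps(2) [simp del]

lemma fits_modes:
  assumes "length ds = Suc (length ts)" "\<And>i. i \<in> set (modes ts) \<Longrightarrow> M i \<in> carrier_mat (p i) (ds ! i)"
  shows "fits ds M p (modes ts)"
  using assms by (auto simp: fits_def set_modes) (auto simp: modes_def)

lemma ttn_carrier: "ttn_factors n r \<tau> C \<Longrightarrow> ttn C \<tau> \<in> carrier_tensor (ttn_dims n r \<tau>)"
  and basis_carrier: "ttn_factors n r \<tau> C \<Longrightarrow> basis C \<tau> \<in> carrier_mat (tree_dim n \<tau>) (r \<tau>)"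
proof -
  have b: "basis C \<sigma> \<in> carrier_mat (tree_dim n \<sigma>) (r \<sigma>)" if "ttn C \<sigma> \<in> carrier_tensor (ttn_dims n r \<sigma>)" for \<sigma>
    using dim_Mat[OF that, of 0] by (cases \<sigma>) (auto simp: basis_def)
  show t: "ttn C \<tau> \<in> carrier_tensor (ttn_dims n r \<tau>)" if "ttn_factors n r \<tau> C"
    using that
  proof (induction \<tau>)
    case (Leaf l)
    then have "C (Leaf l) \<in> carrier_tensor [n l, r (Leaf l)]" by (auto dest: ttn_factorsD)
    then have "Mat 0 (C (Leaf l)) \<in> carrier_mat (n l) (r (Leaf l))" by (rule dim_Mat_0_2)
    then show ?case by (auto intro!: of_mat_carrier)
  next
    case (Node ts)
    have C: "C (Node ts) \<in> carrier_tensor (r (Node ts) # map r ts)"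
      using ttn_factorsD[OF Node.prems] by simp
    have "basis C \<sigma> \<in> carrier_mat (tree_dim n \<sigma>) (r \<sigma>)" if "\<sigma> \<in> set ts" for \<sigma>
      using Node.IH[OF that] ttn_factors_subtree[OF Node.prems child_subtree[OF that]] by (intro b)
    then have "fits (r (Node ts) # map r ts) (\<lambda>i. basis C (ts ! (i - 1)))
        (\<lambda>i. tree_dim n (ts ! (i - 1))) (modes ts)"
      by (intro fits_modes) (auto simp: set_modes nth_Cons')
    from mode_prods_carrier[OF C this]
    have "ttn C (Node ts) \<in> carrier_tensor (upd_dims (r (Node ts) # map r ts)
        (\<lambda>i. tree_dim n (ts ! (i - 1))) (set (modes ts)))"
      by (simp add: ttn_Node)
    also have "upd_dims (r (Node ts) # map r ts) (\<lambda>i. tree_dim n (ts ! (i - 1))) (set (modes ts)) =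
        ttn_dims n r (Node ts)"
      by (intro nth_equalityI) (auto simp: nth_upd_dims set_modes nth_Cons')
    finally show ?case .
  qed
  then show "ttn_factors n r \<tau> C \<Longrightarrow> basis C \<tau> \<in> carrier_mat (tree_dim n \<tau>) (r \<tau>)"
    by (rule b)
qed

lemma fits_basis:
  assumes "\<And>\<sigma>. \<sigma> \<in> set ts \<Longrightarrow> ttn_factors n r \<sigma> C" "length ds = Suc (length ts)" "tl ds = map r ts"
  shows "fits ds (\<lambda>i. basis C (ts ! (i - 1))) (\<lambda>i. tree_dim n (ts ! (i - 1))) (modes ts)"
proof (intro fits_modes)
  fix i assume i: "i \<in> set (modes ts)"
  then have "ds ! i = r (ts ! (i - 1))"
    using assms(2,3) by (cases ds) (auto simp: set_modes nth_Cons')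
  then show "basis C (ts ! (i - 1)) \<in> carrier_mat (tree_dim n (ts ! (i - 1))) (ds ! i)"
    using basis_carrier[OF assms(1)[OF mode_nth_mem[OF i]]] by simp
qed (use assms in simp)

section \<open>Gram matrices between the bases of two networks\<close>

definition gram :: "'l factors \<Rightarrow> 'l factors \<Rightarrow> 'l tree \<Rightarrow> real mat" where
  "gram C Z \<sigma> = (basis C \<sigma>)\<^sup>T * basis Z \<sigma>"

lemma gram_carrier:
  "ttn_factors n r \<sigma> C \<Longrightarrow> ttn_factors n s \<sigma> Z \<Longrightarrow> gram C Z \<sigma> \<in> carrier_mat (r \<sigma>) (s \<sigma>)"
  using basis_carrier[of n r \<sigma> C] basis_carrier[of n s \<sigma> Z] by (auto simp: gram_def)

lemma gram_Leaf:
  assumes "ttn_factors n r (Leaf l) C" "ttn_factors n s (Leaf l) Z"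
  shows "gram C Z (Leaf l) = Mat 1 (C (Leaf l)) * (Mat 1 (Z (Leaf l)))\<^sup>T"
  using ttn_factorsD[OF assms(1)] ttn_factorsD[OF assms(2)]
  by (simp add: gram_def basis_def Mat_1_2[simplified])

lemma fits_gram:
  assumes "\<And>\<sigma>. \<sigma> \<in> set ts \<Longrightarrow> ttn_factors n r \<sigma> C" "\<And>\<sigma>. \<sigma> \<in> set ts \<Longrightarrow> ttn_factors n s \<sigma> Z"
    "length ds = Suc (length ts)" "tl ds = map s ts"
  shows "fits ds (\<lambda>i. gram C Z (ts ! (i - 1))) (\<lambda>i. r (ts ! (i - 1))) (modes ts)"
proof (intro fits_modes)
  fix i assume i: "i \<in> set (modes ts)"
  then have "ds ! i = s (ts ! (i - 1))"
    using assms(3,4) by (cases ds) (auto simp: set_modes nth_Cons')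
  then show "gram C Z (ts ! (i - 1)) \<in> carrier_mat (r (ts ! (i - 1))) (ds ! i)"
    using gram_carrier[OF assms(1)[OF mode_nth_mem[OF i]] assms(2)[OF mode_nth_mem[OF i]]] by simp
qed (use assms in simp)

lemma ttn_factors_children:
  "ttn_factors n r (Node ts) C \<Longrightarrow> \<sigma> \<in> set ts \<Longrightarrow> ttn_factors n r \<sigma> C"
  using ttn_factors_subtree[OF _ child_subtree] .

text \<open>One computation for two purposes: \<open>i = 0\<close> yields the recursion for Gram
  matrices, \<open>i \<ge> 1\<close> the small matrix left by a restriction. The bases of
  \<open>C\<close> are moved to the other factor, where they meet those of \<open>Z\<close>, so that
  only tensors of the size of connection tensors remain. Mode 0 is contracted unless
  \<open>i = 0\<close>; hence the condition on \<open>b\<close>.\<close>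

lemma contraction_ttn:
  assumes C: "ttn_factors n r (Node ts) C" and Z: "ttn_factors n s (Node ts) Z"
    and B: "B \<in> carrier_tensor (b # map s ts)" and A: "A \<in> carrier_tensor (r (Node ts) # map r ts)"
    and i: "i \<notin> set is" "i \<le> length ts" and "is": "is = filter (\<lambda>j. j \<noteq> i) (modes ts)"
    and b: "i = 0 \<or> b = r (Node ts)"
  shows "Mat i (mode_prods A (\<lambda>j. basis C (ts ! (j - 1))) is) *
      (Mat i (mode_prods B (\<lambda>j. basis Z (ts ! (j - 1))) is))\<^sup>T =
    Mat i A * (Mat i (mode_prods B (\<lambda>j. gram C Z (ts ! (j - 1))) is))\<^sup>T"
proof -
  let ?U = "\<lambda>j. basis C (ts ! (j - 1))" and ?W = "\<lambda>j. basis Z (ts ! (j - 1))"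
  let ?d = "\<lambda>j. tree_dim n (ts ! (j - 1))"
  let ?ds = "r (Node ts) # map r ts" and ?ds' = "b # map s ts"
  let ?dd = "upd_dims ?ds' ?d (set is)"
  have fU: "fits ?ds ?U ?d is"
    unfolding "is" using ttn_factors_children[OF C] by (intro fits_filter fits_basis) auto
  have fW: "fits ?ds' ?W ?d is"
    unfolding "is" using ttn_factors_children[OF Z] by (intro fits_filter fits_basis) auto
  have sub: "set is \<subseteq> {1..length ts}" using "is" by (auto simp: set_modes)
  have f: "fits ?ds ?U (\<lambda>j. ?dd ! j) is"
    using fU sub by (auto simp: fits_def nth_upd_dims)
  have UT: "(?U i)\<^sup>T \<in> carrier_mat (r (ts ! (i - 1))) (?d i)" if "i \<in> set is" for i
    using fU that sub by (fastforce simp: fits_def nth_Cons' set_modes)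
  have "Mat i (mode_prods A ?U is) * (Mat i (mode_prods B ?W is))\<^sup>T =
      Mat i A * (Mat i (mode_prods (mode_prods B ?W is) (\<lambda>j. (?U j)\<^sup>T) is))\<^sup>T"
    using i sub "is" b
    by (intro contraction_mode_prods[OF A mode_prods_carrier[OF B fW]] f)
       (auto simp: nth_upd_dims nth_Cons' set_modes)
  also have "mode_prods (mode_prods B ?W is) (\<lambda>j. (?U j)\<^sup>T) is = mode_prods B (\<lambda>j. (?U j)\<^sup>T * ?W j) is"
    using UT by (rule mode_prods_mode_prods[OF B fW])
  finally show ?thesis by (simp add: gram_def)
qed

lemma gram_Node:
  assumes C: "ttn_factors n r (Node ts) C" and Z: "ttn_factors n s (Node ts) Z"
  shows "gram C Z (Node ts) =
    Mat 0 (C (Node ts)) * (Mat 0 (mode_prods (Z (Node ts)) (\<lambda>j. gram C Z (ts ! (j - 1))) (modes ts)))\<^sup>T"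
proof -
  have "filter (\<lambda>j. j \<noteq> 0) (modes ts) = modes ts" by (intro filter_True) (auto simp: set_modes)
  then show ?thesis
    using contraction_ttn[OF C Z _ _ _ _ refl, of "Z (Node ts)" "s (Node ts)" "C (Node ts)" 0]
      ttn_factorsD[OF C] ttn_factorsD[OF Z]
    by (simp add: gram_def basis_def[of _ "Node ts"] ttn_Node set_modes)
qed

section \<open>Dependence on factors, and disjointness of subtrees\<close>

lemma ttn_cong:
  "(\<And>\<rho>. \<rho> \<in> subtrees \<sigma> \<Longrightarrow> A \<rho> = B \<rho>) \<Longrightarrow> ttn A \<sigma> = ttn B \<sigma>"
proof (induction \<sigma>)
  case (Node ts)
  have "basis A (ts ! (i - 1)) = basis B (ts ! (i - 1))" if "i \<in> set (modes ts)" for i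
    unfolding basis_def using Node.IH[OF mode_nth_mem[OF that]] Node.prems mode_nth_mem[OF that]
    by (metis child_subtree subtrees_trans)
  then show ?case
    unfolding ttn_Node using Node.prems[of "Node ts"] by (auto intro: mode_prods_cong)
qed simp

lemma basis_cong:
  "(\<And>\<rho>. \<rho> \<in> subtrees \<sigma> \<Longrightarrow> A \<rho> = B \<rho>) \<Longrightarrow> basis A \<sigma> = basis B \<sigma>"
  unfolding basis_def using ttn_cong[of \<sigma> A B] by simp

lemma basis_update: "\<rho> \<notin> subtrees \<sigma> \<Longrightarrow> basis (C(\<rho> := x)) \<sigma> = basis C \<sigma>"
  by (rule basis_cong) auto

lemma ttn_update: "\<rho> \<notin> subtrees \<sigma> \<Longrightarrow> ttn (C(\<rho> := x)) \<sigma> = ttn C \<sigma>"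
  by (rule ttn_cong) auto

lemma ttn_factors_update:
  "ttn_factors n r \<tau> C \<Longrightarrow> x \<in> carrier_tensor (factor_dims n r \<rho>) \<Longrightarrow> ttn_factors n r \<tau> (C(\<rho> := x))"
  by (auto simp: ttn_factors_def)

lemma size_subtree: "\<rho> \<in> subtrees \<sigma> \<Longrightarrow> size \<rho> \<le> size \<sigma>"
proof (induction \<sigma>)
  case (Node ts)
  show ?case
  proof (cases "\<rho> = Node ts")
    case False
    then obtain \<sigma> where s: "\<sigma> \<in> set ts" "\<rho> \<in> subtrees \<sigma>" using Node.prems by auto
    then have "size \<rho> \<le> size \<sigma>" by (rule Node.IH)
    also have "size \<sigma> \<le> size_list size ts" using s(1) by (rule size_list_estimation') simp
    finally show ?thesis by simp
  qed simp
qed simp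

text \<open>A size argument. Since factors are indexed by trees, it is what keeps an update of the
  connection tensor at \<open>Node ts\<close> away from the bases of the children.\<close>

lemma Node_notin_child: "\<sigma> \<in> set ts \<Longrightarrow> Node ts \<notin> subtrees \<sigma>"
proof
  assume "\<sigma> \<in> set ts" "Node ts \<in> subtrees \<sigma>"
  then have "size (Node ts) \<le> size \<sigma>" "size \<sigma> \<le> size_list size ts"
    by (blast intro: size_subtree size_list_estimation'[OF _ order_refl])+
  then show False by simp
qed

lemma is_tree_child: "is_tree (Node ts) \<Longrightarrow> \<sigma> \<in> set ts \<Longrightarrow> is_tree \<sigma>"
  by (auto simp: list_all_iff)

lemma is_tree_subtree: "is_tree \<tau> \<Longrightarrow> \<sigma> \<in> subtrees \<tau> \<Longrightarrow> is_tree \<sigma>"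
  by (induction \<tau>) (auto simp: list_all_iff)

lemma leaves_nonempty: "is_tree \<tau> \<Longrightarrow> leaves \<tau> \<noteq> {}"
proof (induction \<tau>)
  case (Node ts)
  then have "ts \<noteq> []" by auto
  then show ?case using Node.IH[of "hd ts"] Node.prems is_tree_child[OF Node.prems, of "hd ts"] by auto
qed simp

lemma leaves_subtree: "\<sigma> \<in> subtrees \<tau> \<Longrightarrow> leaves \<sigma> \<subseteq> leaves \<tau>"
  by (induction \<tau>) auto

text \<open>Factors are indexed by trees and not by positions, so equal subtrees of two siblings
  would share a factor. Such a subtree would have a leaf, and siblings have no leaf in
  common.\<close>

lemma children_disjoint:
  assumes "is_tree (Node ts)" "i < length ts" "j < length ts" "i \<noteq> j"
  shows "subtrees (ts ! i) \<inter> subtrees (ts ! j) = {}"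
proof -
  have "leaves (ts ! i) \<inter> leaves (ts ! j) = {}"
    using assms by (cases i j rule: linorder_cases) (auto simp: Int_commute)
  moreover have "leaves \<rho> \<noteq> {}" if "\<rho> \<in> subtrees (ts ! i)" for \<rho>
    using leaves_nonempty[OF is_tree_subtree[OF is_tree_child[OF assms(1)] that]] assms(2) by simp
  ultimately show ?thesis using leaves_subtree by fastforce
qed

text \<open>Extracting the \<open>i\<close>th basis from \<open>ttn A (Node ts)\<close> leaves the
  transpose of \<open>V\<close> as the other matrix factor. A prolongation therefore only adds the
  siblings and the connection tensor from which \<open>V\<close> was built.\<close>

lemma prol_ttn:
  assumes A: "ttn_factors n r (Node ts) A" and i: "i \<in> set (modes ts)"
    and V: "V = (Mat i (mode_prods (A (Node ts)) (\<lambda>j. basis A (ts ! (j - 1))) (filter (\<lambda>j. j \<noteq> i) (modes ts))))\<^sup>T"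
  shows "prol V i (ttn_dims n r (Node ts)) (ttn A (ts ! (i - 1))) = ttn A (Node ts)"
proof -
  let ?U = "\<lambda>j. basis A (ts ! (j - 1))" and ?is = "filter (\<lambda>j. j \<noteq> i) (modes ts)"
  let ?ds = "r (Node ts) # map r ts"
  let ?B = "mode_prods (A (Node ts)) ?U ?is"
  have c: "A (Node ts) \<in> carrier_tensor ?ds" using ttn_factorsD[OF A] by simp
  have f: "fits ?ds ?U (\<lambda>j. tree_dim n (ts ! (j - 1))) (modes ts)"
    using ttn_factors_children[OF A] by (intro fits_basis) auto
  define db where "db = upd_dims ?ds (\<lambda>j. tree_dim n (ts ! (j - 1))) (set ?is)"
  have B: "?B \<in> carrier_tensor db"
    unfolding db_def by (rule mode_prods_carrier[OF c fits_filter[OF f]])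
  have dbi: "db ! i = r (ts ! (i - 1))" using i by (auto simp: db_def nth_upd_dims set_modes nth_Cons')
  have U: "?U i \<in> carrier_mat (tree_dim n (ts ! (i - 1))) (db ! i)"
    using f i by (auto simp: dbi intro!: basis_carrier ttn_factors_children[OF A] mode_nth_mem[simplified])
  have e: "ttn A (Node ts) = mode_prod i ?B (?U i)"
    unfolding ttn_Node using mode_prods_extract[OF c f i] .
  also have "\<dots> = Ten i (db[i := tree_dim n (ts ! (i - 1))]) (?U i * Mat i ?B)"
    using B U by (rule mode_prod_Mat_eq)
  also have "db[i := tree_dim n (ts ! (i - 1))] = ttn_dims n r (Node ts)"
    using carrier_tensorD[OF mode_prod_carrier[OF B U, of i]] carrier_tensorD[OF ttn_carrier[OF A]]
    unfolding e by simp
  also have "?U i * Mat i ?B = (V * Mat 0 (ttn A (ts ! (i - 1))))\<^sup>T"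
    using U dim_Mat[OF B, of i] unfolding V basis_def
    by (simp add: transpose_mult[of _ "prod_list (drop_nth i db)" "db ! i" _ "tree_dim n (ts ! (i - 1))"])
  finally show ?thesis by (simp add: prol_def)
qed


text \<open>The restriction contracts, over tensors of full size, every mode except \<open>i\<close>
  against the network of \<open>A\<close>. By \<open>contraction_ttn\<close> this collapses to
  \<open>K'\<close>, while the basis of \<open>Z\<close> in mode \<open>i\<close> stays outside. The
  form "network times a small matrix at the root" is thus reproduced one level below.\<close>

lemma restr_ttn:
  assumes A: "ttn_factors n r (Node ts) A" and Z: "ttn_factors n s (Node ts) Z" and i: "i \<in> set (modes ts)"
    and K: "K \<in> carrier_mat (r (Node ts)) (s (Node ts))"
    and V: "V = (Mat i (mode_prods (A (Node ts)) (\<lambda>j. basis A (ts ! (j - 1))) (filter (\<lambda>j. j \<noteq> i) (modes ts))))\<^sup>T"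
    and K': "K' = Mat i (A (Node ts)) * (Mat i (mode_prod 0 (mode_prods (Z (Node ts))
      (\<lambda>j. gram A Z (ts ! (j - 1))) (filter (\<lambda>j. j \<noteq> i) (modes ts))) K))\<^sup>T"
  shows "restr V i (ttn_dims n r (ts ! (i - 1))) (mode_prod 0 (ttn Z (Node ts)) K) =
      mode_prod 0 (ttn Z (ts ! (i - 1))) K'" (is ?eq)
    and "K' \<in> carrier_mat (r (ts ! (i - 1))) (s (ts ! (i - 1)))" (is ?car)
proof -
  let ?U = "\<lambda>j. basis A (ts ! (j - 1))" and ?W = "\<lambda>j. basis Z (ts ! (j - 1))"
  let ?G = "\<lambda>j. gram A Z (ts ! (j - 1))"
  let ?is = "filter (\<lambda>j. j \<noteq> i) (modes ts)" and ?\<sigma> = "ts ! (i - 1)"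
  let ?dr = "r (Node ts) # map r ts" and ?ds = "s (Node ts) # map s ts" and ?db = "r (Node ts) # map s ts"
  let ?d = "\<lambda>j. tree_dim n (ts ! (j - 1))"
  let ?B = "mode_prod 0 (Z (Node ts)) K"
  have \<sigma>: "?\<sigma> \<in> set ts" using i by (rule mode_nth_mem)
  have i': "1 \<le> i" "i \<le> length ts" using i by (auto simp: set_modes)
  have cA: "A (Node ts) \<in> carrier_tensor ?dr" using ttn_factorsD[OF A] by simp
  have cZ: "Z (Node ts) \<in> carrier_tensor ?ds" using ttn_factorsD[OF Z] by simp
  have cB: "?B \<in> carrier_tensor ?db" using mode_prod_carrier[OF cZ K, of 0] by simp
  have fW: "fits ?ds ?W ?d (modes ts)" using ttn_factors_children[OF Z] by (intro fits_basis) auto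
  have fWb: "fits ?db ?W ?d (modes ts)" using ttn_factors_children[OF Z] by (intro fits_basis) auto
  have fU: "fits ?dr ?U ?d (modes ts)" using ttn_factors_children[OF A] by (intro fits_basis) auto
  have fG: "fits ?ds ?G (\<lambda>j. r (ts ! (j - 1))) (modes ts)"
    using ttn_factors_children[OF A] ttn_factors_children[OF Z] by (intro fits_gram) auto
  have fGb: "fits ?db ?G (\<lambda>j. r (ts ! (j - 1))) (modes ts)"
    using ttn_factors_children[OF A] ttn_factors_children[OF Z] by (intro fits_gram) auto
  have "mode_prod 0 (mode_prods (Z (Node ts)) ?G ?is) K = mode_prods ?B ?G ?is"
    using K by (intro mode_prods_commute[OF cZ fits_filter[OF fG]]) (auto simp: set_modes)
  then have K'_eq: "K' = Mat i (A (Node ts)) * (Mat i (mode_prods ?B ?G ?is))\<^sup>T" unfolding K' by simp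
  have cBG: "mode_prods ?B ?G ?is \<in> carrier_tensor (upd_dims ?db (\<lambda>j. r (ts ! (j - 1))) (set ?is))"
    by (rule mode_prods_carrier[OF cB fits_filter[OF fGb]])
  show ?car
    using dim_Mat[OF cA, of i] dim_Mat[OF cBG, of i] i'
    by (auto simp: K'_eq nth_upd_dims set_modes nth_Cons')
  define BW where "BW = mode_prods ?B ?W ?is"
  define dw where "dw = upd_dims ?db ?d (set ?is)"
  have BW: "BW \<in> carrier_tensor dw" unfolding BW_def dw_def
    by (rule mode_prods_carrier[OF cB fits_filter[OF fWb]])
  have dwi: "dw ! i = s ?\<sigma>" using i' by (auto simp: dw_def nth_upd_dims set_modes nth_Cons')
  have lw: "length dw = Suc (length ts)" by (simp add: dw_def)
  have W: "?W i \<in> carrier_mat (?d i) (dw ! i)"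
    unfolding dwi by (intro basis_carrier ttn_factors_children[OF Z] \<sigma>)
  have "mode_prod 0 (ttn Z (Node ts)) K = mode_prods ?B ?W (modes ts)"
    unfolding ttn_Node using K by (intro mode_prods_commute[OF cZ fW]) (auto simp: set_modes)
  also have "\<dots> = mode_prod i BW (?W i)"
    unfolding BW_def by (rule mode_prods_extract[OF cB fWb i])
  finally have Zf: "Mat i (mode_prod 0 (ttn Z (Node ts)) K) = ?W i * Mat i BW"
    using Mat_mode_prod[OF BW _ W] i' lw by simp
  define AU where "AU = mode_prods (A (Node ts)) ?U ?is"
  define da where "da = upd_dims ?dr ?d (set ?is)"
  have AU: "AU \<in> carrier_tensor da" unfolding AU_def da_def
    by (rule mode_prods_carrier[OF cA fits_filter[OF fU]])
  have dai: "da ! i = r ?\<sigma>" using i' by (auto simp: da_def nth_upd_dims set_modes nth_Cons')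
  have dd: "drop_nth i da = drop_nth i dw"
    unfolding da_def dw_def by (rule drop_nth_eqI) (auto simp: nth_upd_dims set_modes nth_Cons')
  have con: "Mat i AU * (Mat i BW)\<^sup>T = K'"
    unfolding AU_def BW_def K'_eq using i' by (intro contraction_ttn[OF A Z cB cA]) auto
  have "(Mat i (mode_prod 0 (ttn Z (Node ts)) K) * V)\<^sup>T = (?W i * Mat i BW * (Mat i AU)\<^sup>T)\<^sup>T"
    unfolding Zf V AU_def ..
  also have "\<dots> = Mat i AU * ((Mat i BW)\<^sup>T * (?W i)\<^sup>T)"
    using W dim_Mat[OF BW, of i] dim_Mat[OF AU, of i] dd
    by (subst transpose_mult[of _ "?d i" "prod_list (drop_nth i dw)" _ "da ! i"])
       (auto simp: transpose_mult[of _ "?d i" "dw ! i" _ "prod_list (drop_nth i dw)"])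
  also have "\<dots> = K' * (?W i)\<^sup>T"
    unfolding con[symmetric]
    using W dim_Mat[OF BW, of i] dim_Mat[OF AU, of i] dd
    by (simp add: assoc_mult_mat[of _ "da ! i" "prod_list (drop_nth i dw)" _ "dw ! i" _ "?d i"])
  finally have R: "(Mat i (mode_prod 0 (ttn Z (Node ts)) K) * V)\<^sup>T = K' * Mat 0 (ttn Z ?\<sigma>)"
    by (simp add: basis_def)
  have t: "ttn Z ?\<sigma> \<in> carrier_tensor (ttn_dims n s ?\<sigma>)"
    by (intro ttn_carrier ttn_factors_children[OF Z] \<sigma>)
  have "ttn_dims n s ?\<sigma> ! 0 = s ?\<sigma>" "(ttn_dims n s ?\<sigma>)[0 := r ?\<sigma>] = ttn_dims n r ?\<sigma>"
    by (cases ?\<sigma>; simp)+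
  then show ?eq
    using mode_prod_Mat_eq[OF t, of K' "r ?\<sigma>" 0] \<open>?car\<close> by (simp add: restr_def R)
qed

type_synonym 'l path = "('l tree list \<times> nat) list"

text \<open>Paths are read from the subtree up to the root.\<close>

fun is_path :: "'l tree \<Rightarrow> 'l path \<Rightarrow> 'l tree \<Rightarrow> bool" where
  "is_path \<tau> [] \<sigma> \<longleftrightarrow> \<sigma> = \<tau>"
| "is_path \<tau> ((ts, i) # p) \<sigma> \<longleftrightarrow> i \<in> set (modes ts) \<and> \<sigma> = ts ! (i - 1) \<and> is_path \<tau> p (Node ts)"

lemma is_path_subtree: "is_path \<tau> p \<sigma> \<Longrightarrow> \<sigma> \<in> subtrees \<tau>"
proof (induction \<tau> p \<sigma> rule: is_path.induct)
  case (2 \<tau> ts i p \<sigma>)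
  then have "\<sigma> \<in> subtrees (Node ts)" using child_subtree[OF mode_nth_mem] by fastforce
  then show ?case using 2 by (auto intro: subtrees_trans simp del: subtrees.simps)
qed simp

text \<open>The projections accumulated on the way from the root to a subtree act on an evaluation
  with factors \<open>Z\<close> of the right-hand side as one small matrix multiplied to the root of the
  corresponding part of \<open>Z\<close>.\<close>

fun path_mat :: "'l path \<Rightarrow> 'l factors \<Rightarrow> 'l factors \<Rightarrow> real mat" where
  "path_mat [] A Z = 1\<^sub>m 1"
| "path_mat ((ts, i) # p) A Z = Mat i (A (Node ts)) * (Mat i (mode_prod 0 (mode_prods (Z (Node ts))
      (\<lambda>j. gram A Z (ts ! (j - 1))) (filter (\<lambda>j. j \<noteq> i) (modes ts))) (path_mat p A Z)))\<^sup>T"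

lemma path_mat_carrier:
  assumes "ttn_factors n r \<tau> A" "ttn_factors n s \<tau> Z" "r \<tau> = 1" "s \<tau> = 1" "is_path \<tau> p \<sigma>"
  shows "path_mat p A Z \<in> carrier_mat (r \<sigma>) (s \<sigma>)"
  using assms(5)
proof (induction p arbitrary: \<sigma>)
  case (Cons x p)
  obtain ts i where x: "x = (ts, i)" by force
  have "Node ts \<in> subtrees \<tau>" using Cons.prems is_path_subtree by (auto simp: x)
  then show ?case
    using restr_ttn(2)[of n r ts A s Z i, OF ttn_factors_subtree[OF assms(1)] ttn_factors_subtree[OF assms(2)]
        _ Cons.IH refl refl] Cons.prems by (simp add: x)
qed (use assms in simp)

text \<open>The interface between right-hand sides as functions of full tensors and the factors seen
  by a program. The factors outside \<open>\<sigma>\<close> are frozen to those of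
  \<open>A0\<close>; the ones inside are arbitrary, because the arguments that a solver will choose
  are not known beforehand.\<close>

definition represents :: "('l \<Rightarrow> nat) \<Rightarrow> ('l tree \<Rightarrow> nat) \<Rightarrow> 'l tree \<Rightarrow>
    (real \<Rightarrow> 'l factors \<Rightarrow> 'l factors) \<Rightarrow> 'l path \<Rightarrow> 'l tree \<Rightarrow> (real \<Rightarrow> tensor \<Rightarrow> tensor) \<Rightarrow> 'l factors \<Rightarrow> bool" where
  "represents n r \<tau> ev p \<sigma> f A0 \<longleftrightarrow> (\<forall>t A. ttn_factors n r \<tau> A \<longrightarrow>
     (\<forall>\<rho>\<in>subtrees \<tau> - subtrees \<sigma>. A \<rho> = A0 \<rho>) \<longrightarrow>
     f t (ttn A \<sigma>) = mode_prod 0 (ttn (ev t A) \<sigma>) (path_mat p A (ev t A)))"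

lemma represents_cong:
  "(\<And>\<rho>. \<rho> \<in> subtrees \<tau> - subtrees \<sigma> \<Longrightarrow> A \<rho> = B \<rho>) \<Longrightarrow>
    represents n r \<tau> ev p \<sigma> f A \<longleftrightarrow> represents n r \<tau> ev p \<sigma> f B"
  by (simp add: represents_def)

lemma represents_child:
  assumes tree: "is_tree \<tau>" and root: "r \<tau> = 1" "s \<tau> = 1"
    and ev: "\<And>t A. ttn_factors n r \<tau> A \<Longrightarrow> ttn_factors n s \<tau> (ev t A)"
    and p: "is_path \<tau> p (Node ts)" and i: "i \<in> set (modes ts)"
    and C: "ttn_factors n r \<tau> C" and rep: "represents n r \<tau> ev p (Node ts) f C"
    and V: "V = prol_mat C ts i Q"
    and C': "C' = C(Node ts := Ten i (dims (C (Node ts))) (Q\<^sup>T))"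
  shows "represents n r \<tau> ev ((ts, i) # p) (ts ! (i - 1)) (\<lambda>t Y. restr V i (dims (ttn C (ts ! (i - 1))))
      (f t (prol V i (dims (ttn C (Node ts))) Y))) C'"
  unfolding represents_def
proof (intro allI impI)
  fix t A assume A: "ttn_factors n r \<tau> A" and eq: "\<forall>\<rho>\<in>subtrees \<tau> - subtrees (ts ! (i - 1)). A \<rho> = C' \<rho>"
  let ?\<sigma> = "ts ! (i - 1)" and ?N = "Node ts"
  have \<sigma>: "?\<sigma> \<in> set ts" using i by (rule mode_nth_mem)
  have N: "?N \<in> subtrees \<tau>" using p by (rule is_path_subtree)
  have treeN: "is_tree ?N" using tree N by (rule is_tree_subtree)
  note Z = ev[OF A, of t]
  have b: "basis A (ts ! (j - 1)) = basis C (ts ! (j - 1))" if j: "j \<in> set (modes ts)" "j \<noteq> i" for j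
  proof (rule basis_cong)
    fix \<rho> assume \<rho>: "\<rho> \<in> subtrees (ts ! (j - 1))"
    have "\<rho> \<notin> subtrees ?\<sigma>"
    proof -
      have "j - 1 \<noteq> i - 1" "j - 1 < length ts" "i - 1 < length ts" using i j by (auto simp: set_modes)
      then show ?thesis using children_disjoint[OF treeN, of "j - 1" "i - 1"] \<rho> by blast
    qed
    moreover have "\<rho> \<in> subtrees ?N" using \<rho> mode_nth_mem[OF j(1)] by auto
    then have "\<rho> \<in> subtrees \<tau>" using N by (rule subtrees_trans)
    moreover have "\<rho> \<noteq> ?N" using \<rho> Node_notin_child[OF mode_nth_mem[OF j(1)]] by auto
    ultimately show "A \<rho> = C \<rho>" using eq by (simp add: C')
  qed
  have AN: "A ?N = Ten i (dims (C ?N)) (Q\<^sup>T)"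
    using eq N Node_notin_child[OF \<sigma>] by (simp add: C')
  have V': "V = (Mat i (mode_prods (A ?N) (\<lambda>j. basis A (ts ! (j - 1))) (filter (\<lambda>j. j \<noteq> i) (modes ts))))\<^sup>T"
    unfolding V prol_mat_def AN using b
    by (intro arg_cong[where f = "\<lambda>X. (Mat i X)\<^sup>T"] mode_prods_cong) simp
  have dN: "dims (ttn C ?N) = ttn_dims n r ?N" "dims (ttn C ?\<sigma>) = ttn_dims n r ?\<sigma>"
    using ttn_carrier[OF ttn_factors_subtree[OF C N]]
      ttn_carrier[OF ttn_factors_children[OF ttn_factors_subtree[OF C N] \<sigma>]]
    by (auto dest: carrier_tensorD)
  have "prol V i (dims (ttn C ?N)) (ttn A ?\<sigma>) = ttn A ?N"
    unfolding dN by (rule prol_ttn[OF ttn_factors_subtree[OF A N] i V'])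
  moreover have "f t (ttn A ?N) = mode_prod 0 (ttn (ev t A) ?N) (path_mat p A (ev t A))"
  proof -
    have "\<forall>\<rho>\<in>subtrees \<tau> - subtrees ?N. A \<rho> = C \<rho>"
      using eq \<sigma> by (auto simp: C')
    then show ?thesis using rep A by (simp add: represents_def del: subtrees.simps)
  qed
  ultimately show "restr V i (dims (ttn C ?\<sigma>)) (f t (prol V i (dims (ttn C ?N)) (ttn A ?\<sigma>))) =
      mode_prod 0 (ttn (ev t A) ?\<sigma>) (path_mat ((ts, i) # p) A (ev t A))"
    using restr_ttn(1)[OF ttn_factors_subtree[OF A N] ttn_factors_subtree[OF Z N] i
        path_mat_carrier[OF A Z root p] V' refl]
    by (simp add: dN[simplified])
qed

section \<open>Projected right-hand sides in terms of factors\<close>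

lemma ttn_factors_mult_root:
  assumes "ttn_factors n r \<sigma> C" "M \<in> carrier_mat (r \<sigma>) (r \<sigma>)"
  shows "mult_root \<sigma> M C = C(\<sigma> := mode_prod (case \<sigma> of Leaf l \<Rightarrow> 1 | Node ts \<Rightarrow> 0) (C \<sigma>) M)" (is ?e)
    and "mult_root \<sigma> M C \<sigma> \<in> carrier_tensor (factor_dims n r \<sigma>)" (is ?c)
proof -
  show ?e by (cases \<sigma>) auto
  show ?c using ttn_factorsD[OF assms(1)] assms(2)
    by (cases \<sigma>) (auto simp: intro!: mode_prod_carrier'[where q = "r \<sigma>"])
qed

text \<open>Hence the initial value passed to a child and the argument of the backward equation for
  \<open>S\<close> are networks again: the factor at the root absorbs the matrix.\<close>

lemma ttn_mult_root:
  assumes C: "ttn_factors n r \<sigma> C" and M: "M \<in> carrier_mat (r \<sigma>) (r \<sigma>)"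
  shows "ttn (mult_root \<sigma> M C) \<sigma> = mode_prod 0 (ttn C \<sigma>) M"
proof (cases \<sigma>)
  case (Leaf l)
  have c: "C (Leaf l) \<in> carrier_tensor [n l, r (Leaf l)]" using ttn_factorsD[OF C] by (simp add: Leaf)
  have m: "Mat 0 (C (Leaf l)) \<in> carrier_mat (n l) (r (Leaf l))" using c by (rule dim_Mat_0_2)
  have t: "of_mat ((Mat 0 (C (Leaf l)))\<^sup>T) \<in> carrier_tensor [r (Leaf l), n l]"
    using m by (intro of_mat_carrier) simp
  show ?thesis
    using M m mode_prod_1_2[OF c, of M "r (Leaf l)"] mode_prod_0_2[OF t, of M "r (Leaf l)"]
    by (simp add: Leaf transpose_mult[of _ "n l" "r (Leaf l)" _ "r (Leaf l)"])
next
  case (Node ts)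
  have c: "C (Node ts) \<in> carrier_tensor (r (Node ts) # map r ts)" using ttn_factorsD[OF C] by (simp add: Node)
  have f: "fits (r (Node ts) # map r ts) (\<lambda>j. basis C (ts ! (j - 1))) (\<lambda>j. tree_dim n (ts ! (j - 1))) (modes ts)"
    using ttn_factors_children[OF C[unfolded Node]] by (intro fits_basis) auto
  have "ttn (mult_root \<sigma> M C) \<sigma> = mode_prods (mode_prod 0 (C (Node ts)) M) (\<lambda>j. basis C (ts ! (j - 1))) (modes ts)"
    unfolding Node ttn_Node
    by (auto intro!: mode_prods_cong basis_update Node_notin_child[OF mode_nth_mem] simp del: One_nat_def)
  also have "\<dots> = mode_prod 0 (ttn C \<sigma>) M"
    unfolding Node ttn_Node using M
    by (intro mode_prods_commute[OF c f, symmetric]) (auto simp: Node set_modes)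
  finally show ?thesis .
qed

text \<open>Up to the sign, the left-hand side is the right-hand side of the backward equation for
  \<open>S\<close>. Only two small matrices remain of it.\<close>

lemma gram_path:
  assumes A: "ttn_factors n r \<sigma> A" and Z: "ttn_factors n s \<sigma> Z" and K: "K \<in> carrier_mat (r \<sigma>) (s \<sigma>)"
  shows "(basis A \<sigma>)\<^sup>T * (Mat 0 (mode_prod 0 (ttn Z \<sigma>) K))\<^sup>T = gram A Z \<sigma> * K\<^sup>T"
proof -
  have t: "ttn Z \<sigma> \<in> carrier_tensor (ttn_dims n s \<sigma>)" using Z by (rule ttn_carrier)
  have K': "K \<in> carrier_mat (r \<sigma>) (ttn_dims n s \<sigma> ! 0)" using K by (cases \<sigma>) auto
  have "Mat 0 (mode_prod 0 (ttn Z \<sigma>) K) = K * Mat 0 (ttn Z \<sigma>)"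
    using t K' by (intro Mat_mode_prod) (auto split: tree.splits, cases \<sigma>, auto)
  moreover have "Mat 0 (ttn Z \<sigma>) \<in> carrier_mat (s \<sigma>) (tree_dim n \<sigma>)"
    using basis_carrier[OF Z] by (simp add: basis_def)
  ultimately show ?thesis
    using basis_carrier[OF A] K
    by (simp add: gram_def basis_def transpose_mult[of _ "r \<sigma>" "s \<sigma>" _ "tree_dim n \<sigma>"]
        assoc_mult_mat[of _ "r \<sigma>" "tree_dim n \<sigma>" _ "s \<sigma>" _ "r \<sigma>"])
qed

text \<open>In \<open>Psi\<close>, bases of the argument meet bases of the result in every mode from
  1 on, and each encounter is a Gram matrix; mode 0 carries the accumulated projection
  \<open>K\<close>.\<close>

lemma Psi_rhs:
  assumes A: "ttn_factors n r (Node ts) A" and Z: "ttn_factors n s (Node ts) Z"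
    and K: "K \<in> carrier_mat (r (Node ts)) (s (Node ts))"
  shows "mode_prods (mode_prod 0 (ttn Z (Node ts)) K) (\<lambda>i. (basis A (ts ! (i - 1)))\<^sup>T) (modes ts) =
    mode_prod 0 (mode_prods (Z (Node ts)) (\<lambda>i. gram A Z (ts ! (i - 1))) (modes ts)) K"
proof -
  let ?ds = "s (Node ts) # map s ts" and ?db = "r (Node ts) # map s ts"
  let ?W = "\<lambda>j. basis Z (ts ! (j - 1))" and ?d = "\<lambda>j. tree_dim n (ts ! (j - 1))"
  let ?B = "mode_prod 0 (Z (Node ts)) K"
  have cZ: "Z (Node ts) \<in> carrier_tensor ?ds" using ttn_factorsD[OF Z] by simp
  have cB: "?B \<in> carrier_tensor ?db" using mode_prod_carrier[OF cZ K, of 0] by simp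
  have fW: "fits ?ds ?W ?d (modes ts)" using ttn_factors_children[OF Z] by (intro fits_basis) auto
  have fWb: "fits ?db ?W ?d (modes ts)" using ttn_factors_children[OF Z] by (intro fits_basis) auto
  have fG: "fits ?ds (\<lambda>j. gram A Z (ts ! (j - 1))) (\<lambda>j. r (ts ! (j - 1))) (modes ts)"
    using ttn_factors_children[OF A] ttn_factors_children[OF Z] by (intro fits_gram) auto
  have "mode_prod 0 (ttn Z (Node ts)) K = mode_prods ?B ?W (modes ts)"
    unfolding ttn_Node using K by (intro mode_prods_commute[OF cZ fW]) (auto simp: set_modes)
  then have "mode_prods (mode_prod 0 (ttn Z (Node ts)) K) (\<lambda>i. (basis A (ts ! (i - 1)))\<^sup>T) (modes ts) =
      mode_prods ?B (\<lambda>i. (basis A (ts ! (i - 1)))\<^sup>T * ?W i) (modes ts)"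
  proof (simp only:, intro mode_prods_mode_prods[OF cB fWb])
    fix i assume i: "i \<in> set (modes ts)"
    show "(basis A (ts ! (i - 1)))\<^sup>T \<in> carrier_mat (r (ts ! (i - 1))) (?d i)"
      using basis_carrier[OF ttn_factors_children[OF A mode_nth_mem[OF i]]] by simp
  qed
  also have "\<dots> = mode_prods ?B (\<lambda>i. gram A Z (ts ! (i - 1))) (modes ts)"
    by (simp add: gram_def)
  also have "\<dots> = mode_prod 0 (mode_prods (Z (Node ts)) (\<lambda>i. gram A Z (ts ! (i - 1))) (modes ts)) K"
    using K by (intro mode_prods_commute[OF cZ fG, symmetric]) (auto simp: set_modes)
  finally show ?thesis .
qed

lemma leaf_rhs:
  assumes Z: "ttn_factors n s (Leaf l) Z" and K: "K \<in> carrier_mat q (s (Leaf l))"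
  shows "mode_prod 0 (ttn Z (Leaf l)) K = of_mat ((Mat 0 (mode_prod 1 (Z (Leaf l)) K))\<^sup>T)"
proof -
  have c: "Z (Leaf l) \<in> carrier_tensor [n l, s (Leaf l)]" using ttn_factorsD[OF Z] by simp
  have m: "Mat 0 (Z (Leaf l)) \<in> carrier_mat (n l) (s (Leaf l))" using c by (rule dim_Mat_0_2)
  have t: "of_mat ((Mat 0 (Z (Leaf l)))\<^sup>T) \<in> carrier_tensor [s (Leaf l), n l]"
    using m by (intro of_mat_carrier) simp
  show ?thesis
    using K m mode_prod_1_2[OF c K] mode_prod_0_2[OF t K]
    by (simp add: transpose_mult[of _ "n l" "s (Leaf l)" _ q])
qed


section \<open>Locality of the time step\<close>

lemma override_on_singleton: "override_on C (\<lambda>_. x) {\<rho>} = C(\<rho> := x)"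
  by (auto simp: override_on_def)

lemma override_on_update: "\<sigma> \<notin> D \<Longrightarrow> (override_on C E D)(\<sigma> := x) = override_on (C(\<sigma> := x)) E D"
  by (auto simp: override_on_def)

lemma ttn_override: "D \<inter> subtrees \<sigma> = {} \<Longrightarrow> ttn (override_on C E D) \<sigma> = ttn C \<sigma>"
  by (rule ttn_cong) (auto simp: override_on_def)

lemma basis_override: "D \<inter> subtrees \<sigma> = {} \<Longrightarrow> basis (override_on C E D) \<sigma> = basis C \<sigma>"
  by (simp add: basis_def ttn_override)

lemma mult_root_override:
  "\<sigma> \<notin> D \<Longrightarrow> mult_root \<sigma> M (override_on C E D) = override_on (mult_root \<sigma> M C) E D"
  by (cases \<sigma>) (auto simp: override_on_update)

lemma orth_root_override:
  "\<sigma> \<notin> D \<Longrightarrow> orth_root qr \<sigma> (override_on C E D) =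
    (let (C', S) = orth_root qr \<sigma> C in (override_on C' E D, S))"
  by (cases \<sigma>) (auto simp: override_on_update split: prod.splits)

lemma prol_mat_override:
  assumes "D \<inter> subtrees (Node ts) = {}"
  shows "prol_mat (override_on C E D) ts i Q = prol_mat C ts i Q"
proof -
  have "basis (override_on C E D) (ts ! (j - 1)) = basis C (ts ! (j - 1))" if "j \<in> set (modes ts)" for j
    using assms mode_nth_mem[OF that] by (intro basis_override) auto
  moreover have "Node ts \<notin> D" using assms by auto
  ultimately show ?thesis
    unfolding prol_mat_def
    by (intro arg_cong[where f = "\<lambda>X. (Mat i X)\<^sup>T"]) (auto intro!: mode_prods_cong)
qed

lemma Phi_override:
  assumes D: "D \<inter> subtrees (Node ts) = {}" and i: "i \<in> set (modes ts)"
    and sub: "\<And>g C. sub g (override_on C E D) = override_on (sub g C) E D"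
  shows "Phi qr sol ts i sub f (override_on C E D) = override_on (Phi qr sol ts i sub f C) E D"
proof -
  have 1: "Node ts \<notin> D" "D \<inter> subtrees (ts ! (i - 1)) = {}" "ts ! (i - 1) \<notin> D"
    using D mode_nth_mem[OF i] subtrees_refl[of "ts ! (i - 1)"] by (auto simp del: subtrees_refl)
  show ?thesis
    using 1 by (simp add: Phi_def Let_def prol_mat_override[OF D] mult_root_override sub orth_root_override
        ttn_override ttn_override[OF D] basis_override override_on_update split: prod.splits del: subtrees.simps)
qed

lemma Psi_override:
  assumes D: "D \<inter> subtrees (Node ts) = {}"
  shows "Psi sol ts f (override_on C E D) = override_on (Psi sol ts f C) E D"
proof -
  have b: "basis (override_on C E D) (ts ! (i - 1)) = basis C (ts ! (i - 1))" if "i \<in> set (modes ts)" for i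
    using D mode_nth_mem[OF that] by (intro basis_override) auto
  have "mode_prods A (\<lambda>i. basis (override_on C E D) (ts ! (i - 1))) (modes ts) =
      mode_prods A (\<lambda>i. basis C (ts ! (i - 1))) (modes ts)"
    "mode_prods A (\<lambda>i. (basis (override_on C E D) (ts ! (i - 1)))\<^sup>T) (modes ts) =
      mode_prods A (\<lambda>i. (basis C (ts ! (i - 1)))\<^sup>T) (modes ts)" for A
    using b by (auto intro: mode_prods_cong simp del: One_nat_def)
  moreover have "Node ts \<notin> D" using D by auto
  ultimately show ?thesis by (simp add: Psi_def Let_def override_on_update)
qed

text \<open>A step at \<open>\<sigma>\<close> neither reads nor changes factors outside its
  subtrees. This bridges two differences between program and definition: while a child is treated,
  the program already holds the orthonormalized connection tensor at the parent where
  \<open>Phi\<close> still passes on the old one; and the initial memory is empty outside the tree,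
  where \<open>C0\<close> is arbitrary.\<close>

lemma ttn_step_override:
  "D \<inter> subtrees \<sigma> = {} \<Longrightarrow>
    ttn_step qr sol \<sigma> f (override_on C E D) = override_on (ttn_step qr sol \<sigma> f C) E D"
proof (induction \<sigma> arbitrary: f C)
  case (Leaf l)
  then have "Leaf l \<notin> D" by simp
  then show ?case by (simp add: override_on_update del: fun_upd_apply)
next
  case (Node ts)
  let ?\<Phi> = "\<lambda>i. Phi qr sol ts i (map (ttn_step qr sol) ts ! (i - 1)) f"
  have P: "?\<Phi> i (override_on C E D) = override_on (?\<Phi> i C) E D" if i: "i \<in> set (modes ts)" for i C
  proof (rule Phi_override[OF Node.prems i])
    fix g C
    have "D \<inter> subtrees (ts ! (i - 1)) = {}" using Node.prems mode_nth_mem[OF i] by auto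
    moreover have "i - 1 < length ts" using i by (auto simp: set_modes)
    ultimately show "(map (ttn_step qr sol) ts ! (i - 1)) g (override_on C E D) =
        override_on ((map (ttn_step qr sol) ts ! (i - 1)) g C) E D"
      using Node.IH[OF mode_nth_mem[OF i]] by simp
  qed
  have "fold ?\<Phi> is (override_on C E D) = override_on (fold ?\<Phi> is C) E D" if "set is \<subseteq> set (modes ts)" for "is"
    using that by (induction "is" arbitrary: C) (auto simp: P simp del: One_nat_def)
  from this[OF order_refl] show ?case
    using Node.prems by (simp add: Psi_override del: subtrees.simps One_nat_def)
qed

lemma ttn_step_update:
  assumes "\<rho> \<notin> subtrees \<sigma>"
  shows "ttn_step qr sol \<sigma> f (C(\<rho> := x)) = (ttn_step qr sol \<sigma> f C)(\<rho> := x)"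
  using ttn_step_override[of "{\<rho>}" \<sigma> qr sol f C "\<lambda>_. x"] assms by (simp add: override_on_singleton)

lemma ttn_step_outside: "\<rho> \<notin> subtrees \<sigma> \<Longrightarrow> ttn_step qr sol \<sigma> f C \<rho> = C \<rho>"
  \<comment> \<open>Overwriting a factor with its own value changes nothing, so commutation with
    updates already gives invariance.\<close>
  using ttn_step_update[of \<rho> \<sigma> qr sol f C "C \<rho>"] by (metis fun_upd_same fun_upd_triv)

lemma Phi_outside:
  assumes "\<rho> \<notin> subtrees (Node ts)" "i \<in> set (modes ts)"
  shows "Phi qr sol ts i (ttn_step qr sol (ts ! (i - 1))) f C \<rho> = C \<rho>"
proof -
  have "{\<rho>} \<inter> subtrees (ts ! (i - 1)) = {}" using assms(1) mode_nth_mem[OF assms(2)] by auto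
  then have "Phi qr sol ts i (ttn_step qr sol (ts ! (i - 1))) f (override_on C (\<lambda>_. C \<rho>) {\<rho>}) =
      override_on (Phi qr sol ts i (ttn_step qr sol (ts ! (i - 1))) f C) (\<lambda>_. C \<rho>) {\<rho>}"
    using assms by (intro Phi_override ttn_step_override) auto
  then show ?thesis unfolding override_on_singleton by (metis fun_upd_same fun_upd_triv)
qed

section \<open>The program\<close>

text \<open>Registers attached to a subtree. \<open>Res\<close> receives the factor of an evaluation of \<open>F\<close>,
  \<open>Part i j\<close> is this factor after multiplication of the modes \<open>1, \<dots>, j\<close> except \<open>i\<close> with the
  matrices \<open>Gram\<close>, \<open>Proj\<close> holds \<open>path_mat\<close>, \<open>Saved\<close> the orthonormalized factor during the
  backward step for \<open>S\<close>, \<open>Unf\<close>, \<open>UnfT\<close>, \<open>QF\<close>, \<open>QTF\<close>, \<open>RF\<close> serve for QR decompositions of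
  matricizations, and \<open>Vec\<close>, \<open>VecS\<close>, \<open>ScalR\<close> are the registers of the solver. Each of them has
  fixed mode dimensions, which reduces legality and cost of a program to static checks.\<close>

datatype slot = Res | Gram | Proj | Saved | Part nat nat | PartK nat | Unf nat | UnfT nat
  | QF nat | QTF nat | RF nat | Vec nat | VecS nat | ScalR nat | TrS | RhsS | GramS
  | LeafT | LeafV | ZeroS | NegS

instance slot :: countable
  by countable_datatype

definition W :: "'l tree \<Rightarrow> slot \<Rightarrow> 'l reg" where
  "W \<sigma> x = Work \<sigma> (to_nat x)"

lemma W_eq_iff [simp]: "W \<sigma> x = W \<rho> y \<longleftrightarrow> \<sigma> = \<rho> \<and> x = y"
  by (simp add: W_def)

lemma W_distinct [simp]: "W \<sigma> x \<noteq> Factor \<rho>" "Factor \<rho> \<noteq> W \<sigma> x" "W \<sigma> x \<noteq> Time0" "Time0 \<noteq> W \<sigma> x"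
    "W \<sigma> x \<noteq> Time1" "Time1 \<noteq> W \<sigma> x"
  by (simp_all add: W_def)

text \<open>For want of a copy instruction, \<open>a\<close> is copied as \<open>0 a + a\<close>.\<close>

definition copy :: "'l tree \<Rightarrow> 'l reg \<Rightarrow> 'l reg \<Rightarrow> 'l instr list" where
  "copy \<sigma> d a = [Const (W \<sigma> ZeroS) 0, Axpy d (W \<sigma> ZeroS) a a]"

text \<open>A skipped mode is replaced by a copy, so that the result always ends up in
  \<open>Part i (length ts)\<close>. With \<open>i = 0\<close> nothing is skipped, since the modes
  of the children start at 1.\<close>

definition part_op :: "'l tree list \<Rightarrow> nat \<Rightarrow> nat \<Rightarrow> 'l instr list" where
  "part_op ts i j = (let N = Node ts in
     if j = i then copy N (W N (Part i j)) (W N (Part i (j - 1)))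
     else [ModeProd (W N (Part i j)) j (W N (Part i (j - 1))) (W (ts ! (j - 1)) Gram)])"

definition part_prog :: "'l tree list \<Rightarrow> nat \<Rightarrow> 'l instr list" where
  "part_prog ts i = (let N = Node ts in
     copy N (W N (Part i 0)) (W N Res) @ concat (map (part_op ts i) (modes ts)))"

fun root_mode :: "'l tree \<Rightarrow> nat" where
  "root_mode (Leaf l) = 1"
| "root_mode (Node ts) = 0"

text \<open>The register with the factor of the result expressed in the bases of the argument below.
  At a leaf there is nothing below, and the factor itself takes this role.\<close>

fun rest :: "'l tree \<Rightarrow> 'l reg" where
  "rest (Leaf l) = W (Leaf l) Res"
| "rest (Node ts) = W (Node ts) (Part 0 (length ts))"

primrec gram_prog :: "'l tree \<Rightarrow> 'l instr list" where
  "gram_prog (Leaf l) = [Contract (W (Leaf l) Gram) 1 (Factor (Leaf l)) (rest (Leaf l))]"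
| "gram_prog (Node ts) = concat (map gram_prog ts) @ part_prog ts 0 @
     [Contract (W (Node ts) Gram) 0 (Factor (Node ts)) (rest (Node ts))]"

text \<open>The list begins at the subtree, so the recursive call comes first and the projections
  are computed from the root downwards.\<close>

fun path_prog :: "'l path \<Rightarrow> 'l instr list" where
  "path_prog [] = []"
| "path_prog ((ts, i) # p) = path_prog p @ part_prog ts i @
     [ModeProd (W (Node ts) (PartK i)) 0 (W (Node ts) (Part i (length ts))) (W (Node ts) Proj),
      Contract (W (ts ! (i - 1)) Proj) i (Factor (Node ts)) (W (Node ts) (PartK i))]"

definition eval_prog :: "'l tree \<Rightarrow> 'l path \<Rightarrow> 'l reg \<Rightarrow> 'l instr list" where
  "eval_prog \<tau> p a = EvalF a Factor (\<lambda>\<rho>. W \<rho> Res) # gram_prog \<tau> @ path_prog p"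

text \<open>The vector of the solver is put into \<open>Factor\<close> of the subtree, so that the
  \<open>Factor\<close> registers together hold the argument of \<open>F\<close>. That register is
  scratch space until the solver has finished.\<close>

fun own_rhs :: "'l tree \<Rightarrow> 'l tree \<Rightarrow> 'l path \<Rightarrow> 'l reg \<Rightarrow> 'l reg \<Rightarrow> 'l reg \<Rightarrow> 'l instr list" where
  "own_rhs \<tau> (Leaf l) p d a v = Transpose (Factor (Leaf l)) v # eval_prog \<tau> p a @
     [ModeProd (W (Leaf l) LeafT) 1 (W (Leaf l) Res) (W (Leaf l) Proj), Transpose d (W (Leaf l) LeafT)]"
| "own_rhs \<tau> (Node ts) p d a v = copy (Node ts) (Factor (Node ts)) v @ eval_prog \<tau> p a @
     [ModeProd d 0 (rest (Node ts)) (W (Node ts) Proj)]"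

text \<open>The sign is changed by \<open>- x = - 2 x + x\<close>.\<close>

definition S_rhs :: "'l tree \<Rightarrow> 'l tree \<Rightarrow> 'l path \<Rightarrow> 'l reg \<Rightarrow> 'l reg \<Rightarrow> 'l reg \<Rightarrow> 'l instr list" where
  "S_rhs \<tau> \<sigma> p d a v =
     [Transpose (W \<sigma> TrS) v, ModeProd (Factor \<sigma>) (root_mode \<sigma>) (W \<sigma> Saved) (W \<sigma> TrS)] @
     eval_prog \<tau> p a @
     [Contract (W \<sigma> GramS) (root_mode \<sigma>) (W \<sigma> Saved) (rest \<sigma>),
      ModeProd (W \<sigma> RhsS) 1 (W \<sigma> GramS) (W \<sigma> Proj),
      Const (W \<sigma> NegS) (-2), Axpy d (W \<sigma> NegS) (W \<sigma> RhsS) (W \<sigma> RhsS)]"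

section \<open>Translation of solvers and subflows\<close>

fun op_size :: "solver_op \<Rightarrow> nat" where
  "op_size (Rhs i j k) = Suc (i + j + k)"
| "op_size (Update i j k l) = Suc (i + j + k + l)"
| "op_size (Dot i j k) = Suc (i + j + k)"
| "op_size (Lit i x) = Suc i"
| "op_size (Scal i opr j k) = Suc (i + j + k)"

text \<open>A crude bound above all register numbers in \<open>S\<close>: every operation
  contributes more than its largest index. The 2 reserves the scalar registers 0 and 1 for the times
  and ensures that vector register 0 exists even if \<open>S\<close> is empty.\<close>

definition nregs :: "solver \<Rightarrow> nat" where
  "nregs S = 2 + sum_list (map op_size S)"

fun op_prog :: "('l reg \<Rightarrow> 'l reg \<Rightarrow> 'l reg \<Rightarrow> 'l instr list) \<Rightarrow> (nat \<Rightarrow> 'l reg) \<Rightarrow> (nat \<Rightarrow> 'l reg) \<Rightarrow>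
    solver_op \<Rightarrow> 'l instr list" where
  "op_prog rhs a v (Rhs i j k) = rhs (v i) (a j) (v k)"
| "op_prog rhs a v (Update i j k l) = [Axpy (v i) (a j) (v k) (v l)]"
| "op_prog rhs a v (Dot i j k) = [Inner (a i) (v j) (v k)]"
| "op_prog rhs a v (Lit i x) = [Const (a i) x]"
| "op_prog rhs a v (Scal i opr j k) = [Arith (a i) opr (a j) (a k)]"

definition init_prog :: "solver \<Rightarrow> 'l tree \<Rightarrow> (nat \<Rightarrow> 'l reg) \<Rightarrow> 'l reg \<Rightarrow> 'l instr list" where
  "init_prog S \<sigma> v y =
     concat (map (\<lambda>i. copy \<sigma> (v i) y) [0..<nregs S]) @
     map (\<lambda>i. Const (W \<sigma> (ScalR i)) 0) [0..<nregs S] @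
     copy \<sigma> (W \<sigma> (ScalR 0)) Time0 @ copy \<sigma> (W \<sigma> (ScalR 1)) Time1"

definition solve_prog :: "solver \<Rightarrow> ('l reg \<Rightarrow> 'l reg \<Rightarrow> 'l reg \<Rightarrow> 'l instr list) \<Rightarrow> 'l tree \<Rightarrow>
    (nat \<Rightarrow> 'l reg) \<Rightarrow> 'l reg \<Rightarrow> 'l instr list" where
  "solve_prog S rhs \<sigma> v y =
     init_prog S \<sigma> v y @ concat (map (op_prog rhs (\<lambda>i. W \<sigma> (ScalR i)) v) S)"

fun own_prog :: "solver \<Rightarrow> 'l tree \<Rightarrow> 'l tree \<Rightarrow> 'l path \<Rightarrow> 'l instr list" where
  "own_prog S \<tau> (Leaf l) p = Transpose (W (Leaf l) LeafV) (Factor (Leaf l)) #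
     solve_prog S (own_rhs \<tau> (Leaf l) p) (Leaf l) (\<lambda>i. W (Leaf l) (Vec i)) (W (Leaf l) LeafV) @
     [Transpose (Factor (Leaf l)) (W (Leaf l) (Vec 0))]"
| "own_prog S \<tau> (Node ts) p =
     solve_prog S (own_rhs \<tau> (Node ts) p) (Node ts) (\<lambda>i. W (Node ts) (Vec i)) (Factor (Node ts)) @
     copy (Node ts) (Factor (Node ts)) (W (Node ts) (Vec 0))"

text \<open>The source of all reshapings: one matricization and one tensorization of a tensor as
  large as the connection tensor.\<close>

definition orth_prog :: "('l tree \<Rightarrow> nat) \<Rightarrow> 'l tree list \<Rightarrow> nat \<Rightarrow> 'l reg \<Rightarrow> 'l instr list" where
  "orth_prog r ts i d = (let N = Node ts in
     [Matricize (W N (Unf i)) i (Factor N), Transpose (W N (UnfT i)) (W N (Unf i)),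
      QR (W N (QF i)) (W N (RF i)) (W N (UnfT i)), Transpose (W N (QTF i)) (W N (QF i)),
      Tensorize d i (r N # map r ts) (W N (QTF i))])"

fun root_orth_prog :: "('l tree \<Rightarrow> nat) \<Rightarrow> 'l tree \<Rightarrow> 'l instr list" where
  "root_orth_prog r (Leaf l) = [QR (W (Leaf l) Saved) (W (Leaf l) (RF 0)) (Factor (Leaf l))]"
| "root_orth_prog r (Node ts) = orth_prog r ts 0 (W (Node ts) Saved)"

definition phi_pre :: "('l tree \<Rightarrow> nat) \<Rightarrow> 'l tree list \<Rightarrow> nat \<Rightarrow> 'l instr list" where
  "phi_pre r ts i = (let N = Node ts; \<sigma> = ts ! (i - 1) in orth_prog r ts i (Factor N) @
     [ModeProd (Factor \<sigma>) (root_mode \<sigma>) (Factor \<sigma>) (W N (RF i))])"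

definition phi_post :: "('l tree \<Rightarrow> nat) \<Rightarrow> solver \<Rightarrow> 'l tree \<Rightarrow> 'l tree list \<Rightarrow> 'l path \<Rightarrow> nat \<Rightarrow>
    'l instr list" where
  "phi_post r S \<tau> ts p i = (let N = Node ts; \<sigma> = ts ! (i - 1) in root_orth_prog r \<sigma> @
     solve_prog S (S_rhs \<tau> \<sigma> ((ts, i) # p)) \<sigma> (\<lambda>i. W \<sigma> (VecS i)) (W \<sigma> (RF 0)) @
     copy \<sigma> (Factor \<sigma>) (W \<sigma> Saved) @ [ModeProd (Factor N) i (Factor N) (W \<sigma> (VecS 0))])"

text \<open>Between the two parts of \<open>Phi\<close>, \<open>Factor (Node ts)\<close> holds the orthonormalized
  connection tensor, so that the registers \<open>Factor\<close> contain the factors of the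
  prolongation.\<close>

definition phi_prog :: "('l tree \<Rightarrow> nat) \<Rightarrow> solver \<Rightarrow> 'l tree \<Rightarrow> 'l tree list \<Rightarrow> 'l path \<Rightarrow> nat \<Rightarrow>
    ('l path \<Rightarrow> 'l instr list) \<Rightarrow> 'l instr list" where
  "phi_prog r S \<tau> ts p i sub = phi_pre r ts i @ sub ((ts, i) # p) @ phi_post r S \<tau> ts p i"

primrec step_prog :: "('l tree \<Rightarrow> nat) \<Rightarrow> solver \<Rightarrow> 'l tree \<Rightarrow> 'l tree \<Rightarrow> 'l path \<Rightarrow> 'l instr list" where
  "step_prog r S \<tau> (Leaf l) = (\<lambda>p. own_prog S \<tau> (Leaf l) p)"
| "step_prog r S \<tau> (Node ts) = (\<lambda>p.
     concat (map (\<lambda>i. phi_prog r S \<tau> ts p i (map (step_prog r S \<tau>) ts ! (i - 1))) (modes ts)) @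
     own_prog S \<tau> (Node ts) p)"

text \<open>The projection belonging to the root is the \<open>1 \<times> 1\<close> identity. There is no instruction
  that creates it directly; it is obtained as \<open>Q\<^sup>T Q\<close> from a QR decomposition.\<close>

definition main_prog :: "('l tree \<Rightarrow> nat) \<Rightarrow> solver \<Rightarrow> 'l tree \<Rightarrow> 'l instr list" where
  "main_prog r S \<tau> =
     [Contract (W \<tau> RhsS) 0 (Factor \<tau>) (Factor \<tau>), QR (W \<tau> TrS) (W \<tau> (RF 0)) (W \<tau> RhsS),
      Contract (W \<tau> Proj) 1 (W \<tau> TrS) (W \<tau> TrS)] @ step_prog r S \<tau> \<tau> []"


section \<open>Static analysis of programs\<close>

primrec reads :: "'l tree \<Rightarrow> 'l instr \<Rightarrow> 'l reg set" where
  "reads \<tau> (Const d x) = {}"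
| "reads \<tau> (Arith d opr a b) = {a, b}"
| "reads \<tau> (Axpy d z a b) = {z, a, b}"
| "reads \<tau> (Inner d a b) = {a, b}"
| "reads \<tau> (Transpose d a) = {a}"
| "reads \<tau> (ModeProd d i a b) = {a, b}"
| "reads \<tau> (Contract d i a b) = {a, b}"
| "reads \<tau> (QR d e a) = {a}"
| "reads \<tau> (Matricize d i a) = {a}"
| "reads \<tau> (Tensorize d i ds a) = {a}"
| "reads \<tau> (EvalF t arg res) = insert t (arg ` subtrees \<tau>)"
| "reads \<tau> (Clear d) = {}"

primrec writes :: "'l tree \<Rightarrow> 'l instr \<Rightarrow> 'l reg set" where
  "writes \<tau> (Const d x) = {d}"
| "writes \<tau> (Arith d opr a b) = {d}"
| "writes \<tau> (Axpy d z a b) = {d}"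
| "writes \<tau> (Inner d a b) = {d}"
| "writes \<tau> (Transpose d a) = {d}"
| "writes \<tau> (ModeProd d i a b) = {d}"
| "writes \<tau> (Contract d i a b) = {d}"
| "writes \<tau> (QR d e a) = {d, e}"
| "writes \<tau> (Matricize d i a) = {d}"
| "writes \<tau> (Tensorize d i ds a) = {d}"
| "writes \<tau> (EvalF t arg res) = res ` subtrees \<tau>"
| "writes \<tau> (Clear d) = {d}"

lemma exec_frame: "x \<notin> writes \<tau> I \<Longrightarrow> exec qr ev \<tau> I M x = M x"
  by (cases I) (auto split: prod.splits simp: Let_def)

definition progwrites :: "'l tree \<Rightarrow> 'l instr list \<Rightarrow> 'l reg set" where
  "progwrites \<tau> P = \<Union> (writes \<tau> ` set P)"

lemma progwrites_simps [simp]: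
  "progwrites \<tau> [] = {}"
  "progwrites \<tau> (I # P) = writes \<tau> I \<union> progwrites \<tau> P"
  "progwrites \<tau> (P @ Q) = progwrites \<tau> P \<union> progwrites \<tau> Q"
  "progwrites \<tau> (concat Ps) = \<Union> (progwrites \<tau> ` set Ps)"
  by (auto simp: progwrites_def)

definition run where
  "run qr ev \<tau> P M = fold (exec qr ev \<tau>) P M"

lemma run_simps [simp]:
  "run qr ev \<tau> [] M = M"
  "run qr ev \<tau> (I # P) M = run qr ev \<tau> P (exec qr ev \<tau> I M)"
  "run qr ev \<tau> (P @ Q) M = run qr ev \<tau> Q (run qr ev \<tau> P M)"
  by (simp_all add: run_def)

lemma run_frame: "x \<notin> progwrites \<tau> P \<Longrightarrow> run qr ev \<tau> P M x = M x"
  by (induction P arbitrary: M) (auto simp: exec_frame)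

section \<open>Registers and their types\<close>

fun slot_ok :: "nat \<Rightarrow> nat \<Rightarrow> slot \<Rightarrow> bool" where
  "slot_ok m k (Part i j) \<longleftrightarrow> i \<le> m \<and> j \<le> m"
| "slot_ok m k (PartK i) \<longleftrightarrow> i \<le> m"
| "slot_ok m k (Unf i) \<longleftrightarrow> i \<le> m"
| "slot_ok m k (UnfT i) \<longleftrightarrow> i \<le> m"
| "slot_ok m k (QF i) \<longleftrightarrow> i \<le> m"
| "slot_ok m k (QTF i) \<longleftrightarrow> i \<le> m"
| "slot_ok m k (RF i) \<longleftrightarrow> i \<le> m"
| "slot_ok m k (Vec i) \<longleftrightarrow> i < k"
| "slot_ok m k (VecS i) \<longleftrightarrow> i < k"
| "slot_ok m k (ScalR i) \<longleftrightarrow> i < k"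
| "slot_ok m k _ \<longleftrightarrow> True"

lemma finite_slots: "finite {x. slot_ok m k x}"
proof -
  have "{x. slot_ok m k x} \<subseteq> {Res, Gram, Proj, Saved, TrS, RhsS, GramS, LeafT, LeafV, ZeroS, NegS} \<union>
      (\<lambda>(i, j). Part i j) ` ({..m} \<times> {..m}) \<union> PartK ` {..m} \<union> Unf ` {..m} \<union> UnfT ` {..m} \<union>
      QF ` {..m} \<union> QTF ` {..m} \<union> RF ` {..m} \<union> Vec ` {..<k} \<union> VecS ` {..<k} \<union> ScalR ` {..<k}"
  proof
    fix x assume "x \<in> {x. slot_ok m k x}"
    then show "x \<in> {Res, Gram, Proj, Saved, TrS, RhsS, GramS, LeafT, LeafV, ZeroS, NegS} \<union>
      (\<lambda>(i, j). Part i j) ` ({..m} \<times> {..m}) \<union> PartK ` {..m} \<union> Unf ` {..m} \<union> UnfT ` {..m} \<union>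
      QF ` {..m} \<union> QTF ` {..m} \<union> RF ` {..m} \<union> Vec ` {..<k} \<union> VecS ` {..<k} \<union> ScalR ` {..<k}"
      by (cases x) auto
  qed
  then show ?thesis by (rule finite_subset) simp
qed

definition unf_dims :: "nat list \<Rightarrow> nat \<Rightarrow> nat list" where
  "unf_dims ds i = (if i < length ds then [ds ! i, prod_list (drop_nth i ds)] else [])"

text \<open>\<open>R\<close> bounds the ranks of the state, \<open>q\<close> also those of
  evaluations. They are kept apart because reshaped tensors involve only the ranks \<open>r\<close>
  and must obey the sharper bound \<open>R ^ (m + 1)\<close>. \<open>r_leaf\<close> and
  \<open>r_node\<close> make the QR decompositions legal; as statements about dimensions they hold
  for every state and not only the initial one.\<close>

locale setting =
  fixes n :: "'l \<Rightarrow> nat" and r s :: "'l tree \<Rightarrow> nat" and \<tau> :: "'l tree" and S :: solver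
    and m N R q :: nat
  assumes tree: "is_tree \<tau>"
    and arity: "\<And>ts. Node ts \<in> subtrees \<tau> \<Longrightarrow> length ts \<le> m" and m: "1 \<le> m"
    and r_le: "\<And>\<sigma>. \<sigma> \<in> subtrees \<tau> \<Longrightarrow> r \<sigma> \<le> R" and R_le: "R \<le> q"
    and s_le: "\<And>\<sigma>. \<sigma> \<in> subtrees \<tau> \<Longrightarrow> s \<sigma> \<le> q" and q: "1 \<le> q" and R1: "1 \<le> R"
    and n_le: "\<And>l. Leaf l \<in> subtrees \<tau> \<Longrightarrow> n l \<le> N"
    and r_leaf: "\<And>l. Leaf l \<in> subtrees \<tau> \<Longrightarrow> r (Leaf l) \<le> n l"
    and r_node: "\<And>ts i. Node ts \<in> subtrees \<tau> \<Longrightarrow> i \<le> length ts \<Longrightarrow>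
      (r (Node ts) # map r ts) ! i \<le> prod_list (drop_nth i (r (Node ts) # map r ts))"
    and root: "r \<tau> = 1" "s \<tau> = 1"
begin

text \<open>A bound for the size of every register: connection tensors have at most
  \<open>m + 1\<close> modes of dimension at most \<open>q\<close>, and matrices at leaves have at
  most \<open>N * q\<close> entries.\<close>

definition B :: nat where
  "B = q ^ (m + 1) + N * q"

text \<open>Children are counted from 0 and modes from 1, which explains \<open>Suc k\<close>. A
  treated mode has exchanged its rank \<open>s\<close> for \<open>r\<close>.\<close>

definition part_dims :: "'l tree list \<Rightarrow> nat \<Rightarrow> nat \<Rightarrow> nat list" where
  "part_dims ts i j = map (\<lambda>k. if k < j \<and> Suc k \<noteq> i then r (ts ! k) else s (ts ! k)) [0..<length ts]"

fun slot_dims :: "'l tree \<Rightarrow> slot \<Rightarrow> nat list" where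
  "slot_dims \<sigma> Res = factor_dims n s \<sigma>"
| "slot_dims \<sigma> Gram = [r \<sigma>, s \<sigma>]"
| "slot_dims \<sigma> Proj = [r \<sigma>, s \<sigma>]"
| "slot_dims \<sigma> GramS = [r \<sigma>, s \<sigma>]"
| "slot_dims \<sigma> Saved = factor_dims n r \<sigma>"
| "slot_dims \<sigma> (Part i j) = (case \<sigma> of Leaf l \<Rightarrow> [] | Node ts \<Rightarrow> s \<sigma> # part_dims ts i j)"
| "slot_dims \<sigma> (PartK i) = (case \<sigma> of Leaf l \<Rightarrow> [] | Node ts \<Rightarrow> r \<sigma> # part_dims ts i (length ts))"
| "slot_dims \<sigma> (Unf i) = unf_dims (factor_dims n r \<sigma>) i"
| "slot_dims \<sigma> (QTF i) = unf_dims (factor_dims n r \<sigma>) i"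
| "slot_dims \<sigma> (UnfT i) = rev (unf_dims (factor_dims n r \<sigma>) i)"
| "slot_dims \<sigma> (QF i) = rev (unf_dims (factor_dims n r \<sigma>) i)"
| "slot_dims \<sigma> (RF i) = (case \<sigma> of Leaf l \<Rightarrow> [r \<sigma>, r \<sigma>] | Node ts \<Rightarrow>
     if i \<le> length ts then [(r \<sigma> # map r ts) ! i, (r \<sigma> # map r ts) ! i] else [])"
| "slot_dims \<sigma> (Vec i) = (case \<sigma> of Leaf l \<Rightarrow> [r \<sigma>, n l] | Node ts \<Rightarrow> r \<sigma> # map r ts)"
| "slot_dims \<sigma> (VecS i) = [r \<sigma>, r \<sigma>]"
| "slot_dims \<sigma> TrS = [r \<sigma>, r \<sigma>]"
| "slot_dims \<sigma> RhsS = [r \<sigma>, r \<sigma>]"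
| "slot_dims \<sigma> LeafT = factor_dims n r \<sigma>"
| "slot_dims \<sigma> LeafV = rev (factor_dims n r \<sigma>)"
| "slot_dims \<sigma> (ScalR i) = []"
| "slot_dims \<sigma> ZeroS = []"
| "slot_dims \<sigma> NegS = []"

definition ty :: "'l reg \<Rightarrow> nat list" where
  "ty a = (case a of Time0 \<Rightarrow> [] | Time1 \<Rightarrow> [] | Factor \<sigma> \<Rightarrow> factor_dims n r \<sigma>
     | Work \<sigma> k \<Rightarrow> slot_dims \<sigma> (from_nat k))"

lemma ty_simps [simp]: "ty Time0 = []" "ty Time1 = []" "ty (Factor \<sigma>) = factor_dims n r \<sigma>"
    "ty (W \<sigma> x) = slot_dims \<sigma> x"
  by (simp_all add: ty_def W_def)

definition Regs :: "'l reg set" where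
  "Regs = {Time0, Time1} \<union> Factor ` subtrees \<tau> \<union>
     (\<lambda>(\<sigma>, x). W \<sigma> x) ` (subtrees \<tau> \<times> {x. slot_ok m (nregs S) x})"

lemma Regs_simps [simp]: "Time0 \<in> Regs" "Time1 \<in> Regs" "Factor \<sigma> \<in> Regs \<longleftrightarrow> \<sigma> \<in> subtrees \<tau>"
    "W \<sigma> x \<in> Regs \<longleftrightarrow> \<sigma> \<in> subtrees \<tau> \<and> slot_ok m (nregs S) x"
  by (auto simp: Regs_def)

lemma prod_list_le_B:
  assumes "length ds \<le> m + 1" "\<And>d. d \<in> set ds \<Longrightarrow> d \<le> q"
  shows "prod_list ds \<le> B"
proof -
  have "prod_list ds \<le> q ^ length ds"
    using assms(2) by (induction ds) (auto intro: mult_mono)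
  also have "\<dots> \<le> q ^ (m + 1)" using assms(1) q by (intro power_increasing) auto
  finally show ?thesis by (simp add: B_def)
qed

lemma prod_list_le_R:
  assumes "length ds \<le> m + 1" "\<And>d. d \<in> set ds \<Longrightarrow> d \<le> R"
  shows "prod_list ds \<le> R ^ (m + 1)"
proof -
  have "prod_list ds \<le> R ^ length ds"
    using assms(2) by (induction ds) (auto intro: mult_mono)
  also have "\<dots> \<le> R ^ (m + 1)" using assms(1) R1 by (intro power_increasing) auto
  finally show ?thesis .
qed

lemma r_le_q: "\<sigma> \<in> subtrees \<tau> \<Longrightarrow> r \<sigma> \<le> q"
  using r_le R_le order_trans by blast

lemma child_in: "Node ts \<in> subtrees \<tau> \<Longrightarrow> \<sigma> \<in> set ts \<Longrightarrow> \<sigma> \<in> subtrees \<tau>"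
  by (rule subtrees_trans[OF child_subtree])

lemma prod_factor_le: 
  assumes "\<sigma> \<in> subtrees \<tau>" "\<And>\<sigma>. \<sigma> \<in> subtrees \<tau> \<Longrightarrow> x \<sigma> \<le> q"
  shows "prod_list (factor_dims n x \<sigma>) \<le> B"
proof (cases \<sigma>)
  case (Leaf l)
  then have "n l * x (Leaf l) \<le> N * q" using assms n_le by (intro mult_le_mono) auto
  then show ?thesis by (simp add: Leaf B_def)
next
  case (Node ts)
  show ?thesis
    using arity[of ts] assms child_in unfolding Node factor_dims.simps
    by (intro prod_list_le_B) auto
qed

lemma prod_unf_dims: "prod_list (unf_dims ds i) \<le> max 1 (prod_list ds)"
  by (auto simp: unf_dims_def prod_list_drop_nth)

lemma B1: "1 \<le> B"
proof -
  have "1 \<le> q ^ (m + 1)" using q by (rule one_le_power)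
  then show ?thesis unfolding B_def by linarith
qed

lemma prod_list_ty: 
  assumes "a \<in> Regs"
  shows "prod_list (ty a) \<le> B"
proof -
  have nn: "prod_list [x, y] \<le> B" if "x \<le> q" "y \<le> q" for x y
    using that m by (intro prod_list_le_B) auto
  have fr: "prod_list (factor_dims n r \<sigma>) \<le> B" if "\<sigma> \<in> subtrees \<tau>" for \<sigma>
    using that r_le_q by (rule prod_factor_le)
  have fs: "prod_list (factor_dims n s \<sigma>) \<le> B" if "\<sigma> \<in> subtrees \<tau>" for \<sigma>
    using that s_le by (rule prod_factor_le)
  have un: "prod_list (unf_dims (factor_dims n r \<sigma>) i) \<le> B" if "\<sigma> \<in> subtrees \<tau>" for \<sigma> i
    using prod_unf_dims[of "factor_dims n r \<sigma>" i] fr[OF that] B1 by auto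
  have pd: "prod_list (x # part_dims ts i j) \<le> B" if "Node ts \<in> subtrees \<tau>" "x \<le> q" for x ts i j
    using arity[OF that(1)] that child_in[OF that(1)] r_le_q s_le
    by (intro prod_list_le_B) (auto simp: part_dims_def)
  have pr: "prod_list (rev xs) = prod_list xs" for xs :: "nat list"
    by (induction xs) auto
  from assms show ?thesis unfolding Regs_def
  proof (elim UnE imageE)
    fix y assume "a = (case y of (\<sigma>, x) \<Rightarrow> W \<sigma> x)" "y \<in> subtrees \<tau> \<times> {x. slot_ok m (nregs S) x}"
    then obtain \<sigma> x where a: "a = W \<sigma> x" and \<sigma>: "\<sigma> \<in> subtrees \<tau>" and x: "slot_ok m (nregs S) x" by auto
    have k: "(r \<sigma> # map r ts) ! i \<le> q" if "i \<le> length ts" "\<sigma> = Node ts" for i ts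
      using r_le_q[OF \<sigma>] r_le_q[OF child_in[of ts "ts ! (i - 1)"]] that \<sigma> by (auto simp: nth_Cons')
    note [simp del] = factor_dims.simps prod_list.Cons
    show ?thesis
    proof (cases x)
      case (Part i j)
      then show ?thesis using pd[OF _ s_le[OF \<sigma>]] \<sigma> B1 by (cases \<sigma>) (simp_all add: a)
    next
      case (PartK i)
      then show ?thesis using pd[OF _ r_le_q[OF \<sigma>]] \<sigma> B1 by (cases \<sigma>) (simp_all add: a)
    next
      case (Vec i)
      then show ?thesis using fr[OF \<sigma>]
        by (cases \<sigma>) (simp_all add: a factor_dims.simps prod_list.Cons mult.commute)
    next
      case (RF i)
      then show ?thesis using nn[OF k k] nn[OF r_le_q[OF \<sigma>] r_le_q[OF \<sigma>]] B1
        by (cases \<sigma>) (simp_all add: a)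
    qed (use nn[OF r_le_q[OF \<sigma>] r_le_q[OF \<sigma>]] nn[OF r_le_q[OF \<sigma>] s_le[OF \<sigma>]] fr[OF \<sigma>] fs[OF \<sigma>]
        un[OF \<sigma>] B1 in \<open>simp_all add: a pr\<close>)
  qed (use B1 fr in auto)
qed

text \<open>Legality in terms of register types, enriched by what the counts require: the dimension
  bounded by \<open>q\<close> is the factor by which the cost of an instruction exceeds the size of
  its operand, and \<open>R ^ (m + 1)\<close> limits reshapings. Destinations stay in the finite set
  \<open>Regs\<close>, which limits the storage.\<close>

fun wt :: "'l instr \<Rightarrow> bool" where
  "wt (Const d x) \<longleftrightarrow> ty d = [] \<and> d \<in> Regs"
| "wt (Arith d opr a b) \<longleftrightarrow> ty a = [] \<and> ty b = [] \<and> ty d = [] \<and> d \<in> Regs"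
| "wt (Axpy d z a b) \<longleftrightarrow> ty z = [] \<and> ty a = ty b \<and> ty d = ty b \<and> d \<in> Regs"
| "wt (Inner d a b) \<longleftrightarrow> ty a = ty b \<and> ty d = [] \<and> d \<in> Regs"
| "wt (Transpose d a) \<longleftrightarrow> length (ty a) = 2 \<and> ty d = rev (ty a) \<and> d \<in> Regs"
| "wt (ModeProd d i a b) \<longleftrightarrow> i < length (ty a) \<and> length (ty b) = 2 \<and> ty b ! 1 = ty a ! i \<and>
     ty d = (ty a)[i := ty b ! 0] \<and> ty b ! 0 \<le> q \<and> d \<in> Regs"
| "wt (Contract d i a b) \<longleftrightarrow> i < length (ty a) \<and> i < length (ty b) \<and>
     drop_nth i (ty a) = drop_nth i (ty b) \<and> ty d = [ty a ! i, ty b ! i] \<and> ty b ! i \<le> q \<and> d \<in> Regs"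
| "wt (QR d e a) \<longleftrightarrow> d \<noteq> e \<and> length (ty a) = 2 \<and> ty a ! 1 \<le> ty a ! 0 \<and> ty a ! 1 \<le> q \<and>
     ty d = ty a \<and> ty e = [ty a ! 1, ty a ! 1] \<and> d \<in> Regs \<and> e \<in> Regs"
| "wt (Matricize d i a) \<longleftrightarrow> i < length (ty a) \<and> ty d = [ty a ! i, prod_list (drop_nth i (ty a))] \<and>
     prod_list (ty a) \<le> R ^ (m + 1) \<and> d \<in> Regs"
| "wt (Tensorize d i ds a) \<longleftrightarrow> i < length ds \<and> ty a = [ds ! i, prod_list (drop_nth i ds)] \<and> ty d = ds \<and>
     prod_list (ty a) \<le> R ^ (m + 1) \<and> d \<in> Regs"
| "wt (EvalF t arg res) \<longleftrightarrow> ty t = [] \<and> inj_on res (subtrees \<tau>) \<and> (\<forall>\<sigma>\<in>subtrees \<tau>.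
     ty (arg \<sigma>) = factor_dims n r \<sigma> \<and> ty (res \<sigma>) = factor_dims n s \<sigma> \<and> res \<sigma> \<in> Regs)"
| "wt (Clear d) \<longleftrightarrow> False"

text \<open>Programs have no branches, so a single pass that collects the filled registers in
  \<open>X\<close> settles every execution.\<close>

fun checks :: "'l reg set \<Rightarrow> 'l instr list \<Rightarrow> bool" where
  "checks X [] \<longleftrightarrow> True"
| "checks X (I # P) \<longleftrightarrow> wt I \<and> reads \<tau> I \<subseteq> X \<and> checks (X \<union> writes \<tau> I) P"

lemma checks_append: "checks X (P @ Q) \<longleftrightarrow> checks X P \<and> checks (X \<union> progwrites \<tau> P) Q"
  by (induction P arbitrary: X) (auto simp: Un_assoc)

lemma checks_mono: "checks X P \<Longrightarrow> X \<subseteq> Y \<Longrightarrow> checks Y P"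
proof (induction P arbitrary: X Y)
  case (Cons I P)
  then show ?case using Cons.IH[of "X \<union> writes \<tau> I" "Y \<union> writes \<tau> I"] by auto
qed simp

text \<open>\<open>wt\<close> rejects \<open>Clear\<close>, so filled registers only accumulate, and
  the pieces of a program may be checked separately from the same starting set.\<close>

lemma checks_concat: "(\<forall>P\<in>set Ps. checks X P) \<Longrightarrow> checks X (concat Ps)"
proof (induction Ps)
  case (Cons P Ps)
  have "checks X (concat Ps)" using Cons by simp
  then have "checks (X \<union> progwrites \<tau> P) (concat Ps)" by (rule checks_mono) simp
  then show ?case using Cons.prems by (simp add: checks_append)
qed simp

text \<open>The first part is for legality. The second speaks of all registers and is for storage: a
  register not known to be filled is empty or already has its fixed size.\<close>

definition typed :: "'l reg set \<Rightarrow> 'l memory \<Rightarrow> bool" where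
  "typed X M \<longleftrightarrow> (\<forall>a\<in>X. M a \<in> carrier_tensor (ty a)) \<and>
     (\<forall>a. M a = empty_tensor \<or> a \<in> Regs \<and> M a \<in> carrier_tensor (ty a))"

lemma typed_mono: "typed X M \<Longrightarrow> Y \<subseteq> X \<Longrightarrow> typed Y M"
  by (auto simp: typed_def)

lemma typedD: "typed X M \<Longrightarrow> a \<in> X \<Longrightarrow> M a \<in> carrier_tensor (ty a)"
  by (simp add: typed_def)

lemma numel_le_B: "typed X M \<Longrightarrow> numel (M a) \<le> B"
proof -
  assume "typed X M"
  then consider "M a = empty_tensor" | "a \<in> Regs" "dims (M a) = ty a"
    by (auto simp: typed_def carrier_tensor_def)
  then show ?thesis by cases (auto simp: numel_def empty_tensor_def prod_list_ty)
qed

lemma typed_update: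
  "typed X M \<Longrightarrow> d \<in> Regs \<Longrightarrow> A \<in> carrier_tensor (ty d) \<Longrightarrow> typed (insert d X) (M(d := A))"
  by (auto simp: typed_def)

end

lemma scalar_carrier: "scalar x \<in> carrier_tensor []"
  by (simp add: scalar_def carrier_tensor_def)

lemma scalar_of_scalar [simp]: "scalar_of (scalar x) = x"
  by (simp add: scalar_def scalar_of_def)


lemma axpy_carrier:
  "A \<in> carrier_tensor ds \<Longrightarrow> C \<in> carrier_tensor ds \<Longrightarrow> axpy x A C \<in> carrier_tensor ds"
  by (auto simp: axpy_def carrier_tensor_def)

lemma axpy_zero [simp]: "axpy 0 A A = A"
  by (cases A) (auto simp: axpy_def)

section \<open>Soundness of the static checks\<close>

locale evaluation = setting +
  fixes qr :: "real mat \<Rightarrow> real mat \<times> real mat" and ev :: "real \<Rightarrow> 'a factors \<Rightarrow> 'a factors"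
  assumes qr: "QR_routine qr"
    and ev: "\<And>t A. ttn_factors n r \<tau> A \<Longrightarrow> ttn_factors n s \<tau> (ev t A)"
begin

abbreviation "ex \<equiv> exec qr ev \<tau>"
abbreviation "rn \<equiv> run qr ev \<tau>"

text \<open>The 11 comes from QR decompositions: \<open>4 * p * k\<^sup>2 + 7 * p * k\<close> is at
  most \<open>11 * q * B\<close> when \<open>k \<le> q\<close> and \<open>p * k \<le> B\<close>. The
  other instructions stay below \<open>2 * q * B\<close>.\<close>

definition good :: "'a instr \<Rightarrow> 'a memory \<Rightarrow> bool" where
  "good I M \<longleftrightarrow> legal n r \<tau> I M \<and> flops I M \<le> 11 * q * B \<and>
     (\<forall>k. reshaped I M = Some k \<longrightarrow> k \<le> R ^ (m + 1))"

lemma qr_dims: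
  assumes "A \<in> carrier_mat a b" "b \<le> a" "qr A = (Q, T)"
  shows "Q \<in> carrier_mat a b" "T \<in> carrier_mat b b" "Q\<^sup>T * Q = 1\<^sub>m b"
  using qr[unfolded QR_routine_def, rule_format, of A] assms by (auto simp: is_QR_def)

lemma exec_typed:
  assumes "wt I" "reads \<tau> I \<subseteq> X" and M: "typed X M"
  shows "good I M" and "typed (X \<union> writes \<tau> I) (ex I M)"
proof -
  have c: "M a \<in> carrier_tensor (ty a)" if "a \<in> reads \<tau> I" for a
    using typedD[OF M] that assms(2) by auto
  have d: "dims (M a) = ty a" if "a \<in> reads \<tau> I" for a
    using c[OF that] by (rule carrier_tensorD)
  note nB = numel_le_B[OF M]
  have B2: "x * y \<le> 11 * q * B" if "x \<le> 11 * q" "y \<le> B" for x y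
    using that by (intro mult_le_mono)
  have qB: "B \<le> q * B" using q by simp
  have t2: "\<exists>x y. ds = [x, y]" if "length ds = 2" for ds :: "nat list"
    using that by (cases ds; cases "tl ds") auto
  have "good I M \<and> typed (X \<union> writes \<tau> I) (ex I M)"
  proof (cases I)
    case (Const d x)
    then show ?thesis using assms by (auto simp: good_def scalar_carrier intro!: typed_update)
  next
    case (Arith z opr a b)
    have "1 \<le> 11 * q * B" using q B1 by simp
    then show ?thesis using assms d by (auto simp: Arith good_def scalar_carrier intro!: typed_update)
  next
    case (Axpy z x a b)
    have "2 * numel (M a) \<le> 11 * q * B" using B2[of 2 "numel (M a)"] nB q by auto
    then show ?thesis using assms d c[of a] c[of b]
      by (auto simp: Axpy good_def intro!: typed_update axpy_carrier)
  next
    case (Inner z a b)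
    have "2 * numel (M a) \<le> 11 * q * B" using B2[of 2 "numel (M a)"] nB q by auto
    then show ?thesis using assms d c by (auto simp: Inner good_def scalar_carrier intro!: typed_update)
  next
    case (Transpose z a)
    then obtain x y where xy: "ty a = [x, y]" using assms t2[of "ty a"] by auto
    have "Mat 0 (M a) \<in> carrier_mat x y" using c[of a] by (auto simp: Transpose xy intro: dim_Mat_0_2)
    then have "of_mat ((Mat 0 (M a))\<^sup>T) \<in> carrier_tensor [y, x]" by (intro of_mat_carrier) simp
    then show ?thesis using assms d xy by (auto simp: Transpose good_def intro!: typed_update)
  next
    case (ModeProd z i a b)
    then obtain x y where xy: "ty b = [x, y]" using assms t2[of "ty b"] by auto
    have "Mat 0 (M b) \<in> carrier_mat x y" using c[of b] by (auto simp: ModeProd xy intro: dim_Mat_0_2)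
    then have "mode_prod i (M a) (Mat 0 (M b)) \<in> carrier_tensor (ty z)"
      using mode_prod_carrier[OF c[of a], of "Mat 0 (M b)" x y i] assms xy by (simp add: ModeProd)
    moreover have "2 * dims (M b) ! 0 * numel (M a) \<le> 11 * q * B"
      using B2[of "2 * x" "numel (M a)"] nB assms d[of b] by (auto simp: ModeProd xy)
    ultimately show ?thesis using assms d xy by (auto simp: ModeProd good_def intro!: typed_update)
  next
    case (Contract z i a b)
    have "Mat i (M a) * (Mat i (M b))\<^sup>T \<in> carrier_mat (ty a ! i) (ty b ! i)"
      using dim_Mat[OF c[of a], of i] dim_Mat[OF c[of b], of i] by (auto simp: Contract)
    then have "of_mat (Mat i (M a) * (Mat i (M b))\<^sup>T) \<in> carrier_tensor (ty z)"
      using assms by (auto simp: Contract intro: of_mat_carrier)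
    moreover have "2 * dims (M b) ! i * numel (M a) \<le> 11 * q * B"
      using B2[of "2 * ty b ! i" "numel (M a)"] nB assms d[of b] by (auto simp: Contract)
    ultimately show ?thesis using assms d by (auto simp: Contract good_def intro!: typed_update)
  next
    case (QR z e a)
    then obtain x y where xy: "ty a = [x, y]" using assms t2[of "ty a"] by auto
    then have yx: "y \<le> x" "y \<le> q" using assms by (auto simp: QR)
    have mx: "Mat 0 (M a) \<in> carrier_mat x y" using c[of a] by (auto simp: QR xy intro: dim_Mat_0_2)
    obtain Q T where QT: "qr (Mat 0 (M a)) = (Q, T)" by force
    have "of_mat Q \<in> carrier_tensor (ty z)" "of_mat T \<in> carrier_tensor (ty e)"
      using qr_dims[OF mx yx(1) QT] assms xy by (auto simp: QR intro: of_mat_carrier)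
    then have "typed (insert e (insert z X)) (M(z := of_mat Q, e := of_mat T))"
      using assms by (intro typed_update) (auto simp: QR)
    moreover have "4 * x * y\<^sup>2 + 7 * x * y \<le> 11 * q * B"
    proof -
      have xyB: "x * y \<le> B" using nB[of a] d[of a] xy by (auto simp: numel_def QR)
      then have "y * (x * y) \<le> q * B" "x * y \<le> q * B"
        using mult_le_mono[OF yx(2) xyB] qB by linarith+
      then show ?thesis by (simp add: power2_eq_square algebra_simps)
    qed
    moreover have "X \<union> writes \<tau> I = insert e (insert z X)" by (auto simp: QR)
    ultimately show ?thesis
      using assms(1,2) d[of a] xy QT by (simp add: QR good_def Let_def)
  next
    case (Matricize z i a)
    have "of_mat (Mat i (M a)) \<in> carrier_tensor (ty z)"
      using dim_Mat[OF c[of a], of i] assms by (auto simp: Matricize intro: of_mat_carrier)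
    then show ?thesis using assms d by (auto simp: Matricize good_def numel_def intro!: typed_update)
  next
    case (Tensorize z i ds a)
    then show ?thesis using assms d by (auto simp: good_def numel_def intro!: typed_update)
  next
    case (EvalF t arg res)
    let ?A = "\<lambda>\<sigma>. M (arg \<sigma>)"
    have A: "ttn_factors n r \<tau> ?A"
      unfolding ttn_factors_def
    proof
      fix \<sigma> assume "\<sigma> \<in> subtrees \<tau>"
      then show "M (arg \<sigma>) \<in> carrier_tensor (factor_dims n r \<sigma>)"
        using c[of "arg \<sigma>"] assms(1) by (simp add: EvalF)
    qed
    have Z: "ttn_factors n s \<tau> (ev (scalar_of (M t)) ?A)" using A by (rule ev)
    have e: "ex I M (res \<sigma>) \<in> carrier_tensor (ty (res \<sigma>))" if "\<sigma> \<in> subtrees \<tau>" for \<sigma>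
    proof -
      have "ex I M (res \<sigma>) = ev (scalar_of (M t)) ?A \<sigma>"
        using that assms(1) by (simp add: EvalF Let_def inv_into_f_f)
      then show ?thesis using Z that assms(1) by (simp add: EvalF ttn_factors_def)
    qed
    have f: "ex I M a = M a" if "a \<notin> res ` subtrees \<tau>" for a
      using that by (simp add: EvalF Let_def)
    have "typed (X \<union> writes \<tau> I) (ex I M)"
      unfolding typed_def
    proof (intro conjI ballI allI)
      fix a assume "a \<in> X \<union> writes \<tau> I"
      then show "ex I M a \<in> carrier_tensor (ty a)"
        using e f[of a] typedD[OF M, of a] by (cases "a \<in> res ` subtrees \<tau>") (auto simp: EvalF)
    next
      fix a show "ex I M a = empty_tensor \<or> a \<in> Regs \<and> ex I M a \<in> carrier_tensor (ty a)"
        using e f[of a] M assms(1)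
        by (cases "a \<in> res ` subtrees \<tau>") (auto simp: EvalF typed_def simp del: exec.simps)
    qed
    then show ?thesis using assms(1) A d by (auto simp: EvalF good_def)
  qed (use assms in auto)
  then show "good I M" and "typed (X \<union> writes \<tau> I) (ex I M)" by auto
qed

lemma run_typed: "checks X P \<Longrightarrow> typed X M \<Longrightarrow> typed (X \<union> progwrites \<tau> P) (rn P M)"
proof (induction P arbitrary: X M)
  case (Cons I P)
  then have "typed (X \<union> writes \<tau> I \<union> progwrites \<tau> P) (rn P (ex I M))"
    using exec_typed(2)[of I X M] by (intro Cons.IH) auto
  then show ?case by (simp add: Un_assoc)
qed simp

lemma states_typed:
  "checks X P \<Longrightarrow> typed X M \<Longrightarrow> M' \<in> set (states ex P M) \<Longrightarrow> typed X M'"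
proof (induction P arbitrary: X M)
  case (Cons I P)
  show ?case
  proof (cases "M' = M")
    case False
    then have "typed (X \<union> writes \<tau> I) M'"
      using Cons.prems exec_typed(2)[of I X M] by (intro Cons.IH[of _ "ex I M"]) auto
    then show ?thesis by (rule typed_mono) simp
  qed (use Cons.prems in simp)
qed simp

lemma states_good:
  "checks X P \<Longrightarrow> typed X M \<Longrightarrow> (I, M') \<in> set (zip P (states ex P M)) \<Longrightarrow> good I M'"
proof (induction P arbitrary: X M)
  case (Cons J P)
  then show ?case
    using Cons.IH[of "X \<union> writes \<tau> J" "ex J M"] exec_typed[of J X M] by auto
qed simp

lemma last_states: "last (states ex P M) = rn P M"
proof (induction P arbitrary: M)
  case (Cons I P)
  have "states ex P M \<noteq> []" for M by (cases P) auto
  then show ?case using Cons by simp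
qed simp

end

section \<open>Registers written during an evaluation\<close>

fun eval_slot :: "slot \<Rightarrow> bool" where
  "eval_slot Res = True"
| "eval_slot Gram = True"
| "eval_slot ZeroS = True"
| "eval_slot (Part i j) = True"
| "eval_slot (PartK i) = True"
| "eval_slot _ = False"

text \<open>The projection at the root is left out: it is set once at the start and must survive all
  evaluations.\<close>

definition eval_regs :: "'l tree \<Rightarrow> 'l reg set" where
  "eval_regs \<tau> = {W \<rho> x | \<rho> x. eval_slot x} \<union> {W \<rho> Proj | \<rho>. \<rho> \<noteq> \<tau>}"

lemma child_neq_root: "\<sigma> \<in> set ts \<Longrightarrow> Node ts \<in> subtrees \<tau> \<Longrightarrow> \<sigma> \<noteq> \<tau>"
  using Node_notin_child by blast

lemma progwrites_copy: "progwrites \<tau> (copy \<sigma> d a) = {W \<sigma> ZeroS, d}"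
  by (auto simp: copy_def)

lemma progwrites_part_op: "progwrites \<tau> (part_op ts i j) \<subseteq> {W (Node ts) ZeroS, W (Node ts) (Part i j)}"
  by (simp add: part_op_def Let_def progwrites_copy)

lemma progwrites_part_prog:
  "progwrites \<tau> (part_prog ts i) \<subseteq> {W (Node ts) ZeroS} \<union> {W (Node ts) (Part i j) | j. True}"
  using progwrites_part_op[of \<tau> ts i] by (auto simp: part_prog_def Let_def progwrites_copy)

lemma progwrites_gram_prog:
  "progwrites \<tau> (gram_prog \<sigma>) \<subseteq> {W \<rho> x | \<rho> x. x = ZeroS \<or> x = Gram \<or> (\<exists>j. x = Part 0 j)}"
proof (induction \<sigma>)
  case (Node ts)
  then show ?case using progwrites_part_prog[of \<tau> ts 0] by (simp add: UN_subset_iff) blast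
qed auto

text \<open>Two exclusions matter. With \<open>1 \<le> i\<close> the registers
  \<open>Part 0 j\<close> survive, which hold the projected factors from the computation of the Gram
  matrices and are read again afterwards. And a direct subtree is never the root, so the projection
  there survives as well.\<close>

lemma progwrites_path_prog:
  "is_path \<tau> p \<sigma> \<Longrightarrow> progwrites \<tau> (path_prog p) \<subseteq>
     {W \<rho> x | \<rho> x. x = ZeroS \<or> (\<exists>i. x = PartK i) \<or> (\<exists>i j. 1 \<le> i \<and> x = Part i j)} \<union> {W \<rho> Proj | \<rho>. \<rho> \<noteq> \<tau>}"
proof (induction p arbitrary: \<sigma>)
  case (Cons x p)
  obtain ts i where x: "x = (ts, i)" by force
  then have p: "is_path \<tau> p (Node ts)" and i: "i \<in> set (modes ts)" using Cons.prems by auto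
  have "ts ! (i - 1) \<noteq> \<tau>" using child_neq_root[OF mode_nth_mem[OF i] is_path_subtree[OF p]] .
  moreover have "1 \<le> i" using i by (simp add: set_modes)
  ultimately show ?case using Cons.IH[OF p] progwrites_part_prog[of \<tau> ts i] by (simp add: x) blast
qed simp

lemma progwrites_eval_prog:
  assumes "is_path \<tau> p \<sigma>" shows "progwrites \<tau> (eval_prog \<tau> p a) \<subseteq> eval_regs \<tau>"
proof -
  have "progwrites \<tau> (gram_prog \<tau>) \<subseteq> eval_regs \<tau>"
    by (rule order_trans[OF progwrites_gram_prog]) (auto simp: eval_regs_def)
  moreover have "progwrites \<tau> (path_prog p) \<subseteq> eval_regs \<tau>"
    by (rule order_trans[OF progwrites_path_prog[OF assms]]) (auto simp: eval_regs_def)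
  moreover have "(\<lambda>\<rho>. W \<rho> Res) ` subtrees \<tau> \<subseteq> eval_regs \<tau>"
    by (auto simp: eval_regs_def)
  ultimately show ?thesis by (simp add: eval_prog_def)
qed

lemma Gram_written: "\<rho> \<in> subtrees \<sigma> \<Longrightarrow> W \<rho> Gram \<in> progwrites \<tau> (gram_prog \<sigma>)"
  by (induction \<sigma>) auto

lemma upt_modes: "modes ts = [1..<Suc (length ts)]"
  by (simp add: modes_def)

section \<open>Static checks of the programs\<close>

context setting
begin

lemma nregs_pos: "0 < nregs S" "Suc 0 < nregs S"
  by (simp_all add: nregs_def)

lemma checks_copy:
  "\<sigma> \<in> subtrees \<tau> \<Longrightarrow> a \<in> X \<Longrightarrow> ty d = ty a \<Longrightarrow> d \<in> Regs \<Longrightarrow> checks X (copy \<sigma> d a)"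
  by (simp add: copy_def)

lemma length_part_dims [simp]: "length (part_dims ts i j) = length ts"
  by (simp add: part_dims_def)

lemma part_dims_0 [simp]: "part_dims ts i 0 = map s ts"
  by (auto simp: part_dims_def intro: nth_equalityI)

lemma part_dims_nth: "k < length ts \<Longrightarrow>
    part_dims ts i j ! k = (if k < j \<and> Suc k \<noteq> i then r (ts ! k) else s (ts ! k))"
  by (simp add: part_dims_def)

lemma part_dims_Suc: "k < length ts \<Longrightarrow>
    part_dims ts i (Suc k) = (if Suc k = i then part_dims ts i k else (part_dims ts i k)[k := r (ts ! k)])"
  by (auto intro!: nth_equalityI simp: part_dims_nth nth_list_update)

lemma part_dims_full: "part_dims ts 0 (length ts) = map r ts"
  by (auto intro!: nth_equalityI simp: part_dims_nth)

lemma checks_part_prog: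
  assumes N: "Node ts \<in> subtrees \<tau>" and i: "i \<le> length ts" and X: "W (Node ts) Res \<in> X"
    and G: "\<forall>\<sigma>\<in>set ts. W \<sigma> Gram \<in> X"
  shows "checks X (part_prog ts i)" and "W (Node ts) (Part i (length ts)) \<in> progwrites \<tau> (part_prog ts i)"
proof -
  let ?N = "Node ts"
  have im: "i \<le> m" using arity[OF N] i by simp
  have "checks X (copy ?N (W ?N (Part i 0)) (W ?N Res) @ concat (map (part_op ts i) [1..<Suc k])) \<and>
    W ?N (Part i k) \<in> progwrites \<tau> (copy ?N (W ?N (Part i 0)) (W ?N Res) @ concat (map (part_op ts i) [1..<Suc k]))"
    (is "checks X (?P k) \<and> _ \<in> progwrites \<tau> (?P k)")
    if "k \<le> length ts" for k
    using that
  proof (induction k)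
    case 0
    then show ?case using N im X by (simp add: checks_copy progwrites_copy)
  next
    case (Suc k)
    then have IH: "checks X (?P k)" "W ?N (Part i k) \<in> progwrites \<tau> (?P k)" and k: "k < length ts" by auto
    have P: "?P (Suc k) = ?P k @ part_op ts i (Suc k)" by simp
    have km: "Suc k \<le> m" using arity[OF N] k by simp
    have c: "ts ! k \<in> subtrees \<tau>" using child_in[OF N nth_mem[OF k]] .
    let ?Y = "X \<union> progwrites \<tau> (?P k)"
    have "checks ?Y (part_op ts i (Suc k))"
    proof (cases "Suc k = i")
      case True
      then show ?thesis using IH(2) N im km k
        by (auto simp: part_op_def Let_def part_dims_Suc intro!: checks_copy)
    next
      case False
      have "W (ts ! k) Gram \<in> X" using G k by simp
      moreover have "r (ts ! k) \<le> q" using c by (rule r_le_q)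
      ultimately show ?thesis using IH(2) False N im km k
        by (auto simp: part_op_def Let_def part_dims_Suc part_dims_nth)
    qed
    moreover have "W ?N (Part i (Suc k)) \<in> progwrites \<tau> (part_op ts i (Suc k))"
      by (simp add: part_op_def Let_def progwrites_copy)
    ultimately show ?case
      using IH(1) unfolding P checks_append[of _ "?P k"] progwrites_simps(3)[of _ "?P k"] by blast
  qed
  from this[of "length ts"] show "checks X (part_prog ts i)"
    and "W (Node ts) (Part i (length ts)) \<in> progwrites \<tau> (part_prog ts i)"
    by (simp_all add: part_prog_def Let_def upt_modes)
qed

lemma checks_gram_prog:
  assumes "\<sigma> \<in> subtrees \<tau>" "Factor ` subtrees \<tau> \<union> (\<lambda>\<rho>. W \<rho> Res) ` subtrees \<tau> \<subseteq> X"
  shows "checks X (gram_prog \<sigma>)"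
  using assms
proof (induction \<sigma>)
  case (Leaf l)
  have "s (Leaf l) \<le> q" using Leaf by (intro s_le)
  then show ?case using Leaf by auto
next
  case (Node ts)
  let ?Y = "X \<union> progwrites \<tau> (concat (map gram_prog ts))"
  have "checks X (concat (map gram_prog ts))"
    using Node.IH[OF _ child_in[OF Node.prems(1)] Node.prems(2)] by (intro checks_concat) auto
  moreover have c: "W \<sigma> Gram \<in> progwrites \<tau> (concat (map gram_prog ts))" if "\<sigma> \<in> set ts" for \<sigma>
    using Gram_written[of \<sigma> \<sigma> \<tau>] that by auto
  then have "checks ?Y (part_prog ts 0)" 
    using Node.prems by (intro checks_part_prog) auto
  moreover have "W (Node ts) (Part 0 (length ts)) \<in> progwrites \<tau> (part_prog ts 0)"
    using Node.prems c by (intro checks_part_prog(2)[of ts 0 ?Y]) auto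
  moreover have "s (Node ts) \<le> q" using Node.prems by (intro s_le)
  ultimately show ?case using Node.prems
    by (auto simp: checks_append part_dims_full)
qed

lemma rest_written: "\<rho> \<in> subtrees \<sigma> \<Longrightarrow> \<sigma> \<in> subtrees \<tau> \<Longrightarrow>
    rest \<rho> \<in> progwrites \<tau> (gram_prog \<sigma>) \<union> (\<lambda>\<rho>. W \<rho> Res) ` subtrees \<tau>"
proof (induction \<sigma>)
  case (Node ts)
  show ?case
  proof (cases "\<rho> = Node ts")
    case True
    then show ?thesis using checks_part_prog(2)[OF Node.prems(2), of 0 UNIV] by simp
  next
    case False
    then obtain \<sigma> where "\<sigma> \<in> set ts" "\<rho> \<in> subtrees \<sigma>" using Node.prems by auto
    then show ?thesis using Node.IH[of \<sigma>] child_in[OF Node.prems(2)] by auto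
  qed
qed auto

lemma r_factor_le: "Node ts \<in> subtrees \<tau> \<Longrightarrow> i \<le> length ts \<Longrightarrow> (r (Node ts) # map r ts) ! i \<le> q"
  using r_le_q[of "Node ts"] r_le_q[OF child_in, of ts "ts ! (i - 1)"] by (auto simp: nth_Cons')

lemma checks_path_prog:
  assumes "is_path \<tau> p \<sigma>"
    "Factor ` subtrees \<tau> \<union> (\<lambda>\<rho>. W \<rho> Res) ` subtrees \<tau> \<union> (\<lambda>\<rho>. W \<rho> Gram) ` subtrees \<tau> \<union> {W \<tau> Proj} \<subseteq> X"
  shows "checks X (path_prog p) \<and> W \<sigma> Proj \<in> X \<union> progwrites \<tau> (path_prog p)"
  using assms
proof (induction p arbitrary: \<sigma>)
  case (Cons x p)
  obtain ts i where x: "x = (ts, i)" by force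
  then have p: "is_path \<tau> p (Node ts)" and i: "i \<in> set (modes ts)" and \<sigma>: "\<sigma> = ts ! (i - 1)"
    using Cons.prems by auto
  have N: "Node ts \<in> subtrees \<tau>" using p by (rule is_path_subtree)
  have i': "1 \<le> i" "i \<le> length ts" "i \<le> m" using i arity[OF N] by (auto simp: set_modes)
  have c: "\<sigma> \<in> subtrees \<tau>" unfolding \<sigma> by (rule child_in[OF N mode_nth_mem[OF i]])
  let ?Y = "X \<union> progwrites \<tau> (path_prog p)"
  have IH: "checks X (path_prog p)" "W (Node ts) Proj \<in> ?Y" using Cons.IH[OF p] Cons.prems by auto
  have cN: "W \<rho> Gram \<in> X" if "\<rho> \<in> set ts" for \<rho> using child_in[OF N that] Cons.prems(2) by auto
  have P: "checks ?Y (part_prog ts i)" "W (Node ts) (Part i (length ts)) \<in> progwrites \<tau> (part_prog ts i)"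
    using checks_part_prog[OF N i'(2), of ?Y] N Cons.prems(2) cN by auto
  \<comment> \<open>In the kept mode the result still has its own rank \<open>s\<close>, in all
    others the Gram matrices have produced \<open>r\<close>; so the two tensors can be contracted in
    all modes but \<open>i\<close>.\<close>
  have "drop_nth i (r (Node ts) # map r ts) = drop_nth i (r (Node ts) # part_dims ts i (length ts))"
    by (rule drop_nth_eqI) (auto simp: nth_Cons' part_dims_nth)
  moreover have "(r (Node ts) # part_dims ts i (length ts)) ! i = s \<sigma>" "(r (Node ts) # map r ts) ! i = r \<sigma>"
    using i' by (auto simp: nth_Cons' part_dims_nth \<sigma>)
  ultimately show ?case
    using IH P N i' c s_le[OF c] r_le_q[OF N] Cons.prems(2)
    by (auto simp: x checks_append \<sigma>[symmetric, simplified] simp del: subtrees.simps)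
qed simp

definition base_regs :: "'l reg set" where
  "base_regs = {Time0, Time1, W \<tau> Proj} \<union> Factor ` subtrees \<tau>"

lemma checks_eval_prog:
  assumes p: "is_path \<tau> p \<sigma>" and X: "base_regs \<subseteq> X" "a \<in> X" "ty a = []"
  shows "checks X (eval_prog \<tau> p a)"
    and "{W \<sigma> Proj, W \<sigma> Res, rest \<sigma>} \<subseteq> X \<union> progwrites \<tau> (eval_prog \<tau> p a)"
proof -
  let ?R = "(\<lambda>\<rho>. W \<rho> Res) ` subtrees \<tau>"
  have e: "wt (EvalF a Factor (\<lambda>\<rho>. W \<rho> Res))" "reads \<tau> (EvalF a Factor (\<lambda>\<rho>. W \<rho> Res)) \<subseteq> X"
    using X by (auto simp: inj_on_def base_regs_def)
  have g: "checks (X \<union> ?R) (gram_prog \<tau>)"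
    using X by (intro checks_gram_prog) (auto simp: base_regs_def)
  have G: "(\<lambda>\<rho>. W \<rho> Gram) ` subtrees \<tau> \<subseteq> progwrites \<tau> (gram_prog \<tau>)"
    using Gram_written by auto
  have q: "checks (X \<union> ?R \<union> progwrites \<tau> (gram_prog \<tau>)) (path_prog p)"
    "W \<sigma> Proj \<in> X \<union> ?R \<union> progwrites \<tau> (gram_prog \<tau>) \<union> progwrites \<tau> (path_prog p)"
    using checks_path_prog[OF p, of "X \<union> ?R \<union> progwrites \<tau> (gram_prog \<tau>)"] X G
    by (auto simp: base_regs_def)
  show "checks X (eval_prog \<tau> p a)"
    using e g q(1) by (simp add: eval_prog_def checks_append)
  have \<sigma>: "\<sigma> \<in> subtrees \<tau>" using p by (rule is_path_subtree)
  show "{W \<sigma> Proj, W \<sigma> Res, rest \<sigma>} \<subseteq> X \<union> progwrites \<tau> (eval_prog \<tau> p a)"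
    using q(2) \<sigma> rest_written[OF \<sigma> subtrees_refl] by (auto simp: eval_prog_def)
qed


lemma checks_own_rhs:
  assumes p: "is_path \<tau> p \<sigma>" and X: "base_regs \<subseteq> X" "a \<in> X" "v \<in> X" and ta: "ty a = []"
    and tv: "ty v = slot_dims \<sigma> (Vec 0)" and td: "ty d = slot_dims \<sigma> (Vec 0)" and d: "d \<in> Regs"
  shows "checks X (own_rhs \<tau> \<sigma> p d a v)"
proof -
  have \<sigma>: "\<sigma> \<in> subtrees \<tau>" using p by (rule is_path_subtree)
  have e: "checks (X \<union> Y) (eval_prog \<tau> p a)"
    "{W \<sigma> Proj, W \<sigma> Res, rest \<sigma>} \<subseteq> X \<union> Y \<union> progwrites \<tau> (eval_prog \<tau> p a)" for Y
    using checks_eval_prog[OF p, of "X \<union> Y" a] X ta by auto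
  show ?thesis
  proof (cases \<sigma>)
    case (Leaf l)
    then show ?thesis
      using e[of "{Factor \<sigma>}"] \<sigma> X tv td d r_le_q[OF \<sigma>] by (auto simp: checks_append)
  next
    case (Node ts)
    have "checks X (copy \<sigma> (Factor \<sigma>) v)" using \<sigma> X tv Node by (intro checks_copy) auto
    then show ?thesis
      using e[of "{W \<sigma> ZeroS, Factor \<sigma>}"] \<sigma> X td d r_le_q[OF \<sigma>] Node
      by (auto simp: checks_append progwrites_copy part_dims_full insert_commute)
  qed
qed

lemma root_mode_dims:
  "root_mode \<sigma> < length (factor_dims n x \<sigma>)" "factor_dims n x \<sigma> ! root_mode \<sigma> = x \<sigma>"
  "root_mode \<sigma> < length (ty (rest \<sigma>))" "ty (rest \<sigma>) ! root_mode \<sigma> = s \<sigma>"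
  "drop_nth (root_mode \<sigma>) (factor_dims n r \<sigma>) = drop_nth (root_mode \<sigma>) (ty (rest \<sigma>))"
  by (cases \<sigma>; simp add: part_dims_full)+

lemma checks_S_rhs:
  assumes p: "is_path \<tau> p \<sigma>" and X: "base_regs \<subseteq> X" "a \<in> X" "v \<in> X" "W \<sigma> Saved \<in> X" and ta: "ty a = []"
    and tv: "ty v = [r \<sigma>, r \<sigma>]" and td: "ty d = [r \<sigma>, r \<sigma>]" and d: "d \<in> Regs"
  shows "checks X (S_rhs \<tau> \<sigma> p d a v)"
proof -
  have \<sigma>: "\<sigma> \<in> subtrees \<tau>" using p by (rule is_path_subtree)
  let ?Y = "{W \<sigma> TrS, Factor \<sigma>}"
  have e: "checks (X \<union> ?Y) (eval_prog \<tau> p a)"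
    "{W \<sigma> Proj, W \<sigma> Res, rest \<sigma>} \<subseteq> X \<union> ?Y \<union> progwrites \<tau> (eval_prog \<tau> p a)"
    using checks_eval_prog[OF p, of "X \<union> ?Y" a] X ta by auto
  have u: "(factor_dims n r \<sigma>)[root_mode \<sigma> := r \<sigma>] = factor_dims n r \<sigma>"
    using root_mode_dims(2)[where x = r and \<sigma> = \<sigma>] by (metis list_update_id)
  have Y: "X \<union> {W \<sigma> TrS} \<union> {Factor \<sigma>} = X \<union> ?Y" by auto
  show ?thesis
    using e \<sigma> X tv td d r_le_q[OF \<sigma>] s_le[OF \<sigma>] root_mode_dims[where \<sigma> = \<sigma>] u
    unfolding S_rhs_def checks_append
    by (auto simp: Y insert_commute simp del: factor_dims.simps)
qed

end

lemma op_size_le: "op \<in> set S \<Longrightarrow> op_size op < nregs S"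
  using member_le_sum_list[of "op_size op" "map op_size S"] by (auto simp: nregs_def)

context setting
begin

lemma checks_init_prog:
  assumes \<sigma>: "\<sigma> \<in> subtrees \<tau>" and v: "\<And>i. i < nregs S \<Longrightarrow> v i \<in> Regs \<and> ty (v i) = ty y"
    and X: "{y, Time0, Time1} \<subseteq> X"
  shows "checks X (init_prog S \<sigma> v y)"
proof -
  have 1: "checks X (concat (map (\<lambda>i. copy \<sigma> (v i) y) [0..<nregs S]))"
    using assms by (intro checks_concat) (auto intro!: checks_copy)
  have 2: "checks Y (map (\<lambda>i. Const (W \<sigma> (ScalR i)) 0) is)" if "set is \<subseteq> {..<nregs S}" for "is" Y
    using that \<sigma> by (induction "is" arbitrary: Y) auto
  have 3: "checks Y (copy \<sigma> (W \<sigma> (ScalR 0)) Time0)" "checks Y (copy \<sigma> (W \<sigma> (ScalR 1)) Time1)" if "X \<subseteq> Y" for Y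
    using that X \<sigma> nregs_pos by (auto intro!: checks_copy)
  show ?thesis
    unfolding init_prog_def checks_append
    using 1 2[of "[0..<nregs S]"] 3 by (auto simp: subset_iff)
qed

lemma init_prog_written:
  "i < nregs S \<Longrightarrow> v i \<in> progwrites \<tau> (init_prog S \<sigma> v y)"
  "i < nregs S \<Longrightarrow> W \<sigma> (ScalR i) \<in> progwrites \<tau> (init_prog S \<sigma> v y)"
  by (auto simp: init_prog_def progwrites_copy) (auto simp: progwrites_def)

text \<open>Initialization fills all registers of the solver, so its operations can be checked one
  by one. The right-hand side is only assumed to pass its own check from any larger set of filled
  registers.\<close>

lemma checks_solve_prog:
  assumes \<sigma>: "\<sigma> \<in> subtrees \<tau>" and v: "\<And>i. i < nregs S \<Longrightarrow> v i \<in> Regs \<and> ty (v i) = ty y"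
    and X: "{y, Time0, Time1} \<subseteq> X"
    and rhs: "\<And>Y i j k. X \<subseteq> Y \<Longrightarrow> W \<sigma> (ScalR j) \<in> Y \<Longrightarrow> v k \<in> Y \<Longrightarrow> i < nregs S \<Longrightarrow> j < nregs S \<Longrightarrow>
      k < nregs S \<Longrightarrow> checks Y (rhs (v i) (W \<sigma> (ScalR j)) (v k))"
  shows "checks X (solve_prog S rhs \<sigma> v y)"
proof -
  let ?Y = "X \<union> progwrites \<tau> (init_prog S \<sigma> v y)"
  have w: "v i \<in> ?Y" "W \<sigma> (ScalR i) \<in> ?Y" if "i < nregs S" for i
    using init_prog_written[OF that] by auto
  have "checks ?Y (op_prog rhs (\<lambda>i. W \<sigma> (ScalR i)) v op)" if "op \<in> set S" for op
    using op_size_le[OF that] w v rhs[of ?Y] \<sigma> by (cases op) auto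
  then have "checks ?Y (concat (map (op_prog rhs (\<lambda>i. W \<sigma> (ScalR i)) v) S))"
    by (intro checks_concat) auto
  then show ?thesis
    unfolding solve_prog_def checks_append using checks_init_prog[where v = v, OF \<sigma> _ X] v by blast
qed

lemma progwrites_solve_prog:
  assumes "\<And>i j k. i < nregs S \<Longrightarrow> j < nregs S \<Longrightarrow> k < nregs S \<Longrightarrow>
    progwrites \<tau> (rhs (v i) (W \<sigma> (ScalR j)) (v k)) \<subseteq> insert (v i) E"
  shows "progwrites \<tau> (solve_prog S rhs \<sigma> v y) \<subseteq>
    insert (W \<sigma> ZeroS) (v ` {..<nregs S} \<union> (\<lambda>i. W \<sigma> (ScalR i)) ` {..<nregs S} \<union> E)"
proof -
  have "progwrites \<tau> (init_prog S \<sigma> v y) \<subseteq>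
      insert (W \<sigma> ZeroS) (v ` {..<nregs S} \<union> (\<lambda>i. W \<sigma> (ScalR i)) ` {..<nregs S})"
    using nregs_pos by (auto simp: init_prog_def progwrites_copy) (auto simp: progwrites_def)
  moreover have "progwrites \<tau> (op_prog rhs (\<lambda>i. W \<sigma> (ScalR i)) v op) \<subseteq>
      v ` {..<nregs S} \<union> (\<lambda>i. W \<sigma> (ScalR i)) ` {..<nregs S} \<union> E" if "op \<in> set S" for op
  proof (cases op)
    case (Rhs i j k)
    then show ?thesis using op_size_le[OF that] assms[of i j k] by auto
  qed (use op_size_le[OF that] in auto)
  ultimately show ?thesis by (auto simp: solve_prog_def)
qed

text \<open>The matrix decomposed is the transposed matricization, and \<open>r_node\<close> says
  that it is not wider than high. Its size is a product of ranks \<open>r\<close>, whence the bound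
  for reshapings in terms of \<open>R\<close>.\<close>

lemma checks_orth_prog:
  assumes N: "Node ts \<in> subtrees \<tau>" and i: "i \<le> length ts" and X: "Factor (Node ts) \<in> X"
    and d: "d \<in> Regs" "ty d = r (Node ts) # map r ts"
  shows "checks X (orth_prog r ts i d)"
    and "{d, W (Node ts) (RF i)} \<subseteq> progwrites \<tau> (orth_prog r ts i d)"
proof -
  have im: "i \<le> m" using i arity[OF N] by simp
  have "prod_list (r (Node ts) # map r ts) \<le> R ^ (m + 1)"
    using arity[OF N] r_le[OF N] r_le[OF child_in[OF N]] by (intro prod_list_le_R) auto
  moreover have "prod_list (unf_dims (r (Node ts) # map r ts) i) = prod_list (r (Node ts) # map r ts)"
    using i prod_list_drop_nth[of i "r (Node ts) # map r ts"] by (simp add: unf_dims_def)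
  ultimately show "checks X (orth_prog r ts i d)"
    using i im N X d r_node[OF N i] r_factor_le[OF N i]
    by (auto simp: orth_prog_def Let_def unf_dims_def)
  show "{d, W (Node ts) (RF i)} \<subseteq> progwrites \<tau> (orth_prog r ts i d)"
    by (simp add: orth_prog_def Let_def)
qed

lemma checks_root_orth_prog:
  assumes \<sigma>: "\<sigma> \<in> subtrees \<tau>" and X: "Factor \<sigma> \<in> X"
  shows "checks X (root_orth_prog r \<sigma>)"
    and "{W \<sigma> Saved, W \<sigma> (RF 0)} \<subseteq> progwrites \<tau> (root_orth_prog r \<sigma>)"
proof -
  have "checks X (root_orth_prog r \<sigma>) \<and> {W \<sigma> Saved, W \<sigma> (RF 0)} \<subseteq> progwrites \<tau> (root_orth_prog r \<sigma>)"
  proof (cases \<sigma>)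
    case (Leaf l)
    then show ?thesis using \<sigma> X r_leaf[of l] r_le_q[OF \<sigma>] by auto
  next
    case (Node ts)
    then show ?thesis using \<sigma> X checks_orth_prog[of ts 0 X "W \<sigma> Saved"] by auto
  qed
  then show "checks X (root_orth_prog r \<sigma>)"
    and "{W \<sigma> Saved, W \<sigma> (RF 0)} \<subseteq> progwrites \<tau> (root_orth_prog r \<sigma>)" by auto
qed


lemma checks_own_prog:
  assumes p: "is_path \<tau> p \<sigma>" and X: "base_regs \<subseteq> X"
  shows "checks X (own_prog S \<tau> \<sigma> p)"
proof -
  have \<sigma>: "\<sigma> \<in> subtrees \<tau>" using p by (rule is_path_subtree)
  let ?v = "\<lambda>i. W \<sigma> (Vec i)"
  have s: "checks X' (solve_prog S (own_rhs \<tau> \<sigma> p) \<sigma> ?v y)"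
    if "X \<subseteq> X'" "y \<in> X'" "ty y = slot_dims \<sigma> (Vec 0)" for y X'
  proof (rule checks_solve_prog[OF \<sigma>])
    show "checks Y (own_rhs \<tau> \<sigma> p (?v i) (W \<sigma> (ScalR j)) (?v k))"
      if "X' \<subseteq> Y" "W \<sigma> (ScalR j) \<in> Y" "?v k \<in> Y" "i < nregs S" for Y i j k
      using that X \<open>X \<subseteq> X'\<close> \<sigma> by (intro checks_own_rhs[OF p]) auto
  qed (use that X \<sigma> in \<open>auto simp: base_regs_def\<close>)
  have w: "?v 0 \<in> progwrites \<tau> (solve_prog S (own_rhs \<tau> \<sigma> p) \<sigma> ?v y)" for y
    using init_prog_written(1)[OF nregs_pos(1), of ?v] by (simp add: solve_prog_def)
  show ?thesis
  proof (cases \<sigma>)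
    case (Leaf l)
    then show ?thesis
      using X \<sigma> s[of "insert (W \<sigma> LeafV) X" "W \<sigma> LeafV"] w[of "W \<sigma> LeafV"]
      by (auto simp: checks_append base_regs_def)
  next
    case (Node ts)
    then show ?thesis
      using X \<sigma> s[of X "Factor \<sigma>"] w[of "Factor \<sigma>"]
      by (auto simp: checks_append base_regs_def intro!: checks_copy)
  qed
qed

lemma
  assumes p: "is_path \<tau> p (Node ts)" and i: "i \<in> set (modes ts)" and X: "base_regs \<subseteq> X"
  shows checks_phi_pre: "checks X (phi_pre r ts i)" and checks_phi_post: "checks X (phi_post r S \<tau> ts p i)"
proof -
  let ?N = "Node ts" and ?\<sigma> = "ts ! (i - 1)" and ?q = "(ts, i) # p"
  have N: "?N \<in> subtrees \<tau>" using p by (rule is_path_subtree)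
  have \<sigma>: "?\<sigma> \<in> subtrees \<tau>" by (rule child_in[OF N mode_nth_mem[OF i]])
  have q: "is_path \<tau> ?q ?\<sigma>" using i p by simp
  have i': "i \<le> length ts" "1 \<le> i" using i by (auto simp: set_modes)
  have ri: "(r ?N # map r ts) ! i = r ?\<sigma>" using i' by (auto simp: nth_Cons')
  have b: "base_regs \<subseteq> X \<union> Y" for Y using X by auto
  have F: "Factor ?N \<in> X" "Factor ?\<sigma> \<in> X" using X N \<sigma> by (auto simp: base_regs_def)
  have u: "(factor_dims n r ?\<sigma>)[root_mode ?\<sigma> := r ?\<sigma>] = factor_dims n r ?\<sigma>"
    using root_mode_dims(2)[where x = r and \<sigma> = "?\<sigma>"] by (metis list_update_id)
  have u': "(r ?N # map r ts)[i := r ?\<sigma>] = r ?N # map r ts" using ri by (metis list_update_id)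
  let ?P1 = "orth_prog r ts i (Factor ?N)"
  let ?P2 = "[ModeProd (Factor ?\<sigma>) (root_mode ?\<sigma>) (Factor ?\<sigma>) (W ?N (RF i))]"
  let ?P4 = "root_orth_prog r ?\<sigma>"
  let ?P5 = "solve_prog S (S_rhs \<tau> ?\<sigma> ?q) ?\<sigma> (\<lambda>i. W ?\<sigma> (VecS i)) (W ?\<sigma> (RF 0))"
  have 1: "checks X ?P1" "W ?N (RF i) \<in> progwrites \<tau> ?P1"
    using checks_orth_prog[OF N i'(1) F(1), of "Factor ?N"] N by auto
  have 2: "checks (X \<union> Y) ?P2" if "W ?N (RF i) \<in> Y" for Y
    using that F N \<sigma> i' ri u r_le_q[OF \<sigma>] root_mode_dims(1,2)[where x = r and \<sigma> = "?\<sigma>"]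
    by (auto simp del: factor_dims.simps)
  have 4: "checks (X \<union> Y) ?P4" "{W ?\<sigma> Saved, W ?\<sigma> (RF 0)} \<subseteq> progwrites \<tau> ?P4" for Y
    using checks_root_orth_prog[OF \<sigma>, of "X \<union> Y"] F by auto
  have 5: "checks (X \<union> Y) ?P5" if "{W ?\<sigma> Saved, W ?\<sigma> (RF 0)} \<subseteq> Y" for Y
  proof (rule checks_solve_prog[OF \<sigma>])
    show "checks Y' (S_rhs \<tau> ?\<sigma> ?q (W ?\<sigma> (VecS i)) (W ?\<sigma> (ScalR j)) (W ?\<sigma> (VecS k)))"
      if "X \<union> Y \<subseteq> Y'" "W ?\<sigma> (ScalR j) \<in> Y'" "W ?\<sigma> (VecS k) \<in> Y'" "i < nregs S" for Y' i j k
      using that X \<open>_ \<subseteq> Y\<close> \<sigma> by (intro checks_S_rhs[OF q]) auto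
    show "W ?\<sigma> (VecS i) \<in> Regs \<and> ty (W ?\<sigma> (VecS i)) = ty (W ?\<sigma> (RF 0))" if "i < nregs S" for i
      using that \<sigma> by (cases "?\<sigma>") auto
  qed (use that X in \<open>auto simp: base_regs_def\<close>)
  have 6: "checks (X \<union> Y) (copy ?\<sigma> (Factor ?\<sigma>) (W ?\<sigma> Saved))" if "W ?\<sigma> Saved \<in> Y" for Y
    using that \<sigma> by (intro checks_copy) auto
  have w: "W ?\<sigma> (VecS 0) \<in> progwrites \<tau> ?P5"
    using init_prog_written(1)[OF nregs_pos(1), of "\<lambda>i. W ?\<sigma> (VecS i)"] by (simp add: solve_prog_def)
  have 7: "checks (X \<union> Y) [ModeProd (Factor ?N) i (Factor ?N) (W ?\<sigma> (VecS 0))]" if "W ?\<sigma> (VecS 0) \<in> Y" for Y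
    using that F N i' ri u' r_le_q[OF \<sigma>] by auto
  show "checks X (phi_pre r ts i)"
    unfolding phi_pre_def Let_def checks_append by (intro conjI 1 2)
  show "checks X (phi_post r S \<tau> ts p i)"
    unfolding phi_post_def Let_def checks_append Un_assoc
    using 4(1)[of "{}"] by (intro conjI 5 6 7) (use 4(2) w in auto)
qed

lemma checks_phi_prog:
  assumes "is_path \<tau> p (Node ts)" "i \<in> set (modes ts)" "base_regs \<subseteq> X"
    and "\<And>Y. base_regs \<subseteq> Y \<Longrightarrow> checks Y (sub ((ts, i) # p))"
  shows "checks X (phi_prog r S \<tau> ts p i sub)"
  unfolding phi_prog_def checks_append Un_assoc
  by (intro conjI checks_phi_pre[OF assms(1,2)] checks_phi_post[OF assms(1,2)] assms(4))
    (use assms(3) in auto)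

lemma checks_step_prog:
  "is_path \<tau> p \<sigma> \<Longrightarrow> base_regs \<subseteq> X \<Longrightarrow> checks X (step_prog r S \<tau> \<sigma> p)"
proof (induction \<sigma> arbitrary: p X)
  case (Leaf l)
  then show ?case by (simp add: checks_own_prog del: own_prog.simps)
next
  case (Node ts)
  have "checks X (phi_prog r S \<tau> ts p i (map (step_prog r S \<tau>) ts ! (i - 1)))" if i: "i \<in> set (modes ts)" for i
  proof (rule checks_phi_prog[OF Node.prems(1) i Node.prems(2)])
    fix Y assume "base_regs \<subseteq> Y"
    moreover have "i - 1 < length ts" using i by (auto simp: set_modes)
    ultimately show "checks Y ((map (step_prog r S \<tau>) ts ! (i - 1)) ((ts, i) # p))"
      using Node.IH[OF mode_nth_mem[OF i], of "(ts, i) # p" Y] Node.prems i by simp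
  qed
  then have "checks X (concat (map (\<lambda>i. phi_prog r S \<tau> ts p i (map (step_prog r S \<tau>) ts ! (i - 1))) (modes ts)))"
    by (intro checks_concat) auto
  moreover have "checks (X \<union> Y) (own_prog S \<tau> (Node ts) p)" for Y
    using Node.prems by (intro checks_own_prog) auto
  ultimately show ?case
    by (simp add: checks_append del: own_prog.simps One_nat_def)
qed

lemma checks_main_prog:
  assumes node: "\<nexists>l. \<tau> = Leaf l" and X: "{Time0, Time1} \<union> Factor ` subtrees \<tau> \<subseteq> X"
  shows "checks X (main_prog r S \<tau>)"
  unfolding main_prog_def checks_append
proof
  \<comment> \<open>As the tree is not a leaf, mode 0 of the factor at the root has dimension
    \<open>r \<tau> = 1\<close>, so the auxiliary matrices are 1 by 1.\<close>
  have "0 < length (factor_dims n r \<tau>)" "factor_dims n r \<tau> ! 0 = 1" "slot_dims \<tau> (RF 0) = [1, 1]"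
    using node root by (cases \<tau>; simp)+
  moreover have "\<tau> \<in> subtrees \<tau>" by simp
  ultimately show "checks X [Contract (W \<tau> RhsS) 0 (Factor \<tau>) (Factor \<tau>),
      QR (W \<tau> TrS) (W \<tau> (RF 0)) (W \<tau> RhsS), Contract (W \<tau> Proj) 1 (W \<tau> TrS) (W \<tau> TrS)]"
    using X root q by (auto simp del: factor_dims.simps subtrees_refl slot_dims.simps(12))
qed (intro checks_step_prog, use X in \<open>auto simp: base_regs_def\<close>)

end

section \<open>Correctness of the program\<close>

text \<open>The mathematical content of the register \<open>rest\<close>: the factor of the result
  \<open>Z\<close>, expressed in the bases that \<open>A\<close> provides below.\<close>

fun proj_factor :: "'l factors \<Rightarrow> 'l factors \<Rightarrow> 'l tree \<Rightarrow> tensor" where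
  "proj_factor A Z (Leaf l) = Z (Leaf l)"
| "proj_factor A Z (Node ts) = mode_prods (Z (Node ts)) (\<lambda>j. gram A Z (ts ! (j - 1))) (modes ts)"

lemma gram_root_mode:
  assumes "ttn_factors n r \<sigma> A" "ttn_factors n s \<sigma> Z"
  shows "gram A Z \<sigma> = Mat (root_mode \<sigma>) (A \<sigma>) * (Mat (root_mode \<sigma>) (proj_factor A Z \<sigma>))\<^sup>T"
proof (cases \<sigma>)
  case (Leaf l)
  then show ?thesis using gram_Leaf assms by simp
next
  case (Node ts)
  then show ?thesis using gram_Node assms by simp
qed


definition gram_correct :: "'l factors \<Rightarrow> 'l factors \<Rightarrow> 'l memory \<Rightarrow> 'l tree \<Rightarrow> bool" where
  "gram_correct A Z M \<rho> \<longleftrightarrow> M (W \<rho> Gram) = of_mat (gram A Z \<rho>) \<and> M (rest \<rho>) = proj_factor A Z \<rho>"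

lemma gram_correct_frame:
  assumes "gram_correct A Z M \<rho>" "M' (W \<rho> Gram) = M (W \<rho> Gram)" "M' (rest \<rho>) = M (rest \<rho>)"
  shows "gram_correct A Z M' \<rho>"
  using assms by (simp add: gram_correct_def)

lemma run_copy:
  "a \<noteq> W \<sigma> ZeroS \<Longrightarrow> run qr ev \<tau> (copy \<sigma> d a) M = M(W \<sigma> ZeroS := scalar 0, d := M a)"
  by (auto simp: copy_def)

lemma run_part_prog:
  "run qr ev \<tau> (part_prog ts i) M (W (Node ts) (Part i (length ts))) =
    mode_prods (M (W (Node ts) Res)) (\<lambda>j. Mat 0 (M (W (ts ! (j - 1)) Gram))) (filter (\<lambda>j. j \<noteq> i) (modes ts))"
proof -
  let ?N = "Node ts"
  define Mk where "Mk = (\<lambda>k. run qr ev \<tau>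
    (copy ?N (W ?N (Part i 0)) (W ?N Res) @ concat (map (part_op ts i) [1..<Suc k])) M)"
  have G: "Mk k (W \<sigma> Gram) = M (W \<sigma> Gram)" for k \<sigma>
    unfolding Mk_def
    by (rule run_frame) (auto simp: progwrites_copy dest!: subsetD[OF progwrites_part_op])
  have "Mk k (W ?N (Part i k)) = mode_prods (M (W ?N Res)) (\<lambda>j. Mat 0 (M (W (ts ! (j - 1)) Gram)))
      (filter (\<lambda>j. j \<noteq> i) [1..<Suc k])" for k
  proof (induction k)
    case 0
    then show ?case by (simp add: run_copy Mk_def)
  next
    case (Suc k)
    have "Mk (Suc k) = run qr ev \<tau> (part_op ts i (Suc k)) (Mk k)" by (simp add: Mk_def)
    then have "Mk (Suc k) (W ?N (Part i (Suc k))) = (if Suc k = i then Mk k (W ?N (Part i k))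
        else mode_prod (Suc k) (Mk k (W ?N (Part i k))) (Mat 0 (Mk k (W (ts ! k) Gram))))"
      by (auto simp: part_op_def Let_def run_copy)
    also have "\<dots> = mode_prods (M (W ?N Res)) (\<lambda>j. Mat 0 (M (W (ts ! (j - 1)) Gram)))
        (filter (\<lambda>j. j \<noteq> i) ([1..<Suc k] @ [Suc k]))"
      unfolding G Suc by (simp add: mode_prods_append del: upt_Suc)
    finally show ?case by simp
  qed
  from this[of "length ts"] show ?thesis by (simp add: part_prog_def Let_def upt_modes Mk_def)
qed

lemma rest_neq [simp]: "rest \<rho> \<noteq> W \<sigma> ZeroS" "rest \<rho> \<noteq> W \<sigma> Gram" "rest \<rho> \<noteq> W \<sigma> Proj"
    "rest \<rho> \<noteq> W \<sigma> (PartK i)" "rest \<rho> \<noteq> Factor \<sigma>" "Suc 0 \<le> k \<Longrightarrow> rest \<rho> \<noteq> W \<sigma> (Part k j)"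
    "\<rho> \<noteq> \<sigma> \<Longrightarrow> rest \<rho> \<noteq> W \<sigma> (Part k j)" "\<rho> \<noteq> \<sigma> \<Longrightarrow> rest \<rho> \<noteq> W \<sigma> x"
  by (cases \<rho>; simp)+

lemmas rest_neq' [simp] = rest_neq[THEN not_sym]

context evaluation
begin

text \<open>The alternative in the last hypothesis carries the induction through a list of siblings:
  a result that is already correct stays so, being either untouched or recomputed with the same
  value.\<close>

lemma run_gram_prog:
  assumes A: "ttn_factors n r \<tau> A" and Z: "ttn_factors n s \<tau> Z" and \<sigma>: "\<sigma> \<in> subtrees \<tau>"
    and M: "\<forall>\<rho>\<in>subtrees \<tau>. M (Factor \<rho>) = A \<rho> \<and> M (W \<rho> Res) = Z \<rho>"
    and \<rho>: "\<rho> \<in> subtrees \<tau>" "\<rho> \<in> subtrees \<sigma> \<or> gram_correct A Z M \<rho>"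
  shows "gram_correct A Z (rn (gram_prog \<sigma>) M) \<rho>"
  using \<sigma> M \<rho>
proof (induction \<sigma> arbitrary: M \<rho>)
  case (Leaf l)
  have "gram A Z (Leaf l) = Mat 1 (A (Leaf l)) * (Mat 1 (Z (Leaf l)))\<^sup>T"
    using ttn_factors_subtree[OF A Leaf.prems(1)] ttn_factors_subtree[OF Z Leaf.prems(1)] by (rule gram_Leaf)
  then show ?case using Leaf.prems
    by (cases "\<rho> = Leaf l"; cases \<rho>) (auto simp: gram_correct_def)
next
  case (Node ts)
  let ?N = "Node ts"
  have N: "?N \<in> subtrees \<tau>" by fact
  have fr: "rn (concat (map gram_prog cs)) M x = M x"
    if "x \<in> {Factor \<rho>, W \<rho> Res}" for cs :: "'a tree list" and x \<rho> M
    using that by (intro run_frame notI) (auto dest!: subsetD[OF progwrites_gram_prog])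
  have ch: "gram_correct A Z (rn (concat (map gram_prog cs)) M) \<rho>"
    if "set cs \<subseteq> set ts" "\<rho> \<in> subtrees \<tau>" "(\<exists>c\<in>set cs. \<rho> \<in> subtrees c) \<or> gram_correct A Z M \<rho>"
      "\<forall>\<rho>\<in>subtrees \<tau>. M (Factor \<rho>) = A \<rho> \<and> M (W \<rho> Res) = Z \<rho>" for cs M \<rho>
    using that
  proof (induction cs arbitrary: M)
    case (Cons c cs)
    have c: "c \<in> set ts" using Cons.prems by simp
    let ?M = "rn (gram_prog c) M"
    have "gram_correct A Z (rn (concat (map gram_prog cs)) ?M) \<rho>"
    proof (rule Cons.IH)
      show "(\<exists>c\<in>set cs. \<rho> \<in> subtrees c) \<or> gram_correct A Z ?M \<rho>"
        using Node.IH[OF c child_in[OF N c] Cons.prems(4,2)] Cons.prems(3) by auto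
      show "\<forall>\<rho>\<in>subtrees \<tau>. ?M (Factor \<rho>) = A \<rho> \<and> ?M (W \<rho> Res) = Z \<rho>"
        using fr[of _ _ "[c]" M] Cons.prems(4) by simp
    qed (use Cons.prems in auto)
    then show ?case by simp
  qed simp
  define M1 where "M1 = rn (concat (map gram_prog ts)) M"
  define M2 where "M2 = rn (part_prog ts 0) M1"
  have M1: "\<forall>\<rho>\<in>subtrees \<tau>. M1 (Factor \<rho>) = A \<rho> \<and> M1 (W \<rho> Res) = Z \<rho>"
    using Node.prems(2) fr by (simp add: M1_def)
  have R1: "gram_correct A Z M1 c" if "c \<in> set ts" for c
    unfolding M1_def using that child_in[OF N that] Node.prems(2)
    by (intro ch) (auto intro: bexI[of _ c])
  have M2: "M2 x = M1 x" if "\<forall>j. x \<noteq> W ?N (Part 0 j)" "x \<noteq> W ?N ZeroS" for x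
    unfolding M2_def by (rule run_frame) (use progwrites_part_prog[of \<tau> ts 0] that in blast)
  have "M2 (rest ?N) = mode_prods (M1 (W ?N Res)) (\<lambda>j. Mat 0 (M1 (W (ts ! (j - 1)) Gram)))
      (filter (\<lambda>j. j \<noteq> 0) (modes ts))"
    unfolding M2_def rest.simps by (rule run_part_prog)
  also have "filter (\<lambda>j. j \<noteq> 0) (modes ts) = modes ts" by (intro filter_True) (auto simp: set_modes)
  also have "mode_prods (M1 (W ?N Res)) (\<lambda>j. Mat 0 (M1 (W (ts ! (j - 1)) Gram))) (modes ts) = proj_factor A Z ?N"
    using M1 N R1[OF mode_nth_mem] by (auto intro!: mode_prods_cong simp: gram_correct_def)
  finally have rest: "M2 (rest ?N) = proj_factor A Z ?N" .
  have run: "rn (gram_prog ?N) M = M2(W ?N Gram := of_mat (Mat 0 (M2 (Factor ?N)) * (Mat 0 (M2 (rest ?N)))\<^sup>T))"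
    by (simp add: M2_def M1_def)
  have "M2 (Factor ?N) = A ?N" using M2[of "Factor ?N"] M1 N by simp
  then have G: "rn (gram_prog ?N) M (W ?N Gram) = of_mat (gram A Z ?N)"
    unfolding run rest
    using gram_root_mode[OF ttn_factors_subtree[OF A N] ttn_factors_subtree[OF Z N]] by simp
  show ?case
  proof (cases "\<rho> = ?N")
    case True
    show ?thesis unfolding True gram_correct_def using G rest by (simp add: run del: gram_prog.simps)
  next
    case False
    have "gram_correct A Z M1 \<rho>"
      unfolding M1_def using Node.prems False by (intro ch) auto
    then have "gram_correct A Z M2 \<rho>"
      by (rule gram_correct_frame) (use False in \<open>auto intro!: M2\<close>)
    then show ?thesis
      unfolding run by (rule gram_correct_frame) (use False in auto)
  qed
qed

lemma run_path_prog:
  assumes A: "ttn_factors n r \<tau> A" and Z: "ttn_factors n s \<tau> Z"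
    and p: "is_path \<tau> p \<sigma>"
    and M: "\<forall>\<rho>\<in>subtrees \<tau>. M (Factor \<rho>) = A \<rho> \<and> M (W \<rho> Res) = Z \<rho> \<and> gram_correct A Z M \<rho>"
    and K: "M (W \<tau> Proj) = of_mat (1\<^sub>m 1)"
  shows "rn (path_prog p) M (W \<sigma> Proj) = of_mat (path_mat p A Z)"
    and "\<forall>\<rho>\<in>subtrees \<tau>. gram_correct A Z (rn (path_prog p) M) \<rho>"
proof -
  have frame: "rn (path_prog p) M x = M x" if "is_path \<tau> p \<sigma>"
    "x \<in> {Factor \<rho>, W \<rho> Res, W \<rho> Gram, rest \<rho>}" for p \<sigma> x \<rho>
    using that(2) by (intro run_frame notI) (auto dest!: subsetD[OF progwrites_path_prog[OF that(1)]])
  show "\<forall>\<rho>\<in>subtrees \<tau>. gram_correct A Z (rn (path_prog p) M) \<rho>"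
    using M frame[OF p] by (auto intro: gram_correct_frame)
  show "rn (path_prog p) M (W \<sigma> Proj) = of_mat (path_mat p A Z)"
    using p
  proof (induction p arbitrary: \<sigma>)
    case Nil
    then show ?case using K by simp
  next
    case (Cons x p)
    obtain ts i where x: "x = (ts, i)" by force
    then have p: "is_path \<tau> p (Node ts)" and i: "i \<in> set (modes ts)" and \<sigma>: "\<sigma> = ts ! (i - 1)"
      using Cons.prems by auto
    let ?N = "Node ts"
    have N: "?N \<in> subtrees \<tau>" using p by (rule is_path_subtree)
    define M1 where "M1 = rn (path_prog p) M"
    define M2 where "M2 = rn (part_prog ts i) M1"
    have M1: "M1 (Factor \<rho>) = A \<rho>" "M1 (W \<rho> Res) = Z \<rho>" "M1 (W \<rho> Gram) = of_mat (gram A Z \<rho>)"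
      if "\<rho> \<in> subtrees \<tau>" for \<rho>
      using frame[OF p, of _ \<rho>] M that by (auto simp: M1_def gram_correct_def)
    have P: "M1 (W ?N Proj) = of_mat (path_mat p A Z)" using Cons.IH[OF p] by (simp add: M1_def)
    have M2: "M2 x = M1 x" if "\<forall>j. x \<noteq> W ?N (Part i j)" "x \<noteq> W ?N ZeroS" for x
      unfolding M2_def by (rule run_frame) (use progwrites_part_prog[of \<tau> ts i] that in blast)
    have "M2 (W ?N (Part i (length ts))) = mode_prods (M1 (W ?N Res))
        (\<lambda>j. Mat 0 (M1 (W (ts ! (j - 1)) Gram))) (filter (\<lambda>j. j \<noteq> i) (modes ts))"
      unfolding M2_def by (rule run_part_prog)
    also have "\<dots> = mode_prods (Z ?N) (\<lambda>j. gram A Z (ts ! (j - 1))) (filter (\<lambda>j. j \<noteq> i) (modes ts))"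
      using M1 N child_in[OF N mode_nth_mem] by (auto intro!: mode_prods_cong)
    finally have part: "M2 (W ?N (Part i (length ts))) = \<dots>" .
    have "rn (path_prog (x # p)) M (W \<sigma> Proj) = of_mat (Mat i (M2 (Factor ?N)) *
        (Mat i (mode_prod 0 (M2 (W ?N (Part i (length ts)))) (Mat 0 (M2 (W ?N Proj)))))\<^sup>T)"
      by (simp add: x M1_def M2_def \<sigma>)
    then show ?case using M2[of "Factor ?N"] M2[of "W ?N Proj"] M1[OF N] P part by (simp add: x)
  qed
qed

lemma run_eval_prog:
  fixes M a
  defines "A \<equiv> \<lambda>\<rho>. M (Factor \<rho>)" and "Z \<equiv> ev (scalar_of (M a)) (\<lambda>\<rho>. M (Factor \<rho>))"
  assumes A: "ttn_factors n r \<tau> (\<lambda>\<rho>. M (Factor \<rho>))" and p: "is_path \<tau> p \<sigma>"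
    and K: "M (W \<tau> Proj) = of_mat (1\<^sub>m 1)"
  defines "M' \<equiv> rn (eval_prog \<tau> p a) M"
  shows "M' (W \<sigma> Proj) = of_mat (path_mat p A Z)" "M' (rest \<sigma>) = proj_factor A Z \<sigma>" "M' (W \<sigma> Res) = Z \<sigma>"
    and "\<And>x. x \<notin> eval_regs \<tau> \<Longrightarrow> M' x = M x"
proof -
  have Z: "ttn_factors n s \<tau> Z" unfolding Z_def using A by (rule ev)
  have \<sigma>: "\<sigma> \<in> subtrees \<tau>" using p by (rule is_path_subtree)
  define M1 where "M1 = ex (EvalF a Factor (\<lambda>\<rho>. W \<rho> Res)) M"
  define M2 where "M2 = rn (gram_prog \<tau>) M1"
  have res: "M1 (W \<rho> Res) = Z \<rho>" if "\<rho> \<in> subtrees \<tau>" for \<rho>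
    using that inv_into_f_f[of "\<lambda>\<rho>. W \<rho> Res" "subtrees \<tau>" \<rho>]
    by (simp add: M1_def Let_def Z_def inj_on_def)
  have M1: "M1 x = M x" if "\<forall>\<rho>. x \<noteq> W \<rho> Res" for x
    using that unfolding M1_def by (intro exec_frame) auto
  have M1': "\<forall>\<rho>\<in>subtrees \<tau>. M1 (Factor \<rho>) = A \<rho> \<and> M1 (W \<rho> Res) = Z \<rho>"
    using res M1 by (simp add: A_def)
  have fr: "M2 x = M1 x" if "x \<in> {Factor \<rho>, W \<rho> Res, W \<rho> Proj}" for x \<rho>
    unfolding M2_def using that by (intro run_frame notI) (auto dest!: subsetD[OF progwrites_gram_prog])
  have R: "gram_correct A Z M2 \<rho>" if "\<rho> \<in> subtrees \<tau>" for \<rho>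
    unfolding M2_def using that A Z M1' by (intro run_gram_prog) (auto simp: A_def)
  have M2: "\<forall>\<rho>\<in>subtrees \<tau>. M2 (Factor \<rho>) = A \<rho> \<and> M2 (W \<rho> Res) = Z \<rho> \<and> gram_correct A Z M2 \<rho>"
    using M1' fr R by simp
  have K2: "M2 (W \<tau> Proj) = of_mat (1\<^sub>m 1)" using fr[of "W \<tau> Proj" \<tau>] M1[of "W \<tau> Proj"] K by simp
  have M': "M' = rn (path_prog p) M2" by (simp add: M'_def eval_prog_def M2_def M1_def)
  note P = run_path_prog[OF A[folded A_def] Z p M2 K2]
  show "M' (W \<sigma> Proj) = of_mat (path_mat p A Z)" using P(1) by (simp add: M')
  show "M' (rest \<sigma>) = proj_factor A Z \<sigma>" using P(2) \<sigma> by (simp add: M' gram_correct_def)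
  have "M' (W \<sigma> Res) = M2 (W \<sigma> Res)"
    unfolding M' by (intro run_frame notI) (auto dest!: subsetD[OF progwrites_path_prog[OF p]])
  then show "M' (W \<sigma> Res) = Z \<sigma>" using M2 \<sigma> by simp
  show "M' x = M x" if "x \<notin> eval_regs \<tau>" for x
    unfolding M'_def using progwrites_eval_prog[OF p, of a] that by (intro run_frame) blast
qed

section \<open>Execution of the right-hand sides\<close>

fun own_fun :: "'a tree \<Rightarrow> (real \<Rightarrow> tensor \<Rightarrow> tensor) \<Rightarrow> 'a factors \<Rightarrow> real \<Rightarrow> tensor \<Rightarrow> tensor" where
  "own_fun (Leaf l) f C = f"
| "own_fun (Node ts) f C = (\<lambda>t A. mode_prods (f t (mode_prods A (\<lambda>i. basis C (ts ! (i - 1))) (modes ts)))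
     (\<lambda>i. (basis C (ts ! (i - 1)))\<^sup>T) (modes ts))"

text \<open>Inserting the vector of the solver at \<open>\<sigma>\<close> yields factors that agree
  with \<open>C\<close> outside, so \<open>represents\<close> applies to them; the rest is
  \<open>leaf_rhs\<close> or \<open>Psi_rhs\<close>.\<close>

lemma run_own_rhs:
  assumes rep: "represents n r \<tau> ev p \<sigma> f C" and p: "is_path \<tau> p \<sigma>" and C: "ttn_factors n r \<tau> C"
    and F: "\<forall>\<rho>\<in>subtrees \<tau> - {\<sigma>}. M (Factor \<rho>) = C \<rho>" and K: "M (W \<tau> Proj) = of_mat (1\<^sub>m 1)"
    and v: "M v \<in> carrier_tensor (slot_dims \<sigma> (Vec 0))" "v \<noteq> W \<sigma> ZeroS"
    and a: "a \<noteq> W \<sigma> ZeroS" "a \<noteq> Factor \<sigma>"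
  shows "rn (own_rhs \<tau> \<sigma> p d a v) M d = own_fun \<sigma> f C (scalar_of (M a)) (M v)"
proof -
  have \<sigma>: "\<sigma> \<in> subtrees \<tau>" using p by (rule is_path_subtree)
  show ?thesis
  proof (cases \<sigma>)
    case (Leaf l)
    define M1 where "M1 = M(Factor \<sigma> := of_mat ((Mat 0 (M v))\<^sup>T))"
    define A where "A = (\<lambda>\<rho>. M1 (Factor \<rho>))"
    define Z where "Z = ev (scalar_of (M1 a)) A"
    define M2 where "M2 = rn (eval_prog \<tau> p a) M1"
    have v': "M v \<in> carrier_tensor [r \<sigma>, n l]" using v(1) by (simp add: Leaf)
    have mv: "Mat 0 (M v) \<in> carrier_mat (r \<sigma>) (n l)" using v' by (rule dim_Mat_0_2)
    have "A \<sigma> \<in> carrier_tensor [n l, r \<sigma>]" using mv by (auto simp: A_def M1_def intro: of_mat_carrier)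
    then have A: "ttn_factors n r \<tau> A"
      using C F by (auto simp: ttn_factors_def A_def M1_def Leaf)
    have K1: "M1 (W \<tau> Proj) = of_mat (1\<^sub>m 1)" using K by (simp add: M1_def)
    note E = run_eval_prog[OF A[unfolded A_def] p K1, where a = a, folded A_def, folded Z_def, folded M2_def]
    have Z: "ttn_factors n s \<tau> Z" unfolding Z_def using A by (rule ev)
    have "ttn A \<sigma> = M v" using of_mat_Mat[OF v'] by (simp add: Leaf A_def M1_def)
    moreover have "M1 a = M a" using a by (simp add: M1_def)
    moreover have "\<forall>\<rho>\<in>subtrees \<tau> - subtrees \<sigma>. A \<rho> = C \<rho>" using F by (auto simp: A_def M1_def Leaf)
    ultimately have "f (scalar_of (M a)) (M v) = mode_prod 0 (ttn Z \<sigma>) (path_mat p A Z)"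
      using rep A unfolding represents_def Z_def by metis
    also have "\<dots> = of_mat ((Mat 0 (mode_prod 1 (Z \<sigma>) (path_mat p A Z)))\<^sup>T)"
      using leaf_rhs[OF ttn_factors_subtree[OF Z \<sigma>[unfolded Leaf]], of "path_mat p A Z" "r \<sigma>"]
        path_mat_carrier[OF A Z root p] by (simp add: Leaf)
    finally show ?thesis
      using E(1,3) by (simp add: Leaf M2_def M1_def)
  next
    case (Node ts)
    define M1 where "M1 = M(W \<sigma> ZeroS := scalar 0, Factor \<sigma> := M v)"
    define A where "A = (\<lambda>\<rho>. M1 (Factor \<rho>))"
    define Z where "Z = ev (scalar_of (M1 a)) A"
    define M2 where "M2 = rn (eval_prog \<tau> p a) M1"
    have v': "M v \<in> carrier_tensor (factor_dims n r \<sigma>)" using v(1) by (simp add: Node)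
    then have A: "ttn_factors n r \<tau> A"
      using C F by (auto simp: ttn_factors_def A_def M1_def)
    have K1: "M1 (W \<tau> Proj) = of_mat (1\<^sub>m 1)" using K by (simp add: M1_def)
    note E = run_eval_prog[OF A[unfolded A_def] p K1, where a = a, folded A_def, folded Z_def, folded M2_def]
    have Z: "ttn_factors n s \<tau> Z" unfolding Z_def using A by (rule ev)
    have b: "basis A (ts ! (i - 1)) = basis C (ts ! (i - 1))" if i: "i \<in> set (modes ts)" for i
    proof (rule basis_cong)
      fix \<rho> assume \<rho>: "\<rho> \<in> subtrees (ts ! (i - 1))"
      then have "\<rho> \<noteq> \<sigma>" using Node_notin_child[OF mode_nth_mem[OF i]] by (auto simp: Node)
      moreover have "\<rho> \<in> subtrees \<tau>"
        using subtrees_trans[OF \<rho> child_in[OF \<sigma>[unfolded Node] mode_nth_mem[OF i]]] .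
      ultimately show "A \<rho> = C \<rho>" using F by (simp add: A_def M1_def)
    qed
    have "ttn A \<sigma> = mode_prods (M v) (\<lambda>i. basis C (ts ! (i - 1))) (modes ts)"
    proof -
      have "A (Node ts) = M v" by (simp add: A_def M1_def Node)
      then show ?thesis unfolding Node ttn_Node by (auto intro: mode_prods_cong b simp del: One_nat_def)
    qed
    moreover have "M1 a = M a" using a by (simp add: M1_def)
    moreover have "\<forall>\<rho>\<in>subtrees \<tau> - subtrees \<sigma>. A \<rho> = C \<rho>" using F by (auto simp: A_def M1_def)
    ultimately have "f (scalar_of (M a)) (mode_prods (M v) (\<lambda>i. basis C (ts ! (i - 1))) (modes ts)) =
        mode_prod 0 (ttn Z \<sigma>) (path_mat p A Z)"
      using rep A unfolding represents_def Z_def by metis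
    then have "own_fun \<sigma> f C (scalar_of (M a)) (M v) =
        mode_prods (mode_prod 0 (ttn Z \<sigma>) (path_mat p A Z)) (\<lambda>i. (basis A (ts ! (i - 1)))\<^sup>T) (modes ts)"
      using b by (auto simp: Node simp del: One_nat_def intro!: mode_prods_cong)
    also have "\<dots> = mode_prod 0 (proj_factor A Z \<sigma>) (path_mat p A Z)"
      using Psi_rhs[OF ttn_factors_subtree[OF A \<sigma>[unfolded Node]] ttn_factors_subtree[OF Z \<sigma>[unfolded Node]]]
        path_mat_carrier[OF A Z root p] by (simp add: Node)
    finally show ?thesis
      using E(1,2) v(2) by (simp add: Node M2_def M1_def run_copy)
  qed
qed

end

lemma axpy_of_mat: "axpy (-2) (of_mat X) (of_mat X) = of_mat (- X)"
proof (rule tensor_eqI)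
  show "of_mat (- X) \<in> carrier_tensor [dim_row X, dim_col X]" by (intro of_mat_carrier) simp
  show "axpy (-2) (of_mat X) (of_mat X) \<in> carrier_tensor [dim_row X, dim_col X]"
    by (intro axpy_carrier of_mat_carrier) auto
  fix js assume v: "valid_index [dim_row X, dim_col X] js"
  have "entry (of_mat (- X)) js = - entry (of_mat X) js"
  proof -
    have "colex (drop_nth 0 [dim_row X, dim_col X]) (drop_nth 0 js) < dim_col X"
      using colex_less[OF drop_nth_valid[OF v, of 0]] by simp
    moreover have "js ! 0 < dim_row X" using v by (auto simp: valid_index_iff)
    ultimately show ?thesis using v by (simp add: of_mat_def entry_Ten del: drop_nth_2)
  qed
  moreover have "colex [dim_row X, dim_col X] js < dim_vec (vals (of_mat X))"
    using colex_less[OF v] of_mat_carrier[of X "dim_row X" "dim_col X"] by (simp add: carrier_tensor_def)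
  then have "entry (axpy (-2) (of_mat X) (of_mat X)) js = - entry (of_mat X) js"
    using of_mat_carrier[of X "dim_row X" "dim_col X"] by (simp add: axpy_def entry_def carrier_tensor_def)
  ultimately show "entry (axpy (-2) (of_mat X) (of_mat X)) js = entry (of_mat (- X)) js" by simp
qed

context evaluation
begin

text \<open>Each evaluation overwrites \<open>Factor \<sigma>\<close> by the factor multiplied with
  the current matrix, whereas the basis in the equation is constant. This is why the latter is kept
  in \<open>Saved\<close>.\<close>

lemma run_S_rhs:
  assumes rep: "represents n r \<tau> ev p \<sigma> f C" and p: "is_path \<tau> p \<sigma>" and C: "ttn_factors n r \<tau> C"
    and F: "\<forall>\<rho>\<in>subtrees \<tau> - {\<sigma>}. M (Factor \<rho>) = C \<rho>" and K: "M (W \<tau> Proj) = of_mat (1\<^sub>m 1)"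
    and X: "M (W \<sigma> Saved) = C \<sigma>"
    and v: "M v \<in> carrier_tensor [r \<sigma>, r \<sigma>]"
    and a: "a \<noteq> W \<sigma> TrS" "a \<noteq> Factor \<sigma>"
  shows "rn (S_rhs \<tau> \<sigma> p d a v) M d = of_mat (- ((basis C \<sigma>)\<^sup>T *
    (Mat 0 (f (scalar_of (M a)) (mode_prod 0 (ttn C \<sigma>) ((Mat 0 (M v))\<^sup>T))))\<^sup>T))"
proof -
  have \<sigma>: "\<sigma> \<in> subtrees \<tau>" using p by (rule is_path_subtree)
  have C\<sigma>: "ttn_factors n r \<sigma> C" using C \<sigma> by (rule ttn_factors_subtree)
  let ?S = "(Mat 0 (M v))\<^sup>T" and ?rm = "root_mode \<sigma>"
  have S: "?S \<in> carrier_mat (r \<sigma>) (r \<sigma>)" using dim_Mat_0_2[OF v] by simp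
  define M1 where "M1 = M(W \<sigma> TrS := of_mat ?S, Factor \<sigma> := mode_prod ?rm (C \<sigma>) ?S)"
  define A where "A = (\<lambda>\<rho>. M1 (Factor \<rho>))"
  define Z where "Z = ev (scalar_of (M1 a)) A"
  define M2 where "M2 = rn (eval_prog \<tau> p a) M1"
  have rm: "?rm = (case \<sigma> of Leaf l \<Rightarrow> 1 | Node ts \<Rightarrow> 0)" by (cases \<sigma>) auto
  have mr: "mult_root \<sigma> ?S C = C(\<sigma> := mode_prod ?rm (C \<sigma>) ?S)"
    unfolding rm by (rule ttn_factors_mult_root(1)[OF C\<sigma> S])
  have A_eq: "A \<rho> = mult_root \<sigma> ?S C \<rho>" if "\<rho> \<in> subtrees \<tau>" for \<rho>
    using F that by (auto simp: mr A_def M1_def)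
  have "mult_root \<sigma> ?S C \<sigma> \<in> carrier_tensor (factor_dims n r \<sigma>)"
    by (rule ttn_factors_mult_root(2)[OF C\<sigma> S])
  then have A: "ttn_factors n r \<tau> A"
    using C unfolding ttn_factors_def by (auto simp: A_eq) (auto simp: mr)
  have K1: "M1 (W \<tau> Proj) = of_mat (1\<^sub>m 1)" using K by (simp add: M1_def)
  note E = run_eval_prog[OF A[unfolded A_def] p K1, where a = a, folded A_def, folded Z_def, folded M2_def]
  have Z: "ttn_factors n s \<tau> Z" unfolding Z_def using A by (rule ev)
  have P: "path_mat p A Z \<in> carrier_mat (r \<sigma>) (s \<sigma>)" by (rule path_mat_carrier[OF A Z root p])
  have "ttn A \<sigma> = ttn (mult_root \<sigma> ?S C) \<sigma>"
    by (rule ttn_cong) (simp add: A_eq subtrees_trans[OF _ \<sigma>])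
  then have "ttn A \<sigma> = mode_prod 0 (ttn C \<sigma>) ?S" using ttn_mult_root[OF C\<sigma> S] by simp
  moreover have "M1 a = M a" using a by (simp add: M1_def)
  moreover have "\<forall>\<rho>\<in>subtrees \<tau> - subtrees \<sigma>. A \<rho> = C \<rho>" using F by (auto simp: A_def M1_def)
  ultimately have f: "f (scalar_of (M a)) (mode_prod 0 (ttn C \<sigma>) ?S) = mode_prod 0 (ttn Z \<sigma>) (path_mat p A Z)"
    using rep A unfolding represents_def Z_def by metis
  \<comment> \<open>\<open>A\<close> and \<open>C\<close> differ only in the factor at the root of
    this part, and the projected factor involves only the bases of the direct subtrees.\<close>
  have pf: "proj_factor A Z \<sigma> = proj_factor C Z \<sigma>"
  proof (cases \<sigma>)
    case (Node ts)
    have "gram A Z (ts ! (i - 1)) = gram C Z (ts ! (i - 1))" if i: "i \<in> set (modes ts)" for i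
      unfolding gram_def
    proof (intro arg_cong2[where f = "(*)"] arg_cong[where f = transpose_mat] basis_cong refl)
      fix \<rho> assume \<rho>: "\<rho> \<in> subtrees (ts ! (i - 1))"
      then have "\<rho> \<noteq> \<sigma>" using Node_notin_child[OF mode_nth_mem[OF i]] by (auto simp: Node)
      moreover have "\<rho> \<in> subtrees \<tau>"
        using subtrees_trans[OF \<rho> child_in[OF \<sigma>[unfolded Node] mode_nth_mem[OF i]]] .
      ultimately show "A \<rho> = C \<rho>" by (simp add: A_eq mr)
    qed
    then show ?thesis by (auto simp: Node simp del: One_nat_def intro!: mode_prods_cong)
  qed simp
  have g: "Mat ?rm (C \<sigma>) * (Mat ?rm (proj_factor A Z \<sigma>))\<^sup>T = gram C Z \<sigma>"
    unfolding pf by (rule gram_root_mode[OF C\<sigma> ttn_factors_subtree[OF Z \<sigma>], symmetric])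
  have gc: "gram C Z \<sigma> \<in> carrier_mat (r \<sigma>) (s \<sigma>)"
    by (rule gram_carrier[OF C\<sigma> ttn_factors_subtree[OF Z \<sigma>]])
  have X2: "M2 (W \<sigma> Saved) = C \<sigma>"
    using E(4)[of "W \<sigma> Saved"] X by (simp add: M1_def eval_regs_def)
  have m: "mode_prod 1 (of_mat (gram C Z \<sigma>)) (path_mat p A Z) = of_mat (gram C Z \<sigma> * (path_mat p A Z)\<^sup>T)"
    using mode_prod_1_2[OF of_mat_carrier[OF gc] P] by simp
  have M1_run: "rn [Transpose (W \<sigma> TrS) v, ModeProd (Factor \<sigma>) ?rm (W \<sigma> Saved) (W \<sigma> TrS)] M = M1"
    by (simp add: M1_def X)
  have "rn (S_rhs \<tau> \<sigma> p d a v) M d = axpy (-2) (of_mat (gram C Z \<sigma> * (path_mat p A Z)\<^sup>T))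
      (of_mat (gram C Z \<sigma> * (path_mat p A Z)\<^sup>T))"
    unfolding S_rhs_def run_simps(3) M1_run M2_def[symmetric]
    using E(1,2) X2 g m by (cases \<sigma>) (auto simp del: rest.simps)
  also have "\<dots> = of_mat (- (gram C Z \<sigma> * (path_mat p A Z)\<^sup>T))" by (rule axpy_of_mat)
  also have "gram C Z \<sigma> * (path_mat p A Z)\<^sup>T = (basis C \<sigma>)\<^sup>T * (Mat 0 (mode_prod 0 (ttn Z \<sigma>) (path_mat p A Z)))\<^sup>T"
    by (rule gram_path[OF C\<sigma> ttn_factors_subtree[OF Z \<sigma>] P, symmetric])
  finally show ?thesis unfolding f .
qed

end

section \<open>Execution of a solver and of the equation of a subtree\<close>

definition factors :: "'l memory \<Rightarrow> 'l factors" where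
  "factors M = (\<lambda>\<rho>. M (Factor \<rho>))"

lemma run_init_prog:
  assumes y: "\<And>i. y \<noteq> v i" "y \<noteq> W \<sigma> ZeroS" "\<And>i. y \<noteq> W \<sigma> (ScalR i)"
    and v: "\<And>i. v i \<noteq> W \<sigma> ZeroS" "\<And>i j. v i \<noteq> W \<sigma> (ScalR j)" "\<And>i. v i \<noteq> Time0" "\<And>i. v i \<noteq> Time1"
    and t: "M Time0 = scalar t0" "M Time1 = scalar t1" and i: "i < nregs S"
  shows "run qr ev \<tau> (init_prog S \<sigma> v y) M (v i) = M y"
    and "run qr ev \<tau> (init_prog S \<sigma> v y) M (W \<sigma> (ScalR i)) = scalar (((\<lambda>_. 0)(0 := t0, 1 := t1)) i)"
proof -
  let ?r = "run qr ev \<tau>"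
  have 1: "?r (concat (map (\<lambda>i. copy \<sigma> (v i) y) is)) M (v i) = M y" if "i \<in> set is \<or> M (v i) = M y" for "is" M
    using that
  proof (induction "is" arbitrary: M)
    case (Cons j "is")
    let ?M = "M(W \<sigma> ZeroS := scalar 0, v j := M y)"
    have "?r (concat (map (\<lambda>i. copy \<sigma> (v i) y) is)) ?M (v i) = ?M y"
      using Cons.prems y v by (intro Cons.IH) auto
    then show ?case using y by (simp add: run_copy)
  qed simp
  have 2: "?r (map (\<lambda>i. Const (W \<sigma> (ScalR i)) 0) is) M (W \<sigma> (ScalR i)) = scalar 0"
    if "i \<in> set is \<or> M (W \<sigma> (ScalR i)) = scalar 0" for "is" M
    using that by (induction "is" arbitrary: M) auto
  define M1 where "M1 = ?r (concat (map (\<lambda>i. copy \<sigma> (v i) y) [0..<nregs S])) M"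
  define M2 where "M2 = ?r (map (\<lambda>i. Const (W \<sigma> (ScalR i)) 0) [0..<nregs S]) M1"
  have run: "?r (init_prog S \<sigma> v y) M = ?r (copy \<sigma> (W \<sigma> (ScalR 1)) Time1) (?r (copy \<sigma> (W \<sigma> (ScalR 0)) Time0) M2)"
    by (simp add: init_prog_def M1_def M2_def)
  have M1: "M1 x = M x" if "x \<in> {Time0, Time1}" for x
    unfolding M1_def by (rule run_frame) (use that v v[THEN not_sym] in \<open>auto simp: progwrites_copy\<close>)
  have M2: "M2 x = M1 x" if "\<forall>j. x \<noteq> W \<sigma> (ScalR j)" for x
    unfolding M2_def by (rule run_frame) (use that in \<open>auto simp: progwrites_def\<close>)
  have "M1 (v i) = M y" unfolding M1_def using i by (intro 1) simp
  then show "?r (init_prog S \<sigma> v y) M (v i) = M y"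
    using v M2[of "v i"] by (simp add: run run_copy)
  have "M2 (W \<sigma> (ScalR i)) = scalar 0" unfolding M2_def using i by (intro 2) simp
  then show "?r (init_prog S \<sigma> v y) M (W \<sigma> (ScalR i)) = scalar (((\<lambda>_. 0)(0 := t0, 1 := t1)) i)"
    using M1 M2 t by (simp add: run run_copy)
qed

context evaluation
begin

text \<open>A simulation of \<open>solve\<close> on the registers \<open>Y\<close> with numbers
  below \<open>nregs S\<close>. \<open>E\<close> consists of the scratch registers of the right-hand
  side, \<open>G\<close> of the registers on whose values its meaning depends. Nothing written may
  lie in \<open>G\<close>, so the meaning is the same at every operation.\<close>

lemma run_solve_prog:
  fixes v :: "nat \<Rightarrow> 'a reg" and \<sigma> y M
  defines "Y \<equiv> v ` {..<nregs S} \<union> (\<lambda>i. W \<sigma> (ScalR i)) ` {..<nregs S}"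
  assumes \<sigma>: "\<sigma> \<in> subtrees \<tau>" and v: "\<And>i. i < nregs S \<Longrightarrow> v i \<in> Regs \<and> ty (v i) = ty y"
    and X: "{y, Time0, Time1} \<subseteq> X" "typed X M"
    and rhs: "\<And>Y i j k. X \<subseteq> Y \<Longrightarrow> W \<sigma> (ScalR j) \<in> Y \<Longrightarrow> v k \<in> Y \<Longrightarrow> i < nregs S \<Longrightarrow> j < nregs S \<Longrightarrow>
      k < nregs S \<Longrightarrow> checks Y (rhs (v i) (W \<sigma> (ScalR j)) (v k))"
    and wr: "\<And>i j k. i < nregs S \<Longrightarrow> j < nregs S \<Longrightarrow> k < nregs S \<Longrightarrow>
      progwrites \<tau> (rhs (v i) (W \<sigma> (ScalR j)) (v k)) \<subseteq> insert (v i) E"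
    and E: "E \<inter> Y = {}" "E \<inter> G = {}" and G: "Y \<inter> G = {}" "W \<sigma> ZeroS \<notin> G"
    and sem: "\<And>M' i j k. i < nregs S \<Longrightarrow> j < nregs S \<Longrightarrow> k < nregs S \<Longrightarrow>
      (\<forall>x\<in>G. M' x = M x) \<Longrightarrow> M' (v k) \<in> carrier_tensor (ty y) \<Longrightarrow>
      rn (rhs (v i) (W \<sigma> (ScalR j)) (v k)) M' (v i) = f (scalar_of (M' (W \<sigma> (ScalR j)))) (M' (v k))"
    and y: "\<And>i. y \<noteq> v i" "y \<noteq> W \<sigma> ZeroS" "\<And>i. y \<noteq> W \<sigma> (ScalR i)"
    and v': "\<And>i. v i \<noteq> W \<sigma> ZeroS" "\<And>i j. v i \<noteq> W \<sigma> (ScalR j)" "\<And>i. v i \<noteq> Time0" "\<And>i. v i \<noteq> Time1"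
      "inj v"
    and t: "M Time0 = scalar t0" "M Time1 = scalar t1"
  shows "rn (solve_prog S rhs \<sigma> v y) M (v 0) = solve S t0 t1 f (M y)"
proof -
  let ?sc = "\<lambda>i. W \<sigma> (ScalR i)"
  define M0 where "M0 = rn (init_prog S \<sigma> v y) M"
  have ini: "progwrites \<tau> (init_prog S \<sigma> v y) \<subseteq> insert (W \<sigma> ZeroS) Y"
    using nregs_pos by (auto simp: init_prog_def progwrites_copy Y_def) (auto simp: progwrites_def)
  have "typed (X \<union> progwrites \<tau> (init_prog S \<sigma> v y)) M0"
    unfolding M0_def using checks_init_prog[where v = v, OF \<sigma> _ X(1)] v X(2) by (intro run_typed) auto
  then have ty0: "typed (X \<union> Y) M0"
    by (rule typed_mono) (use init_prog_written[where v = v and \<sigma> = \<sigma> and y = y] in \<open>auto simp: Y_def\<close>)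
  have G0: "\<forall>x\<in>G. M0 x = M x"
    unfolding M0_def using ini G by (auto intro!: run_frame)
  have sim0: "M0 (v i) = M y" "M0 (?sc i) = scalar (((\<lambda>_. 0)(0 := t0, 1 := t1)) i)" if "i < nregs S" for i
    unfolding M0_def using run_init_prog[where v = v and y = y and M = M, OF y v'(1-4) t that] by auto
  have step: "\<forall>i<nregs S. rn (concat (map (op_prog rhs ?sc v) ops)) M' (v i) =
      snd (fold (solver_step f) ops (a, w)) i"
    if "set ops \<subseteq> set S" "typed (X \<union> Y) M'" "\<forall>x\<in>G. M' x = M x"
      "\<forall>i<nregs S. M' (v i) = w i \<and> M' (?sc i) = scalar (a i)" for ops M' a w
    using that
  proof (induction ops arbitrary: M' a w)
    case (Cons opr ops)
    let ?P = "op_prog rhs ?sc v opr"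
    have opr: "op_size opr < nregs S" using Cons.prems(1) by (intro op_size_le) auto
    have Yi: "v i \<in> Y" "?sc i \<in> Y" if "i < nregs S" for i using that by (auto simp: Y_def)
    have ck: "checks (X \<union> Y) ?P"
      using opr v rhs[of "X \<union> Y"] \<sigma> Yi by (cases opr) auto
    have pw: "progwrites \<tau> ?P \<subseteq> Y \<union> E"
    proof (cases opr)
      case (Rhs i j k)
      then show ?thesis using wr[of i j k] opr Yi by auto
    qed (use opr Yi in auto)
    obtain a' w' where aw: "solver_step f opr (a, w) = (a', w')" by force
    have "typed (X \<union> Y \<union> progwrites \<tau> ?P) (rn ?P M')" using ck Cons.prems(2) by (rule run_typed)
    then have 1: "typed (X \<union> Y) (rn ?P M')" by (rule typed_mono) simp
    have 2: "\<forall>x\<in>G. rn ?P M' x = M x"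
      using pw E G Cons.prems(3) by (auto intro!: trans[OF run_frame])
    have 3: "\<forall>i<nregs S. rn ?P M' (v i) = w' i \<and> rn ?P M' (?sc i) = scalar (a' i)"
    proof (cases opr)
      case (Rhs i j k)
      then have ijk: "i < nregs S" "j < nregs S" "k < nregs S" using opr by auto
      have "rn ?P M' (v i) = f (scalar_of (M' (?sc j))) (M' (v k))"
        using sem[OF ijk Cons.prems(3)] typedD[OF Cons.prems(2), of "v k"] Yi(1)[OF ijk(3)] v[OF ijk(3)]
        by (simp add: Rhs)
      moreover have "rn ?P M' x = M' x" if "x \<in> Y" "x \<noteq> v i" for x
        using that wr[OF ijk] E(1) by (intro run_frame) (auto simp: Rhs)
      ultimately show ?thesis
        using Cons.prems(4) ijk Yi v' v'(1-4)[THEN not_sym] aw by (auto simp: Rhs inj_eq)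
    next
      case (Update i j k l)
      then show ?thesis using Cons.prems(4) opr v' v'(1-4)[THEN not_sym] aw by (auto simp: inj_eq)
    next
      case (Dot i j k)
      then show ?thesis using Cons.prems(4) opr v' v'(1-4)[THEN not_sym] aw by (auto simp: inj_eq)
    next
      case (Lit i x)
      then show ?thesis using Cons.prems(4) opr v' v'(1-4)[THEN not_sym] aw by (auto simp: inj_eq)
    next
      case (Scal i o' j k)
      then show ?thesis using Cons.prems(4) opr v' v'(1-4)[THEN not_sym] aw by (auto simp: inj_eq)
    qed
    show ?case using Cons.IH[OF _ 1 2 3] Cons.prems(1) aw by simp
  qed simp
  show ?thesis
    using step[OF order_refl ty0 G0, of "\<lambda>_. M y" "(\<lambda>_. 0)(0 := t0, 1 := t1)"] sim0 nregs_pos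
    by (simp add: solve_prog_def solve_def M0_def)
qed

definition invar :: "real \<Rightarrow> real \<Rightarrow> 'a memory \<Rightarrow> bool" where
  "invar t0 t1 M \<longleftrightarrow> typed base_regs M \<and> M Time0 = scalar t0 \<and> M Time1 = scalar t1 \<and>
     M (W \<tau> Proj) = of_mat (1\<^sub>m 1)"

lemma invar_run:
  assumes "invar t0 t1 M" "checks base_regs P" "{Time0, Time1, W \<tau> Proj} \<inter> progwrites \<tau> P = {}"
  shows "invar t0 t1 (rn P M)"
proof -
  have "typed base_regs (rn P M)"
    using run_typed[OF assms(2)] assms(1) by (auto simp: invar_def intro: typed_mono)
  then show ?thesis using assms by (simp add: invar_def run_frame)
qed

lemma invar_factors: "invar t0 t1 M \<Longrightarrow> ttn_factors n r \<tau> (factors M)"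
  using typedD[of base_regs M "Factor _"] by (auto simp: invar_def ttn_factors_def factors_def base_regs_def)

lemma progwrites_own_rhs:
  "is_path \<tau> p \<sigma> \<Longrightarrow> progwrites \<tau> (own_rhs \<tau> \<sigma> p d a v) \<subseteq> insert d (eval_regs \<tau> \<union> {Factor \<sigma>, W \<sigma> LeafT})"
  using progwrites_eval_prog[of \<tau> p \<sigma> a]
  by (cases \<sigma>) (auto simp: progwrites_copy eval_regs_def)

lemma progwrites_own_prog:
  assumes p: "is_path \<tau> p \<sigma>"
  shows "progwrites \<tau> (own_prog S \<tau> \<sigma> p) \<subseteq> eval_regs \<tau> \<union> {Factor \<sigma>} \<union>
    {W \<sigma> x | x. x \<in> {LeafT, LeafV} \<or> (\<exists>i. x = Vec i \<or> x = ScalR i)}"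
proof -
  let ?E = "eval_regs \<tau> \<union> {Factor \<sigma>, W \<sigma> LeafT}"
  have "progwrites \<tau> (solve_prog S (own_rhs \<tau> \<sigma> p) \<sigma> (\<lambda>i. W \<sigma> (Vec i)) y) \<subseteq>
    insert (W \<sigma> ZeroS) ((\<lambda>i. W \<sigma> (Vec i)) ` {..<nregs S} \<union> (\<lambda>i. W \<sigma> (ScalR i)) ` {..<nregs S} \<union> ?E)" for y
    using progwrites_own_rhs[OF p] by (rule progwrites_solve_prog)
  moreover have "W \<sigma> ZeroS \<in> eval_regs \<tau>" by (simp add: eval_regs_def)
  ultimately have "progwrites \<tau> (solve_prog S (own_rhs \<tau> \<sigma> p) \<sigma> (\<lambda>i. W \<sigma> (Vec i)) y) \<subseteq>
    eval_regs \<tau> \<union> {Factor \<sigma>} \<union> {W \<sigma> x | x. x \<in> {LeafT, LeafV} \<or> (\<exists>i. x = Vec i \<or> x = ScalR i)}" for y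
    by fastforce
  then show ?thesis using \<open>W \<sigma> ZeroS \<in> eval_regs \<tau>\<close> by (cases \<sigma>) (auto simp: progwrites_copy)
qed

lemma eval_regs_disjoint: "Time0 \<notin> eval_regs \<tau>" "Time1 \<notin> eval_regs \<tau>" "W \<tau> Proj \<notin> eval_regs \<tau>"
    "Factor \<rho> \<notin> eval_regs \<tau>" "W \<rho> (Vec i) \<notin> eval_regs \<tau>" "W \<rho> (VecS i) \<notin> eval_regs \<tau>"
    "W \<rho> (ScalR i) \<notin> eval_regs \<tau>" "W \<rho> Saved \<notin> eval_regs \<tau>" "W \<rho> (RF i) \<notin> eval_regs \<tau>"
    "W \<rho> LeafV \<notin> eval_regs \<tau>" "W \<rho> ZeroS \<in> eval_regs \<tau>"
  by (auto simp: eval_regs_def)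

text \<open>The differential equation solved at a subtree after its direct subtrees have been treated:
  the whole integrator for a leaf, and \<open>Psi\<close> for any other subtree.\<close>

fun own_update :: "((real \<Rightarrow> tensor \<Rightarrow> tensor) \<Rightarrow> tensor \<Rightarrow> tensor) \<Rightarrow> 'a tree \<Rightarrow>
    (real \<Rightarrow> tensor \<Rightarrow> tensor) \<Rightarrow> 'a factors \<Rightarrow> tensor" where
  "own_update sol (Leaf l) f C = of_mat ((Mat 0 (sol f (ttn C (Leaf l))))\<^sup>T)"
| "own_update sol (Node ts) f C = sol (own_fun (Node ts) f C) (C (Node ts))"

lemma run_own_prog:
  assumes I: "invar t0 t1 M" and p: "is_path \<tau> p \<sigma>" and rep: "represents n r \<tau> ev p \<sigma> f (factors M)"
  shows "factors (rn (own_prog S \<tau> \<sigma> p) M) = (factors M)(\<sigma> := own_update (solve S t0 t1) \<sigma> f (factors M))"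
    and "invar t0 t1 (rn (own_prog S \<tau> \<sigma> p) M)"
proof -
  have \<sigma>: "\<sigma> \<in> subtrees \<tau>" using p by (rule is_path_subtree)
  let ?v = "\<lambda>i. W \<sigma> (Vec i)"
  have C: "ttn_factors n r \<tau> (factors M)" using I by (rule invar_factors)
  have sv: "rn (solve_prog S (own_rhs \<tau> \<sigma> p) \<sigma> ?v y) M' (?v 0) = solve S t0 t1 (own_fun \<sigma> f (factors M)) (M' y)"
    if M': "\<forall>x. x \<noteq> W \<sigma> LeafV \<longrightarrow> M' x = M x" and X: "typed (insert y base_regs) M'"
      and y: "ty y = slot_dims \<sigma> (Vec 0)" "y \<in> {W \<sigma> LeafV, Factor \<sigma>}" for y M'
  proof (rule run_solve_prog[where G = "Factor ` (subtrees \<tau> - {\<sigma>}) \<union> {W \<tau> Proj}" and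
        E = "eval_regs \<tau> \<union> {Factor \<sigma>, W \<sigma> LeafT}", OF \<sigma>])
    show "?v i \<in> Regs \<and> ty (?v i) = ty y" if "i < nregs S" for i
      using that \<sigma> y by simp
    show "checks Y (own_rhs \<tau> \<sigma> p (?v i) (W \<sigma> (ScalR j)) (?v k))"
      if "insert y base_regs \<subseteq> Y" "W \<sigma> (ScalR j) \<in> Y" "?v k \<in> Y" "i < nregs S" for Y i j k
      using that \<sigma> by (intro checks_own_rhs[OF p]) auto
    show "progwrites \<tau> (own_rhs \<tau> \<sigma> p (?v i) (W \<sigma> (ScalR j)) (?v k)) \<subseteq>
        insert (?v i) (eval_regs \<tau> \<union> {Factor \<sigma>, W \<sigma> LeafT})" for i j k
      by (rule progwrites_own_rhs[OF p])
    fix M'' i j k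
    assume G: "\<forall>x\<in>Factor ` (subtrees \<tau> - {\<sigma>}) \<union> {W \<tau> Proj}. M'' x = M' x"
      and c: "M'' (?v k) \<in> carrier_tensor (ty y)"
    show "rn (own_rhs \<tau> \<sigma> p (?v i) (W \<sigma> (ScalR j)) (?v k)) M'' (?v i) =
        own_fun \<sigma> f (factors M) (scalar_of (M'' (W \<sigma> (ScalR j)))) (M'' (?v k))"
      using G c y M' I by (intro run_own_rhs[OF rep p C]) (auto simp: factors_def invar_def)
  qed (use X M' I y in \<open>auto simp: base_regs_def eval_regs_disjoint invar_def inj_def\<close>)
  have tb: "typed base_regs M" using I by (simp add: invar_def)
  have P: "rn (own_prog S \<tau> \<sigma> p) M (Factor \<sigma>) = own_update (solve S t0 t1) \<sigma> f (factors M)"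
  proof (cases \<sigma>)
    case (Leaf l)
    have c: "M (Factor \<sigma>) \<in> carrier_tensor [n l, r \<sigma>]"
      using typedD[OF tb, of "Factor \<sigma>"] \<sigma> by (simp add: base_regs_def Leaf)
    have "checks base_regs [Transpose (W \<sigma> LeafV) (Factor \<sigma>)]"
      using \<sigma> by (simp add: Leaf base_regs_def)
    from run_typed[OF this tb]
    have "typed (insert (W \<sigma> LeafV) base_regs) (M(W \<sigma> LeafV := of_mat ((Mat 0 (M (Factor \<sigma>)))\<^sup>T)))" by simp
    from sv[OF _ this] show ?thesis by (simp add: Leaf factors_def)
  next
    case (Node ts)
    have "typed (insert (Factor \<sigma>) base_regs) M"
      using tb \<sigma> by (simp add: base_regs_def insert_absorb)
    from sv[OF _ this] show ?thesis
      by (simp add: Node factors_def run_copy del: own_fun.simps)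
  qed
  show "factors (rn (own_prog S \<tau> \<sigma> p) M) = (factors M)(\<sigma> := own_update (solve S t0 t1) \<sigma> f (factors M))"
  proof
    fix \<rho>
    show "factors (rn (own_prog S \<tau> \<sigma> p) M) \<rho> = ((factors M)(\<sigma> := own_update (solve S t0 t1) \<sigma> f (factors M))) \<rho>"
    proof (cases "\<rho> = \<sigma>")
      case False
      then have "rn (own_prog S \<tau> \<sigma> p) M (Factor \<rho>) = M (Factor \<rho>)"
        using progwrites_own_prog[OF p] by (intro run_frame) (auto simp: eval_regs_disjoint)
      then show ?thesis using False by (simp add: factors_def)
    qed (use P in \<open>simp add: factors_def\<close>)
  qed
  show "invar t0 t1 (rn (own_prog S \<tau> \<sigma> p) M)"
  proof (rule invar_run[OF I checks_own_prog[OF p order_refl]])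
    show "{Time0, Time1, W \<tau> Proj} \<inter> progwrites \<tau> (own_prog S \<tau> \<sigma> p) = {}"
      by (auto dest!: subsetD[OF progwrites_own_prog[OF p]] simp: eval_regs_disjoint)
  qed
qed

lemma own_update_Node: "(factors M)(Node ts := own_update sol (Node ts) f (factors M)) = Psi sol ts f (factors M)"
  by (simp add: Psi_def Let_def)

end

section \<open>The subflow \<open>Phi\<close> and the recursion\<close>

lemma progwrites_orth_prog: "progwrites \<tau> (orth_prog r ts i d) =
    {W (Node ts) (Unf i), W (Node ts) (UnfT i), W (Node ts) (QF i), W (Node ts) (RF i), W (Node ts) (QTF i), d}"
  by (auto simp: orth_prog_def Let_def)

lemma progwrites_S_rhs:
  "is_path \<tau> p \<sigma> \<Longrightarrow> progwrites \<tau> (S_rhs \<tau> \<sigma> p d a v) \<subseteq>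
    insert d (eval_regs \<tau> \<union> {Factor \<sigma>, W \<sigma> TrS, W \<sigma> GramS, W \<sigma> RhsS, W \<sigma> NegS})"
  using progwrites_eval_prog[of \<tau> p \<sigma> a] by (auto simp: S_rhs_def)

context evaluation
begin

lemma run_orth_prog:
  assumes M: "M (Factor (Node ts)) \<in> carrier_tensor (r (Node ts) # map r ts)"
    and qr: "qr ((Mat i (M (Factor (Node ts))))\<^sup>T) = (Q, T)" and d: "\<And>j. d \<noteq> W (Node ts) (RF j)"
  shows "rn (orth_prog r ts i d) M d = Ten i (r (Node ts) # map r ts) (Q\<^sup>T)"
    and "rn (orth_prog r ts i d) M (W (Node ts) (RF i)) = of_mat T"
  using qr d[THEN not_sym] by (simp_all add: orth_prog_def Let_def)

lemma orth_root_run: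
  assumes M: "M (Factor \<sigma>) = C \<sigma>" "C \<sigma> \<in> carrier_tensor (factor_dims n r \<sigma>)"
  obtains T where "orth_root qr \<sigma> C = (C(\<sigma> := rn (root_orth_prog r \<sigma>) M (W \<sigma> Saved)), T)"
    "rn (root_orth_prog r \<sigma>) M (W \<sigma> (RF 0)) = of_mat T"
proof (cases \<sigma>)
  case (Leaf l)
  obtain Q T where "qr (Mat 0 (C \<sigma>)) = (Q, T)" by force
  then show ?thesis using M that by (simp add: Leaf)
next
  case (Node ts)
  obtain Q T where QT: "qr ((Mat 0 (C \<sigma>))\<^sup>T) = (Q, T)" by force
  have "dims (C (Node ts)) = r (Node ts) # map r ts" using carrier_tensorD[OF M(2)] by (simp add: Node)
  then show ?thesis
    using that run_orth_prog[of M ts 0 Q T "W \<sigma> Saved"] M QT by (simp add: Node)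
qed

lemma progwrites_phi_post:
  assumes p: "is_path \<tau> ((ts, i) # p) \<sigma>"
  shows "progwrites \<tau> (phi_post r S \<tau> ts p i) \<subseteq> eval_regs \<tau> \<union> {Factor \<sigma>, Factor (Node ts)} \<union>
    {W \<sigma> x | x. x \<notin> {Proj}}"
proof -
  have \<sigma>: "\<sigma> = ts ! (i - 1)" using p by simp
  let ?D = "eval_regs \<tau> \<union> {Factor \<sigma>, Factor (Node ts)} \<union> {W \<sigma> x | x. x \<notin> {Proj}}"
  have 1: "progwrites \<tau> (root_orth_prog r \<sigma>) \<subseteq> ?D"
    by (cases \<sigma>) (auto simp: progwrites_orth_prog)
  have "progwrites \<tau> (solve_prog S (S_rhs \<tau> \<sigma> ((ts, i) # p)) \<sigma> (\<lambda>i. W \<sigma> (VecS i)) (W \<sigma> (RF 0))) \<subseteq>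
    insert (W \<sigma> ZeroS) ((\<lambda>i. W \<sigma> (VecS i)) ` {..<nregs S} \<union> (\<lambda>i. W \<sigma> (ScalR i)) ` {..<nregs S} \<union>
      (eval_regs \<tau> \<union> {Factor \<sigma>, W \<sigma> TrS, W \<sigma> GramS, W \<sigma> RhsS, W \<sigma> NegS}))"
    using progwrites_S_rhs[OF p] by (rule progwrites_solve_prog)
  also have "\<dots> \<subseteq> ?D" by auto
  finally have 2: "progwrites \<tau> (solve_prog S (S_rhs \<tau> \<sigma> ((ts, i) # p)) \<sigma> (\<lambda>i. W \<sigma> (VecS i)) (W \<sigma> (RF 0))) \<subseteq> ?D" .
  show ?thesis
    unfolding phi_post_def Let_def \<sigma>[symmetric] progwrites_simps(3)
    by (intro Un_least 1 2) (auto simp: progwrites_copy)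
qed

text \<open>The memory is compared with the intermediate values of \<open>Phi\<close> stage by
  stage. They differ in one factor throughout, since \<open>Factor N\<close> already holds the
  orthonormalized tensor \<open>T\<close>; therefore the stages are stated with
  \<open>(N := T)\<close>. The difference disappears with the last multiplication. The old tensor
  can be discarded because the new one is a mode product of \<open>T\<close>.\<close>

lemma run_phi_prog:
  assumes I: "invar t0 t1 M" and p: "is_path \<tau> p (Node ts)" and i: "i \<in> set (modes ts)"
    and rep: "represents n r \<tau> ev p (Node ts) f (factors M)"
    and sub: "\<And>g M. invar t0 t1 M \<Longrightarrow> represents n r \<tau> ev ((ts, i) # p) (ts ! (i - 1)) g (factors M) \<Longrightarrow>
      factors (rn (sub ((ts, i) # p)) M) = ttn_step qr (solve S t0 t1) (ts ! (i - 1)) g (factors M) \<and>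
      invar t0 t1 (rn (sub ((ts, i) # p)) M)"
  shows "factors (rn (phi_prog r S \<tau> ts p i sub) M) =
      Phi qr (solve S t0 t1) ts i (ttn_step qr (solve S t0 t1) (ts ! (i - 1))) f (factors M)"
    and "invar t0 t1 (rn (phi_prog r S \<tau> ts p i sub) M)"
proof -
  define N where "N = Node ts"
  define \<sigma> where "\<sigma> = ts ! (i - 1)"
  define q where "q = (ts, i) # p"
  define C where "C = factors M"
  define sol where "sol = solve S t0 t1"
  define ds where "ds = r N # map r ts"
  have N: "N \<in> subtrees \<tau>" using is_path_subtree[OF p] by (simp add: N_def)
  have \<sigma>ts: "\<sigma> \<in> set ts" using mode_nth_mem[OF i] by (simp add: \<sigma>_def)
  have \<sigma>: "\<sigma> \<in> subtrees \<tau>" using child_in[OF N[unfolded N_def] \<sigma>ts] .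
  have q: "is_path \<tau> q \<sigma>" using p i by (simp add: q_def \<sigma>_def)
  have N\<sigma>: "N \<notin> subtrees \<sigma>" "N \<noteq> \<sigma>" using Node_notin_child[OF \<sigma>ts] by (auto simp: N_def)
  have i': "i \<le> length ts" "1 \<le> i" using i by (auto simp: set_modes)
  have dsi: "ds ! i = r \<sigma>" "i < length ds" using i' by (auto simp: ds_def nth_Cons' \<sigma>_def)
  have \<sigma>\<tau>: "\<sigma> \<noteq> \<tau>" using child_neq_root[OF \<sigma>ts N[unfolded N_def]] .
  have C: "ttn_factors n r \<tau> C" unfolding C_def using I by (rule invar_factors)
  have CN: "C N \<in> carrier_tensor ds"
    using ttn_factorsD[OF ttn_factors_subtree[OF C N]] by (simp add: N_def ds_def)
  obtain Q ST where QR: "qr ((Mat i (C N))\<^sup>T) = (Q, ST)" by force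
  have mT: "(Mat i (C N))\<^sup>T \<in> carrier_mat (prod_list (drop_nth i ds)) (r \<sigma>)"
    using dim_Mat[OF CN, of i] dsi by simp
  have le: "r \<sigma> \<le> prod_list (drop_nth i ds)"
    using r_node[of ts i] N i' dsi by (simp add: N_def ds_def)
  note qrd = qr_dims[OF mT le QR]
  define T where "T = Ten i ds (Q\<^sup>T)"
  have T: "T \<in> carrier_tensor ds" by (simp add: T_def)
  define V where "V = prol_mat C ts i Q"
  define g where "g = (\<lambda>t Y. restr V i (dims (ttn C \<sigma>)) (f t (prol V i (dims (ttn C N)) Y)))"
  have tb: "typed base_regs M" using I by (simp add: invar_def)

  define M2 where "M2 = rn (phi_pre r ts i) M"
  have w2: "progwrites \<tau> (phi_pre r ts i) = {W N (Unf i), W N (UnfT i), W N (QF i), W N (RF i), W N (QTF i),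
      Factor N, Factor \<sigma>}"
    by (auto simp: phi_pre_def Let_def progwrites_orth_prog N_def \<sigma>_def)
  have I2: "invar t0 t1 M2"
    unfolding M2_def using w2 by (intro invar_run[OF I] checks_phi_pre[OF p i]) auto
  define C1 where "C1 = mult_root \<sigma> ST C"
  have C1: "C1 = C(\<sigma> := mode_prod (root_mode \<sigma>) (C \<sigma>) ST)" by (cases \<sigma>) (auto simp: C1_def)
  have F2: "factors M2 = C1(N := T)"
  proof -
    define M1 where "M1 = rn (orth_prog r ts i (Factor N)) M"
    have "M1 (Factor N) = T" "M1 (W N (RF i)) = of_mat ST"
      using run_orth_prog[of M ts i Q ST "Factor N"] CN QR
      by (simp_all add: M1_def N_def T_def ds_def C_def factors_def)
    moreover have "M1 (Factor \<rho>) = C \<rho>" if "\<rho> \<noteq> N" for \<rho>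
      unfolding M1_def C_def factors_def by (rule run_frame) (use that in \<open>auto simp: progwrites_orth_prog\<close>)
    moreover have "M2 = M1(Factor \<sigma> := mode_prod (root_mode \<sigma>) (M1 (Factor \<sigma>)) (Mat 0 (M1 (W N (RF i)))))"
      by (simp add: M2_def phi_pre_def Let_def M1_def N_def \<sigma>_def)
    ultimately show ?thesis using N\<sigma> by (auto simp: factors_def C1)
  qed

  have rep2: "represents n r \<tau> ev q \<sigma> g (factors M2)"
  proof -
    have "represents n r \<tau> ev q \<sigma> g (C(N := T))"
      unfolding q_def \<sigma>_def g_def N_def
      by (rule represents_child[where f = f and Q = Q, OF tree root ev p i C])
         (use rep carrier_tensorD[OF CN] in \<open>simp_all add: C_def V_def T_def N_def\<close>)
    then show ?thesis
      by (subst represents_cong[where B = "C(N := T)"]) (auto simp: F2 C1)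
  qed
  define M3 where "M3 = rn (sub q) M2"
  define C3 where "C3 = ttn_step qr sol \<sigma> g C1"
  \<comment> \<open>The subprogram starts from \<open>C1(N := T)\<close>, the definition from
    \<open>C1\<close>. Locality moves the update past the step.\<close>
  have I3: "invar t0 t1 M3" and F3: "factors M3 = C3(N := T)"
    using sub[OF I2 rep2[unfolded q_def \<sigma>_def]] F2 ttn_step_update[OF N\<sigma>(1), of qr sol g C1 T]
    by (simp_all add: M3_def q_def \<sigma>_def C3_def sol_def)
  have ty3: "ttn_factors n r \<tau> (C3(N := T))" using invar_factors[OF I3] by (simp add: F3)
  have c3: "C3 \<sigma> \<in> carrier_tensor (factor_dims n r \<sigma>)"
    using ttn_factorsD[OF ttn_factors_subtree[OF ty3 \<sigma>]] N\<sigma> by simp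

  define M4 where "M4 = rn (root_orth_prog r \<sigma>) M3"
  have M3\<sigma>: "M3 (Factor \<sigma>) = C3 \<sigma>" using fun_cong[OF F3, of \<sigma>] N\<sigma> by (simp add: factors_def)
  obtain S1 where O: "orth_root qr \<sigma> C3 = (C3(\<sigma> := M4 (W \<sigma> Saved)), S1)" "M4 (W \<sigma> (RF 0)) = of_mat S1"
    using orth_root_run[where M = M3 and C = C3 and \<sigma> = \<sigma>, OF M3\<sigma> c3] unfolding M4_def by blast
  define C4 where "C4 = C3(\<sigma> := M4 (W \<sigma> Saved))"
  have w4: "progwrites \<tau> (root_orth_prog r \<sigma>) \<subseteq> {W \<sigma> x | x. x \<noteq> Proj}"
    by (cases \<sigma>) (auto simp: progwrites_orth_prog)
  have fr4: "M4 x = M3 x" if "\<forall>y. x = W \<sigma> y \<longrightarrow> y = Proj" for x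
    unfolding M4_def using w4 that by (intro run_frame) blast
  have F4: "M4 (Factor \<rho>) = (C3(N := T)) \<rho>" for \<rho>
    using fr4[of "Factor \<rho>"] fun_cong[OF F3, of \<rho>] by (simp add: factors_def)
  define X4 where "X4 = base_regs \<union> {W \<sigma> Saved, W \<sigma> (RF 0)}"
  have "typed (base_regs \<union> progwrites \<tau> (root_orth_prog r \<sigma>)) M4"
    unfolding M4_def using I3 \<sigma>
    by (intro run_typed checks_root_orth_prog(1)) (auto simp: invar_def base_regs_def)
  then have ty4: "typed X4 M4"
    by (rule typed_mono) (use checks_root_orth_prog(2)[OF \<sigma>, of base_regs] \<sigma> in \<open>auto simp: X4_def base_regs_def\<close>)
  have t4: "M4 Time0 = scalar t0" "M4 Time1 = scalar t1" "M4 (W \<tau> Proj) = of_mat (1\<^sub>m 1)"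
    using I3 \<sigma>\<tau> by (auto simp: fr4 invar_def)

  define h where "h = (\<lambda>t Y. of_mat (- ((basis C4 \<sigma>)\<^sup>T *
    (Mat 0 (g t (mode_prod 0 (ttn C4 \<sigma>) ((Mat 0 Y)\<^sup>T))))\<^sup>T)))"
  let ?P5 = "solve_prog S (S_rhs \<tau> \<sigma> q) \<sigma> (\<lambda>i. W \<sigma> (VecS i)) (W \<sigma> (RF 0))"
  let ?E = "eval_regs \<tau> \<union> {Factor \<sigma>, W \<sigma> TrS, W \<sigma> GramS, W \<sigma> RhsS, W \<sigma> NegS}"
  have tyC4: "ttn_factors n r \<tau> (C4(N := T))"
  proof -
    have "ttn_factors n r \<tau> ((C3(N := T))(\<sigma> := M4 (W \<sigma> Saved)))"
      using typedD[OF ty4, of "W \<sigma> Saved"] by (intro ttn_factors_update[OF ty3]) (simp add: X4_def)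
    also have "(C3(N := T))(\<sigma> := M4 (W \<sigma> Saved)) = C4(N := T)"
      using N\<sigma> by (simp add: C4_def fun_upd_twist)
    finally show ?thesis .
  qed
  \<comment> \<open>The backward equation uses the same function \<open>g\<close>. Since
    \<open>M2\<close>, only factors inside \<open>\<sigma>\<close> have changed, so the
    representation is still valid.\<close>
  have rep4: "represents n r \<tau> ev q \<sigma> g (C4(N := T))"
  proof (subst represents_cong[where B = "factors M2"])
    fix \<rho> assume "\<rho> \<in> subtrees \<tau> - subtrees \<sigma>"
    then have "\<rho> \<notin> subtrees \<sigma>" "\<rho> \<noteq> \<sigma>" by auto
    then show "(C4(N := T)) \<rho> = factors M2 \<rho>"
      by (simp add: F2 C4_def C3_def ttn_step_outside)
  qed (rule rep2)
  have ck: "checks Y (S_rhs \<tau> \<sigma> q (W \<sigma> (VecS i)) (W \<sigma> (ScalR j)) (W \<sigma> (VecS k)))"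
    if "X4 \<subseteq> Y" "W \<sigma> (ScalR j) \<in> Y" "W \<sigma> (VecS k) \<in> Y" "i < nregs S" for Y i j k
    using that \<sigma> by (intro checks_S_rhs[OF q]) (auto simp: X4_def)
  have vv: "W \<sigma> (VecS i) \<in> Regs \<and> ty (W \<sigma> (VecS i)) = ty (W \<sigma> (RF 0))" if "i < nregs S" for i
    using that \<sigma> by (cases \<sigma>) auto
  have X4: "{W \<sigma> (RF 0), Time0, Time1} \<subseteq> X4" by (auto simp: X4_def base_regs_def)
  have V0: "rn ?P5 M4 (W \<sigma> (VecS 0)) = sol h (of_mat S1)"
    unfolding O(2)[symmetric] sol_def
  \<comment> \<open>\<open>Saved\<close> is among the protected registers, because the basis at
    \<open>\<sigma>\<close> is fixed in this equation.\<close>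
  proof (rule run_solve_prog[where G = "Factor ` (subtrees \<tau> - {\<sigma>}) \<union> {W \<tau> Proj, W \<sigma> Saved}" and E = ?E and
        v = "\<lambda>i. W \<sigma> (VecS i)" and rhs = "S_rhs \<tau> \<sigma> q" and y = "W \<sigma> (RF 0)" and X = X4 and M = M4 and f = h,
        OF \<sigma> vv X4 ty4 ck progwrites_S_rhs[OF q]])
    fix M' i j k
    assume G: "\<forall>x\<in>Factor ` (subtrees \<tau> - {\<sigma>}) \<union> {W \<tau> Proj, W \<sigma> Saved}. M' x = M4 x"
      and c: "M' (W \<sigma> (VecS k)) \<in> carrier_tensor (ty (W \<sigma> (RF 0)))"
    have "ty (W \<sigma> (RF 0)) = [r \<sigma>, r \<sigma>]" by (cases \<sigma>) auto
    then have "rn (S_rhs \<tau> \<sigma> q (W \<sigma> (VecS i)) (W \<sigma> (ScalR j)) (W \<sigma> (VecS k))) M' (W \<sigma> (VecS i)) =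
      of_mat (- ((basis (C4(N := T)) \<sigma>)\<^sup>T * (Mat 0 (g (scalar_of (M' (W \<sigma> (ScalR j))))
        (mode_prod 0 (ttn (C4(N := T)) \<sigma>) ((Mat 0 (M' (W \<sigma> (VecS k))))\<^sup>T))))\<^sup>T))"
      using G c N\<sigma> t4 by (intro run_S_rhs[OF rep4 q tyC4]) (auto simp: C4_def F4)
    then show "rn (S_rhs \<tau> \<sigma> q (W \<sigma> (VecS i)) (W \<sigma> (ScalR j)) (W \<sigma> (VecS k))) M' (W \<sigma> (VecS i)) =
        h (scalar_of (M' (W \<sigma> (ScalR j)))) (M' (W \<sigma> (VecS k)))"
      by (simp add: h_def basis_update[OF N\<sigma>(1)] ttn_update[OF N\<sigma>(1)])
  qed (use \<sigma>\<tau> t4 in \<open>auto simp: eval_regs_disjoint inj_def\<close>)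
  define M5 where "M5 = rn ?P5 M4"
  have w5: "progwrites \<tau> ?P5 \<subseteq> insert (W \<sigma> ZeroS) ((\<lambda>i. W \<sigma> (VecS i)) ` {..<nregs S} \<union>
      (\<lambda>i. W \<sigma> (ScalR i)) ` {..<nregs S} \<union> ?E)"
    using progwrites_S_rhs[OF q] by (rule progwrites_solve_prog)
  have F5: "M5 (Factor \<rho>) = (C3(N := T)) \<rho>" if "\<rho> \<noteq> \<sigma>" for \<rho>
    using that w5 F4 unfolding M5_def by (subst run_frame) (auto simp: eval_regs_disjoint)
  have S5: "M5 (W \<sigma> Saved) = M4 (W \<sigma> Saved)"
    unfolding M5_def by (rule run_frame) (use w5 in \<open>auto simp: eval_regs_disjoint\<close>)
  have "checks X4 ?P5"
    using checks_solve_prog[where v = "\<lambda>i. W \<sigma> (VecS i)" and rhs = "S_rhs \<tau> \<sigma> q" and y = "W \<sigma> (RF 0)"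
        and X = X4, OF \<sigma> vv X4 ck] .
  then have "typed (X4 \<union> progwrites \<tau> ?P5) M5" unfolding M5_def using ty4 by (rule run_typed)
  moreover have "W \<sigma> (VecS 0) \<in> progwrites \<tau> ?P5"
    using init_prog_written(1)[OF nregs_pos(1), where v = "\<lambda>i. W \<sigma> (VecS i)" and \<sigma> = \<sigma>]
    by (simp add: solve_prog_def)
  ultimately have "M5 (W \<sigma> (VecS 0)) \<in> carrier_tensor [r \<sigma>, r \<sigma>]"
    using typedD[where a = "W \<sigma> (VecS 0)" and M = M5] by fastforce
  then have S2: "Mat 0 (sol h (of_mat S1)) \<in> carrier_mat (r \<sigma>) (r \<sigma>)"
    using V0 by (auto simp: M5_def intro: dim_Mat_0_2)

  define M7 where "M7 = rn (phi_post r S \<tau> ts p i) M3"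
  have M7: "M7 = M5(W \<sigma> ZeroS := scalar 0, Factor \<sigma> := M4 (W \<sigma> Saved),
      Factor N := mode_prod i T (Mat 0 (sol h (of_mat S1))))"
    using F5[OF N\<sigma>(2)] V0 N\<sigma> S5
    by (simp add: M7_def phi_post_def Let_def N_def[symmetric] \<sigma>_def[symmetric, simplified] q_def[symmetric]
        M4_def[symmetric] M5_def[symmetric] run_copy)
  \<comment> \<open>As \<open>Mat i T\<close> is the transpose of \<open>Q\<close>, a product in
    mode \<open>i\<close> yields the new connection tensor without another reshaping.\<close>
  have "mode_prod i T (Mat 0 (sol h (of_mat S1))) = Ten i (ds[i := r \<sigma>]) (Mat 0 (sol h (of_mat S1)) * Mat i T)"
    using mode_prod_Mat_eq[OF T, of _ "r \<sigma>" i] S2 by (simp add: dsi)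
  also have "ds[i := r \<sigma>] = ds" using dsi by (metis list_update_id)
  also have "Mat i T = Q\<^sup>T"
    unfolding T_def using qrd(1) dsi by (intro Mat_Ten) auto
  finally have T7: "mode_prod i T (Mat 0 (sol h (of_mat S1))) = Ten i ds (Mat 0 (sol h (of_mat S1)) * Q\<^sup>T)" .
  have F7: "factors M7 = C4(N := Ten i (dims (C N)) (Mat 0 (sol h (of_mat S1)) * Q\<^sup>T))"
    unfolding T7[symmetric] carrier_tensorD[OF CN] using N\<sigma> F5 by (auto simp: factors_def M7 C4_def)
  also have "\<dots> = Phi qr sol ts i (ttn_step qr sol \<sigma>) f C"
    unfolding Phi_def Let_def N_def[symmetric] \<sigma>_def[symmetric] QR prod.case V_def[symmetric]
      g_def[symmetric] C1_def[symmetric] C3_def[symmetric] O(1) C4_def[symmetric]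
    unfolding h_def g_def ..
  finally show "factors (rn (phi_prog r S \<tau> ts p i sub) M) =
      Phi qr (solve S t0 t1) ts i (ttn_step qr (solve S t0 t1) (ts ! (i - 1))) f (factors M)"
    by (simp add: phi_prog_def M7_def M3_def M2_def q_def sol_def \<sigma>_def C_def)
  have "invar t0 t1 M7"
    unfolding M7_def
  proof (rule invar_run[OF I3 checks_phi_post[OF p i order_refl]])
    show "{Time0, Time1, W \<tau> Proj} \<inter> progwrites \<tau> (phi_post r S \<tau> ts p i) = {}"
      using \<sigma>\<tau> by (auto dest!: subsetD[OF progwrites_phi_post[OF q[unfolded q_def]]] simp: eval_regs_disjoint)
  qed
  then show "invar t0 t1 (rn (phi_prog r S \<tau> ts p i sub) M)"
    by (simp add: phi_prog_def M7_def M3_def M2_def q_def)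
qed

text \<open>Each subflow at a node changes only factors inside that node, which
  \<open>represents\<close> leaves free. So the representation of \<open>f\<close> persists, and all
  subflows of a node work with the same path.\<close>

lemma run_step_prog:
  "invar t0 t1 M \<Longrightarrow> is_path \<tau> p \<sigma> \<Longrightarrow> represents n r \<tau> ev p \<sigma> f (factors M) \<Longrightarrow>
    factors (rn (step_prog r S \<tau> \<sigma> p) M) = ttn_step qr (solve S t0 t1) \<sigma> f (factors M) \<and>
    invar t0 t1 (rn (step_prog r S \<tau> \<sigma> p) M)"
proof (induction \<sigma> arbitrary: p f M)
  case (Leaf l)
  then show ?case using run_own_prog[of t0 t1 M p "Leaf l" f] by (simp del: own_prog.simps)
next
  case (Node ts)
  let ?sol = "solve S t0 t1"
  let ?\<Phi> = "\<lambda>i. Phi qr ?sol ts i (map (ttn_step qr ?sol) ts ! (i - 1)) f"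
  let ?P = "\<lambda>i. phi_prog r S \<tau> ts p i (map (step_prog r S \<tau>) ts ! (i - 1))"
  have 1: "factors (rn (concat (map ?P is)) M) = fold ?\<Phi> is (factors M) \<and>
      invar t0 t1 (rn (concat (map ?P is)) M) \<and>
      represents n r \<tau> ev p (Node ts) f (factors (rn (concat (map ?P is)) M))"
    if "set is \<subseteq> set (modes ts)" "invar t0 t1 M" "represents n r \<tau> ev p (Node ts) f (factors M)" for "is" M
    using that
  proof (induction "is" arbitrary: M)
    case (Cons i "is")
    have i: "i \<in> set (modes ts)" using Cons.prems by simp
    then have il: "i - 1 < length ts" by (auto simp: set_modes)
    have "is_path \<tau> ((ts, i) # p) (ts ! (i - 1))" using Node.prems(2) i by simp
    note IH = Node.IH[OF mode_nth_mem[OF i] _ this]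
    have sub: "factors (rn ((map (step_prog r S \<tau>) ts ! (i - 1)) ((ts, i) # p)) M) =
        ttn_step qr ?sol (ts ! (i - 1)) g (factors M) \<and>
        invar t0 t1 (rn ((map (step_prog r S \<tau>) ts ! (i - 1)) ((ts, i) # p)) M)"
      if "invar t0 t1 M" "represents n r \<tau> ev ((ts, i) # p) (ts ! (i - 1)) g (factors M)" for g M
      unfolding nth_map[OF il] by (rule IH[OF that])
    have f: "factors (rn (?P i) M) = ?\<Phi> i (factors M)"
      unfolding nth_map[OF il, of "ttn_step qr ?sol"]
      by (rule run_phi_prog(1)[where sub = "map (step_prog r S \<tau>) ts ! (i - 1)", OF Cons.prems(2) Node.prems(2) i Cons.prems(3) sub])
    have I: "invar t0 t1 (rn (?P i) M)"
      by (rule run_phi_prog(2)[where sub = "map (step_prog r S \<tau>) ts ! (i - 1)", OF Cons.prems(2) Node.prems(2) i Cons.prems(3) sub])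
    have s: "set is \<subseteq> set (modes ts)" using Cons.prems(1) by simp
    have "represents n r \<tau> ev p (Node ts) f (factors (rn (?P i) M))"
      unfolding f using Cons.prems(3)
      by (subst represents_cong[where B = "factors M"]) (use Phi_outside[OF _ i] il in auto)
    note IH2 = Cons.IH[OF s I this]
    have e1: "rn (concat (map ?P (i # is))) M = rn (concat (map ?P is)) (rn (?P i) M)" by simp
    have e2: "fold ?\<Phi> (i # is) (factors M) = fold ?\<Phi> is (factors (rn (?P i) M))"
      unfolding f by simp
    show ?case unfolding e1 e2 by (rule IH2)
  qed simp
  let ?M = "rn (concat (map ?P (modes ts))) M"
  from 1[OF order_refl Node.prems(1,3)]
  have 2: "factors ?M = fold ?\<Phi> (modes ts) (factors M)" "invar t0 t1 ?M"
    "represents n r \<tau> ev p (Node ts) f (factors ?M)" by auto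
  from run_own_prog[OF 2(2) Node.prems(2) 2(3)] own_update_Node[of ?M ts ?sol f] 2(1)
  show ?case by (simp del: own_prog.simps own_update.simps One_nat_def)
qed

end

section \<open>Counting\<close>

text \<open>Counts occurrences along the recursion followed by the programs; the set of subtrees is
  no larger.\<close>

primrec nodes :: "'l tree \<Rightarrow> nat" where
  "nodes (Leaf l) = 1"
| "nodes (Node ts) = Suc (sum_list (map nodes ts))"

lemma nodes_pos: "1 \<le> nodes \<sigma>"
  by (cases \<sigma>) auto

lemma finite_subtrees: "finite (subtrees \<sigma>)"
  by (induction \<sigma>) auto

lemma finite_leaves: "finite (leaves \<sigma>)"
  by (induction \<sigma>) auto

lemma card_subtrees: "card (subtrees \<sigma>) \<le> nodes \<sigma>"
proof (induction \<sigma>)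
  case (Node ts)
  have "card (\<Union> (set (map subtrees us))) \<le> sum_list (map nodes us)" if "set us \<subseteq> set ts" for us
    using that
  proof (induction us)
    case (Cons u us)
    have "card (subtrees u \<union> \<Union> (set (map subtrees us))) \<le> card (subtrees u) + card (\<Union> (set (map subtrees us)))"
      by (rule card_Un_le)
    also have "\<dots> \<le> nodes u + sum_list (map nodes us)"
      using Cons Node.IH[of u] by (intro add_mono) auto
    finally show ?case by simp
  qed simp
  from this[OF order_refl] show ?case
    using card_insert_le_m1[of "Suc (sum_list (map nodes ts))" "\<Union> (set (map subtrees ts))" "Node ts"]
    by (simp add: card_insert_if finite_subtrees)
qed simp

text \<open>Every inner node has at least two direct subtrees. Their surpluses of 1 pay for the node
  itself and for its own surplus.\<close>

lemma nodes_le_leaves: "is_tree \<tau> \<Longrightarrow> nodes \<tau> + 1 \<le> 2 * card (leaves \<tau>)"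
proof (induction \<tau>)
  case (Node ts)
  have "card (leaves (Node ts)) = card (\<Union>i<length ts. leaves (ts ! i))"
    by (auto simp: set_conv_nth intro!: arg_cong[where f = card])
  also have "\<dots> = (\<Sum>i<length ts. card (leaves (ts ! i)))"
  proof (rule card_UN_disjoint)
    show "\<forall>i\<in>{..<length ts}. \<forall>j\<in>{..<length ts}. i \<noteq> j \<longrightarrow> leaves (ts ! i) \<inter> leaves (ts ! j) = {}"
    proof (intro ballI impI)
      fix i j assume "i \<in> {..<length ts}" "j \<in> {..<length ts}" "i \<noteq> j"
      then show "leaves (ts ! i) \<inter> leaves (ts ! j) = {}"
        using Node.prems by (cases i j rule: linorder_cases) (auto simp: Int_commute)
    qed
  qed (auto simp: finite_leaves)
  finally have "2 * card (leaves (Node ts)) = (\<Sum>i<length ts. 2 * card (leaves (ts ! i)))"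
    by (simp add: sum_distrib_left)
  moreover have "(\<Sum>i<length ts. nodes (ts ! i) + 1) \<le> (\<Sum>i<length ts. 2 * card (leaves (ts ! i)))"
    using Node.IH is_tree_child[OF Node.prems] by (intro sum_mono) auto
  moreover have "(\<Sum>i<length ts. nodes (ts ! i) + 1) = sum_list (map nodes ts) + length ts"
    by (simp add: sum_Suc sum_list_sum_nth atLeast0LessThan)
  ultimately show ?case using Node.prems by simp
qed simp

lemma height_le_nodes: "is_tree \<tau> \<Longrightarrow> height \<tau> \<le> nodes \<tau>"
proof (induction \<tau>)
  case (Node ts)
  have "ts \<noteq> []" using Node.prems by auto
  moreover have "height \<sigma> \<le> sum_list (map nodes ts)" if "\<sigma> \<in> set ts" for \<sigma>
    using Node.IH[OF that is_tree_child[OF Node.prems that]] member_le_sum_list[of "nodes \<sigma>" "map nodes ts"] that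
    by force
  ultimately show ?case by simp
qed simp

lemma height_child: "\<sigma> \<in> set ts \<Longrightarrow> Suc (height \<sigma>) \<le> height (Node ts)"
  by simp

text \<open>Every step towards the root raises the height by at least one.\<close>

lemma length_path: "is_path \<tau> p \<sigma> \<Longrightarrow> length p + height \<sigma> \<le> height \<tau>"
proof (induction p arbitrary: \<sigma>)
  case (Cons x p)
  obtain ts i where x: "x = (ts, i)" by force
  have i: "i \<in> set (modes ts)" "\<sigma> = ts ! (i - 1)" "is_path \<tau> p (Node ts)" using Cons.prems by (auto simp: x)
  have "Suc (height \<sigma>) \<le> height (Node ts)" unfolding i(2) by (rule height_child[OF mode_nth_mem[OF i(1)]])
  then show ?case using Cons.IH[OF i(3)] by simp
qed simp

text \<open>Lengths of programs and numbers of instructions of a certain kind are both obtained from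
  weights \<open>w\<close> of the instructions.\<close>

definition weight :: "('l instr \<Rightarrow> nat) \<Rightarrow> 'l instr list \<Rightarrow> nat" where
  "weight w P = sum_list (map w P)"

lemma weight_simps [simp]:
  "weight w [] = 0" "weight w (I # P) = w I + weight w P" "weight w (P @ Q) = weight w P + weight w Q"
  by (simp_all add: weight_def)

lemma weight_concat: "(\<And>x. x \<in> set xs \<Longrightarrow> weight w (f x) \<le> k) \<Longrightarrow> weight w (concat (map f xs)) \<le> length xs * k"
proof (induction xs)
  case (Cons x xs)
  then have "weight w (f x) \<le> k" "weight w (concat (map f xs)) \<le> length xs * k" by auto
  then show ?case by simp
qed simp

lemma weight_const: "weight (\<lambda>_. Suc 0) P = length P"
  by (induction P) auto

lemma weight_indicator: "weight (\<lambda>I. if Q I then 1 else 0) P = length (filter Q P)"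
  by (induction P) auto

context setting
begin

lemma weight_solve_prog:
  assumes init: "weight w (init_prog S \<sigma> v y) \<le> a" and rhs: "\<And>i j k. weight w (rhs (v i) (W \<sigma> (ScalR j)) (v k)) \<le> e"
    and w: "\<And>d z x y. w (Axpy d z x y) \<le> e" "\<And>d x y. w (Inner d x y) \<le> e" "\<And>d x. w (Const d x) \<le> e"
      "\<And>d opr x y. w (Arith d opr x y) \<le> e"
  shows "weight w (solve_prog S rhs \<sigma> v y) \<le> a + length S * e"
proof -
  have "weight w (op_prog rhs (\<lambda>i. W \<sigma> (ScalR i)) v op) \<le> e" for op
    using rhs w by (cases op) auto
  then have "weight w (concat (map (op_prog rhs (\<lambda>i. W \<sigma> (ScalR i)) v) S)) \<le> length S * e"
    by (intro weight_concat) auto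
  then show ?thesis using init by (simp add: solve_prog_def)
qed

text \<open>\<open>a\<close> is charged to every node, \<open>b\<close> to every node except the
  root, because a subflow \<open>Phi\<close> belongs to a direct subtree. Adding \<open>b\<close> on
  the left makes the induction hypothesis additive over the direct subtrees.\<close>

lemma weight_step_prog:
  assumes own: "\<And>\<sigma> p. is_path \<tau> p \<sigma> \<Longrightarrow> weight w (own_prog S \<tau> \<sigma> p) \<le> a"
    and phi: "\<And>ts p i. is_path \<tau> p (Node ts) \<Longrightarrow> i \<in> set (modes ts) \<Longrightarrow>
      weight w (phi_pre r ts i) + weight w (phi_post r S \<tau> ts p i) \<le> b"
  shows "is_path \<tau> p \<sigma> \<Longrightarrow> weight w (step_prog r S \<tau> \<sigma> p) + b \<le> nodes \<sigma> * (a + b)"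
proof (induction \<sigma> arbitrary: p)
  case (Leaf l)
  then show ?case using own[OF Leaf] by (simp del: own_prog.simps)
next
  case (Node ts)
  let ?P = "\<lambda>i. phi_prog r S \<tau> ts p i (map (step_prog r S \<tau>) ts ! (i - 1))"
  have P: "weight w (?P i) \<le> nodes (ts ! (i - 1)) * (a + b)" if i: "i \<in> set (modes ts)" for i
  proof -
    have il: "i - 1 < length ts" using i by (auto simp: set_modes)
    have "is_path \<tau> ((ts, i) # p) (ts ! (i - 1))" using Node.prems i by simp
    from Node.IH[OF mode_nth_mem[OF i] this] phi[OF Node.prems i] il
    show ?thesis by (simp add: phi_prog_def)
  qed
  have "weight w (concat (map ?P [1..<Suc k])) \<le> sum_list (map nodes (take k ts)) * (a + b)" if "k \<le> length ts" for k
    using that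
  proof (induction k)
    case (Suc k)
    have "Suc k \<in> set (modes ts)" using Suc.prems by (simp add: set_modes)
    from P[OF this] Suc show ?case
      by (simp add: take_Suc_conv_app_nth add_mult_distrib)
  qed simp
  from this[of "length ts"] own[OF Node.prems] show ?case
    by (simp add: upt_modes add_mult_distrib del: own_prog.simps One_nat_def upt_Suc)
qed

section \<open>Lengths of programs\<close>

lemma length_modes: "length (modes ts) = length ts"
  by (simp add: modes_def del: upt_Suc)

lemma length_copy: "length (copy \<sigma> d a) = 2"
  by (simp add: copy_def)

lemma length_part_prog: "Node ts \<in> subtrees \<tau> \<Longrightarrow> length (part_prog ts i) \<le> 2 * m + 2"
proof -
  assume N: "Node ts \<in> subtrees \<tau>"
  have "weight (\<lambda>_. Suc 0) (concat (map (part_op ts i) (modes ts))) \<le> length (modes ts) * 2"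
    by (rule weight_concat) (simp add: part_op_def Let_def weight_const length_copy)
  then show ?thesis
    using arity[OF N] by (simp add: part_prog_def Let_def weight_const length_copy length_modes)
qed

lemma length_gram_prog: "\<sigma> \<in> subtrees \<tau> \<Longrightarrow> length (gram_prog \<sigma>) \<le> nodes \<sigma> * (2 * m + 3)"
proof (induction \<sigma>)
  case (Node ts)
  have "length (concat (map gram_prog us)) \<le> sum_list (map nodes us) * (2 * m + 3)" if "set us \<subseteq> set ts" for us
    using that
  proof (induction us)
    case (Cons u us)
    then have "length (gram_prog u) \<le> nodes u * (2 * m + 3)"
      using Node.IH[of u] child_in[OF Node.prems] by auto
    then show ?case using Cons by (simp add: add_mult_distrib)
  qed simp
  from this[OF order_refl] length_part_prog[OF Node.prems, of 0] show ?case by simp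
qed simp

lemma length_path_prog: "is_path \<tau> p \<sigma> \<Longrightarrow> length (path_prog p) \<le> length p * (2 * m + 4)"
proof (induction p arbitrary: \<sigma>)
  case (Cons x p)
  obtain ts i where x: "x = (ts, i)" by force
  then have p: "is_path \<tau> p (Node ts)" using Cons.prems by auto
  show ?case using Cons.IH[OF p] length_part_prog[OF is_path_subtree[OF p], of i] by (simp add: x)
qed simp

text \<open>Composed of \<open>2 * m + 3\<close> per node for the Gram matrices,
  \<open>2 * m + 4\<close> per step of the path, which has at most \<open>nodes \<tau>\<close>
  steps, and 7 for the instruction \<open>EvalF\<close> and up to six further instructions of a
  right-hand side.\<close>

definition eval_len :: nat where
  "eval_len = nodes \<tau> * (4 * m + 14)"

lemma length_eval_prog:
  assumes "is_path \<tau> p \<sigma>"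
  shows "length (eval_prog \<tau> p a) + 6 \<le> eval_len"
proof -
  have "length p \<le> nodes \<tau>" using length_path[OF assms] height_le_nodes[OF tree] by simp
  then have "length p * (2 * m + 4) \<le> nodes \<tau> * (2 * m + 4)" by simp
  moreover have "nodes \<tau> * (4 * m + 14) = nodes \<tau> * (2 * m + 3) + nodes \<tau> * (2 * m + 4) + nodes \<tau> * 7"
    by (simp add: algebra_simps)
  moreover have "length (eval_prog \<tau> p a) = 1 + length (gram_prog \<tau>) + length (path_prog p)"
    by (simp add: eval_prog_def)
  ultimately show ?thesis
    using length_gram_prog[OF subtrees_refl] length_path_prog[OF assms] nodes_pos[of \<tau>]
    unfolding eval_len_def by linarith
qed

lemma eval_len_pos: "1 \<le> eval_len"
  using nodes_pos[of \<tau>] by (simp add: eval_len_def)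

text \<open>Three instructions initialize a vector register and a scalar register, four more load
  the two times.\<close>

definition solve_len :: nat where
  "solve_len = 3 * nregs S + 4 + length S * eval_len"

lemma length_init_prog: "length (init_prog S \<sigma> v y) \<le> 3 * nregs S + 4"
proof -
  have "weight (\<lambda>_. Suc 0) (concat (map (\<lambda>i. copy \<sigma> (v i) y) [0..<nregs S])) \<le> length [0..<nregs S] * 2"
    by (rule weight_concat) (simp add: weight_const length_copy)
  then show ?thesis by (simp add: init_prog_def weight_const length_copy)
qed

lemma length_own_prog: "is_path \<tau> p \<sigma> \<Longrightarrow> length (own_prog S \<tau> \<sigma> p) \<le> solve_len + 2"
proof -
  assume p: "is_path \<tau> p \<sigma>"
  have "length (own_rhs \<tau> \<sigma> p d a v) \<le> eval_len" for d a v
    using length_eval_prog[OF p, of a] by (cases \<sigma>) (auto simp: length_copy)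
  then have "weight (\<lambda>_. Suc 0) (solve_prog S (own_rhs \<tau> \<sigma> p) \<sigma> (\<lambda>i. W \<sigma> (Vec i)) y) \<le>
      (3 * nregs S + 4) + length S * eval_len" for y
    using length_init_prog[of \<sigma>] eval_len_pos by (intro weight_solve_prog) (simp_all add: weight_const)
  then have "length (solve_prog S (own_rhs \<tau> \<sigma> p) \<sigma> (\<lambda>i. W \<sigma> (Vec i)) y) \<le> solve_len" for y
    by (simp add: weight_const solve_len_def)
  then show ?thesis by (cases \<sigma>) (auto simp: length_copy)
qed

lemma length_phi_prog:
  assumes p: "is_path \<tau> p (Node ts)" and i: "i \<in> set (modes ts)"
  shows "length (phi_pre r ts i) + length (phi_post r S \<tau> ts p i) \<le> solve_len + 14"
proof -
  define \<sigma> where "\<sigma> = ts ! (i - 1)"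
  have q: "is_path \<tau> ((ts, i) # p) \<sigma>" using p i by (simp add: \<sigma>_def)
  have "length (S_rhs \<tau> \<sigma> ((ts, i) # p) d a v) \<le> eval_len" for d a v
    using length_eval_prog[OF q, of a] by (simp add: S_rhs_def)
  then have "weight (\<lambda>_. Suc 0) (solve_prog S (S_rhs \<tau> \<sigma> ((ts, i) # p)) \<sigma> (\<lambda>i. W \<sigma> (VecS i)) y) \<le>
      (3 * nregs S + 4) + length S * eval_len" for y
    using length_init_prog[of \<sigma>] eval_len_pos by (intro weight_solve_prog) (simp_all add: weight_const)
  then have "length (solve_prog S (S_rhs \<tau> \<sigma> ((ts, i) # p)) \<sigma> (\<lambda>i. W \<sigma> (VecS i)) y) \<le> solve_len" for y
    by (simp add: weight_const solve_len_def)
  moreover have "length (root_orth_prog r \<sigma>) \<le> 5" by (cases \<sigma>) (auto simp: orth_prog_def Let_def)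
  moreover have "length (phi_pre r ts i) = 6" by (simp add: phi_pre_def orth_prog_def Let_def)
  moreover have "length (phi_post r S \<tau> ts p i) = length (root_orth_prog r \<sigma>) +
      length (solve_prog S (S_rhs \<tau> \<sigma> ((ts, i) # p)) \<sigma> (\<lambda>i. W \<sigma> (VecS i)) (W \<sigma> (RF 0))) + 3"
    unfolding phi_post_def Let_def \<sigma>_def[symmetric] by (simp add: length_copy)
  \<comment> \<open>\<open>14 = 6 + 5 + 3\<close>: preparation, orthonormalization at the root of
    the child, and the final copy and product.\<close>
  ultimately show ?thesis using add_le_mono by fastforce
qed

lemma length_main_prog: "length (main_prog r S \<tau>) \<le> nodes \<tau> * (2 * solve_len + 16) + 3"
proof -
  have "weight (\<lambda>_. Suc 0) (step_prog r S \<tau> \<tau> []) + (solve_len + 14) \<le> nodes \<tau> * ((solve_len + 2) + (solve_len + 14))"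
    using length_own_prog length_phi_prog by (intro weight_step_prog) (simp_all add: weight_const)
  moreover have "length (main_prog r S \<tau>) = 3 + length (step_prog r S \<tau> \<tau> [])" by (simp add: main_prog_def)
  moreover have "(solve_len + 2) + (solve_len + 14) = 2 * solve_len + 16" by simp
  ultimately show ?thesis unfolding weight_const by (metis add.commute add_leD1 add_left_mono)
qed

section \<open>Numbers of reshapings and evaluations\<close>

fun is_reshape :: "'l instr \<Rightarrow> bool" where
  "is_reshape (Matricize d i a) = True"
| "is_reshape (Tensorize d i ds a) = True"
| "is_reshape _ = False"

lemma reshaped_iff: "reshaped I M \<noteq> None \<longleftrightarrow> is_reshape I"
  by (cases I) auto

abbreviation "wr \<equiv> weight (\<lambda>I. if is_reshape I then 1 else 0)"
abbreviation "we \<equiv> weight (\<lambda>I. if is_eval I then 1 else 0)"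

lemma weight_part_gram_path:
  assumes "\<And>d x. w (Const d x) = (0::nat)" "\<And>d z x y. w (Axpy d z x y) = 0" "\<And>d i x y. w (ModeProd d i x y) = 0"
    "\<And>d i x y. w (Contract d i x y) = 0"
  shows "weight w (copy \<sigma> d a) = 0" "weight w (part_prog ts i) = 0" "weight w (gram_prog \<sigma>) = 0"
    "weight w (path_prog p) = 0"
proof -
  show c: "weight w (copy \<sigma> d a) = 0" for \<sigma> d a using assms by (simp add: copy_def)
  have "weight w (concat (map (part_op ts i) (modes ts))) \<le> length (modes ts) * 0" for ts i
    by (rule weight_concat) (simp add: part_op_def Let_def c assms)
  then show p: "weight w (part_prog ts i) = 0" for ts i by (simp add: part_prog_def Let_def c)
  show "weight w (gram_prog \<sigma>) = 0"
  proof (induction \<sigma>)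
    case (Node ts)
    have "weight w (concat (map gram_prog ts)) \<le> length ts * 0" using Node by (intro weight_concat) simp
    then show ?case by (simp add: p assms)
  qed (simp add: assms)
  show "weight w (path_prog p) = 0"
    by (induction p rule: path_prog.induct) (simp_all add: p assms)
qed

lemma weight_init_prog:
  assumes "\<And>d x. w (Const d x) = (0::nat)" "\<And>d z x y. w (Axpy d z x y) = 0"
  shows "weight w (init_prog S \<sigma> v y) = 0"
proof -
  have c: "weight w (copy \<sigma> d a) = 0" for \<sigma> d a using assms by (simp add: copy_def)
  have "weight w (concat (map (\<lambda>i. copy \<sigma> (v i) y) [0..<nregs S])) \<le> length [0..<nregs S] * 0"
    by (rule weight_concat) (simp add: c)
  moreover have "weight w (map (\<lambda>i. Const (W \<sigma> (ScalR i)) 0) is) = 0" for "is"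
    by (induction "is") (simp_all add: assms)
  ultimately show ?thesis by (simp add: init_prog_def c)
qed

lemma weight_rhs:
  assumes "\<And>d x. w (Const d x) = (0::nat)" "\<And>d z x y. w (Axpy d z x y) = 0" "\<And>d i x y. w (ModeProd d i x y) = 0"
    "\<And>d i x y. w (Contract d i x y) = 0" "\<And>d x. w (Transpose d x) = 0" "\<And>t arg res. w (EvalF t arg res) \<le> e"
  shows "weight w (own_rhs \<tau> \<sigma> p d a v) \<le> e" "weight w (S_rhs \<tau> \<sigma> p d a v) \<le> e"
proof -
  have "weight w (eval_prog \<tau> p a) \<le> e" for a
    using assms by (simp add: eval_prog_def weight_part_gram_path)
  then show "weight w (own_rhs \<tau> \<sigma> p d a v) \<le> e" "weight w (S_rhs \<tau> \<sigma> p d a v) \<le> e"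
    using assms by (cases \<sigma>, simp_all add: S_rhs_def weight_part_gram_path)
qed

lemma weight_own_prog:
  assumes "\<And>d x. w (Const d x) = (0::nat)" "\<And>d z x y. w (Axpy d z x y) = 0" "\<And>d i x y. w (ModeProd d i x y) = 0"
    "\<And>d i x y. w (Contract d i x y) = 0" "\<And>d x. w (Transpose d x) = 0" "\<And>t arg res. w (EvalF t arg res) \<le> e"
    "\<And>d x y. w (Inner d x y) = 0" "\<And>d opr x y. w (Arith d opr x y) = 0"
  shows "weight w (own_prog S \<tau> \<sigma> p) \<le> length S * e"
    and "weight w (solve_prog S (S_rhs \<tau> \<sigma> p) \<sigma> v y) \<le> length S * e"
proof -
  have s: "weight w (solve_prog S rhs \<sigma> v y) \<le> 0 + length S * e" if "\<And>d a v. weight w (rhs d a v) \<le> e" for rhs v y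
    using that weight_init_prog[of w \<sigma> v y] assms by (intro weight_solve_prog) simp_all
  note r = weight_rhs[of w e, OF assms(1-6)]
  show "weight w (solve_prog S (S_rhs \<tau> \<sigma> p) \<sigma> v y) \<le> length S * e"
    using s[OF r(2)] by simp
  show "weight w (own_prog S \<tau> \<sigma> p) \<le> length S * e"
    using s[OF r(1)] weight_part_gram_path(1)[of w, OF assms(1-4)] assms by (cases \<sigma>) simp_all
qed

text \<open>Each subtree other than the root accounts for one orthonormalization of its parent and
  at most one of itself by \<open>orth_prog\<close>, with two reshapings each. The right-hand sides
  contain none.\<close>

lemma reshapes_main_prog: "wr (main_prog r S \<tau>) \<le> nodes \<tau> * 4"
proof -
  let ?w = "\<lambda>I. if is_reshape I then 1 else (0::nat)"
  have "wr (step_prog r S \<tau> \<tau> []) + 4 \<le> nodes \<tau> * (0 + 4)"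
  proof (rule weight_step_prog)
    show "wr (own_prog S \<tau> \<sigma> p) \<le> 0" for \<sigma> p
      using weight_own_prog(1)[of ?w 0] by simp
    show "wr (phi_pre r ts i) + wr (phi_post r S \<tau> ts p i) \<le> 4" for ts p i
    proof -
      have "wr (root_orth_prog r \<sigma>) \<le> 2" for \<sigma> by (cases \<sigma>) (auto simp: orth_prog_def Let_def)
      moreover have "wr (solve_prog S (S_rhs \<tau> \<sigma> p) \<sigma> v y) = 0" for \<sigma> p v y
        using weight_own_prog(2)[of ?w 0] by simp
      ultimately show ?thesis
        by (simp add: phi_pre_def phi_post_def Let_def orth_prog_def copy_def)
    qed
  qed simp
  then show ?thesis by (simp add: main_prog_def)
qed

text \<open>The 2 stands for the equation of the subtree itself and the backward equation for
  \<open>S\<close>, each solved with at most \<open>length S\<close> evaluations.\<close>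

lemma evals_main_prog: "we (main_prog r S \<tau>) \<le> nodes \<tau> * (2 * length S)"
proof -
  let ?w = "\<lambda>I. if is_eval I then 1 else (0::nat)"
  have "we (step_prog r S \<tau> \<tau> []) + length S \<le> nodes \<tau> * (length S + length S)"
  proof (rule weight_step_prog)
    show "we (own_prog S \<tau> \<sigma> p) \<le> length S" for \<sigma> p
      using weight_own_prog(1)[of ?w 1] by simp
    show "we (phi_pre r ts i) + we (phi_post r S \<tau> ts p i) \<le> length S" for ts p i
    proof -
      have "we (root_orth_prog r \<sigma>) = 0" for \<sigma> by (cases \<sigma>) (auto simp: orth_prog_def Let_def)
      moreover have "we (solve_prog S (S_rhs \<tau> \<sigma> p) \<sigma> v y) \<le> length S" for \<sigma> p v y
        using weight_own_prog(2)[of ?w 1] by simp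
      ultimately show ?thesis
        by (simp add: phi_pre_def phi_post_def Let_def orth_prog_def copy_def)
    qed
  qed simp
  then show ?thesis by (simp add: main_prog_def mult_2)
qed

section \<open>Storage\<close>

lemma finite_Regs: "finite Regs"
  by (simp add: Regs_def finite_subtrees finite_slots)

text \<open>The 3 consists of one \<open>Factor\<close> register per subtree and the two time
  registers, which are charged to the nodes as well.\<close>

lemma card_Regs: "card Regs \<le> nodes \<tau> * (3 + card {x. slot_ok m (nregs S) x})"
proof -
  let ?T = "subtrees \<tau>" and ?X = "{x. slot_ok m (nregs S) x}"
  have "card Regs \<le> card {Time0, Time1 :: 'l reg} + card (Factor ` ?T) + card ((\<lambda>(\<sigma>, x). W \<sigma> x) ` (?T \<times> ?X))"
    unfolding Regs_def by (intro order_trans[OF card_Un_le] add_mono order_refl)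
  also have "card {Time0, Time1 :: 'l reg} \<le> 2 * nodes \<tau>" using nodes_pos[of \<tau>] by simp
  also have "card (Factor ` ?T) \<le> nodes \<tau>"
    using card_image_le[OF finite_subtrees, of Factor \<tau>] card_subtrees[of \<tau>] by simp
  also have "card ((\<lambda>(\<sigma>, x). W \<sigma> x) ` (?T \<times> ?X)) \<le> card (?T \<times> ?X)"
    by (intro card_image_le) (simp add: finite_subtrees finite_slots)
  also have "\<dots> \<le> nodes \<tau> * card ?X"
    by (simp add: card_cartesian_product card_subtrees)
  finally show ?thesis by (simp add: algebra_simps)
qed

lemma storage_le: "typed X M \<Longrightarrow> storage M \<le> card Regs * B"
proof -
  assume M: "typed X M"
  have "{a. numel (M a) \<noteq> 0} \<subseteq> Regs"
    using M by (auto simp: typed_def numel_def empty_tensor_def) force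
  then have "storage M \<le> (\<Sum>a\<in>Regs. numel (M a))"
    unfolding storage_def by (intro sum_mono2 finite_Regs) auto
  also have "\<dots> \<le> (\<Sum>a\<in>Regs. B)" by (intro sum_mono numel_le_B[OF M])
  finally show ?thesis by simp
qed

end

section \<open>The complexity bound\<close>

context evaluation
begin

lemma init_typed:
  assumes "ttn_factors n r \<tau> C0"
  shows "typed ({Time0, Time1} \<union> Factor ` subtrees \<tau>) (init_memory \<tau> t0 t1 C0)"
  using assms scalar_carrier
  by (auto simp: typed_def init_memory_def ttn_factors_def split: reg.splits)

lemma run_main_prog:
  assumes node: "\<nexists>l. \<tau> = Leaf l" and C0: "ttn_factors n r \<tau> C0"
    and evl: "evaluates n r s \<tau> ev F" and \<sigma>: "\<sigma> \<in> subtrees \<tau>"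
  shows "rn (main_prog r S \<tau>) (init_memory \<tau> t0 t1 C0) (Factor \<sigma>) = ttn_step qr (solve S t0 t1) \<tau> F C0 \<sigma>"
proof -
  let ?M = "init_memory \<tau> t0 t1 C0"
  let ?I = "[Contract (W \<tau> RhsS) 0 (Factor \<tau>) (Factor \<tau>), QR (W \<tau> TrS) (W \<tau> (RF 0)) (W \<tau> RhsS),
      Contract (W \<tau> Proj) 1 (W \<tau> TrS) (W \<tau> TrS)]"
  define M1 where "M1 = rn ?I ?M"
  have F1: "M1 x = ?M x" if "\<forall>y. x \<noteq> W \<tau> y" for x
    unfolding M1_def by (rule run_frame) (use that in auto)
  have "checks ({Time0, Time1} \<union> Factor ` subtrees \<tau>) (main_prog r S \<tau>)"
    by (rule checks_main_prog[OF node order_refl])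
  then have "checks ({Time0, Time1} \<union> Factor ` subtrees \<tau>) ?I"
    unfolding main_prog_def checks_append by (rule conjunct1)
  then have "typed ({Time0, Time1} \<union> Factor ` subtrees \<tau> \<union> progwrites \<tau> ?I) M1"
    unfolding M1_def by (rule run_typed[OF _ init_typed[OF C0]])
  then have ty: "typed base_regs M1" by (rule typed_mono) (auto simp: base_regs_def)
  have C\<tau>: "C0 \<tau> \<in> carrier_tensor (factor_dims n r \<tau>)" using C0 by (rule ttn_factorsD)
  let ?A = "Mat 0 (C0 \<tau>) * (Mat 0 (C0 \<tau>))\<^sup>T"
  have d0: "factor_dims n r \<tau> ! 0 = 1" using node root by (cases \<tau>) auto
  have A: "?A \<in> carrier_mat 1 1" using dim_Mat[OF C\<tau>, of 0] d0 by auto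
  obtain Q T where QT: "qr ?A = (Q, T)" by force
  note Q = qr_dims[OF A order_refl QT]
  \<comment> \<open>\<open>Q\<close> has an orthonormal column whatever the decomposed number is, so
    the projection at the root is the identity for all data.\<close>
  have "Mat 1 (of_mat Q) * (Mat 1 (of_mat Q))\<^sup>T = 1\<^sub>m 1"
    using Mat_1_2[OF of_mat_carrier[OF Q(1)]] Q(3) by simp
  moreover have "M1 (W \<tau> Proj) = of_mat (Mat 1 (of_mat Q) * (Mat 1 (of_mat Q))\<^sup>T)"
    using QT by (simp add: M1_def init_memory_def)
  ultimately have P: "M1 (W \<tau> Proj) = of_mat (1\<^sub>m 1)" by simp
  have I: "invar t0 t1 M1"
    using ty P F1[of Time0] F1[of Time1] by (simp add: invar_def init_memory_def)
  \<comment> \<open>At the root nothing has been projected yet: the path is empty and its matrix is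
    the identity of size \<open>s \<tau> = 1\<close>.\<close>
  have rep: "represents n r \<tau> ev [] \<tau> F (factors M1)"
    unfolding represents_def
  proof (intro allI impI)
    fix t A assume A: "ttn_factors n r \<tau> A"
    have Z: "ttn_factors n s \<tau> (ev t A)" "ttn (ev t A) \<tau> = F t (ttn A \<tau>)"
      using evl A by (simp_all add: evaluates_def)
    have "0 < length (ttn_dims n s \<tau>)" "ttn_dims n s \<tau> ! 0 = 1" using root by (cases \<tau>; simp)+
    then show "F t (ttn A \<tau>) = mode_prod 0 (ttn (ev t A) \<tau>) (path_mat [] A (ev t A))"
      using mode_prod_one[OF ttn_carrier[OF Z(1)], of 0] Z(2) by simp
  qed
  \<comment> \<open>Outside the tree the memory holds empty tensors while \<open>C0\<close> may be
    anything. Locality shows that the step is not affected.\<close>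
  define D where "D = - subtrees \<tau>"
  have fM: "factors M1 = override_on C0 (\<lambda>_. empty_tensor) D"
    by (auto simp: factors_def F1 init_memory_def override_on_def D_def)
  have "factors (rn (main_prog r S \<tau>) ?M) = ttn_step qr (solve S t0 t1) \<tau> F (factors M1)"
    using run_step_prog[OF I _ rep] by (simp add: main_prog_def M1_def)
  also have "\<dots> = override_on (ttn_step qr (solve S t0 t1) \<tau> F C0) (\<lambda>_. empty_tensor) D"
    unfolding fM by (rule ttn_step_override) (simp add: D_def)
  finally show ?thesis using \<sigma> by (simp add: factors_def override_on_def D_def fun_eq_iff)
qed

lemma run_bounds:
  fixes t0 t1 :: real
  assumes node: "\<nexists>l. \<tau> = Leaf l" and C0: "ttn_factors n r \<tau> C0"
  defines "Ms \<equiv> states ex (main_prog r S \<tau>) (init_memory \<tau> t0 t1 C0)"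
  shows "\<And>I M. (I, M) \<in> set (zip (main_prog r S \<tau>) Ms) \<Longrightarrow> good I M"
    and "\<And>M. M \<in> set Ms \<Longrightarrow> storage M \<le> card Regs * B"
    and "length [(I, M) \<leftarrow> zip (main_prog r S \<tau>) Ms. reshaped I M \<noteq> None] \<le> nodes \<tau> * 4"
    and "(\<Sum>(I, M)\<leftarrow>zip (main_prog r S \<tau>) Ms. flops I M) \<le> length (main_prog r S \<tau>) * (11 * q * B)"
proof -
  let ?P = "main_prog r S \<tau>"
  note ck = checks_main_prog[OF node order_refl]
  show good: "good I M" if "(I, M) \<in> set (zip ?P Ms)" for I M
    using that unfolding Ms_def by (rule states_good[OF ck init_typed[OF C0]])
  show "storage M \<le> card Regs * B" if "M \<in> set Ms" for M
    using that unfolding Ms_def by (intro storage_le[OF states_typed[OF ck init_typed[OF C0]]])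
  have len: "length (states ex P M) = Suc (length P)" for P M
    by (induction P arbitrary: M) auto
  have "(\<lambda>(I, M). reshaped I M \<noteq> None) = is_reshape \<circ> (fst :: 'a instr \<times> 'a memory \<Rightarrow> 'a instr)"
    \<comment> \<open>Whether an instruction reshapes can be read off from it alone, so the count
      reduces to the program text.\<close>
    by (auto simp: fun_eq_iff reshaped_iff simp del: not_None_eq)
  then have "length [(I, M) \<leftarrow> zip ?P Ms. reshaped I M \<noteq> None] = length (filter is_reshape (map fst (zip ?P Ms)))"
    by (simp only: filter_map length_map)
  also have "map fst (zip ?P Ms) = ?P" by (simp add: map_fst_zip_take len Ms_def)
  finally show "length [(I, M) \<leftarrow> zip ?P Ms. reshaped I M \<noteq> None] \<le> nodes \<tau> * 4"
    using reshapes_main_prog by (simp add: weight_indicator)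
  have "(\<Sum>(I, M)\<leftarrow>xs. flops I M) \<le> length xs * (11 * q * B)" if "set xs \<subseteq> set (zip ?P Ms)" for xs
    using that good by (induction xs) (fastforce simp: good_def)+
  from this[OF order_refl] show "(\<Sum>(I, M)\<leftarrow>zip ?P Ms. flops I M) \<le> length ?P * (11 * q * B)"
    by (simp add: len Ms_def)
qed

end

section \<open>Consequences of the rank conditions, and numerical estimates\<close>

lemma full_rank_rank_le:
  assumes "vec_space.rank a A = a" "A \<in> carrier_mat a b"
  shows "a \<le> b"
  using vec_space.rank_le_nc[OF assms(2)] assms(1) by simp

lemma full_rank_node:
  assumes C: "ttn_factors n r \<tau> C" and fr: "full_rank_factors \<tau> C" and N: "Node ts \<in> subtrees \<tau>"
    and i: "i \<le> length ts"
  shows "(r (Node ts) # map r ts) ! i \<le> prod_list (drop_nth i (r (Node ts) # map r ts))"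
proof -
  have c: "C (Node ts) \<in> carrier_tensor (r (Node ts) # map r ts)"
    using ttn_factorsD[OF ttn_factors_subtree[OF C N]] by simp
  have "vec_space.rank (dims (C (Node ts)) ! i) (Mat i (C (Node ts))) = dims (C (Node ts)) ! i"
    using fr N i unfolding full_rank_factors_def by blast
  then show ?thesis using full_rank_rank_le dim_Mat[OF c, of i] by (simp add: carrier_tensorD[OF c])
qed

lemma leaf_mem: "Leaf x \<in> subtrees \<tau> \<longleftrightarrow> x \<in> leaves \<tau>"
  by (induction \<tau>) auto

text \<open>The hypotheses of the theorem only bound \<open>s \<tau>\<close>. But values of
  \<open>F\<close> lie in \<open>V_space n r \<tau>\<close>, and mode 0 of a network shows its rank
  at the root. The factors \<open>C\<close> supply an argument at which this can be read
  off.\<close>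

lemma root_rank:
  assumes ev: "evaluates n r s \<tau> ev F" and C: "ttn_factors n r \<tau> C"
    and F: "\<forall>X\<in>V_space n r \<tau>. F t X \<in> V_space n r \<tau>"
  shows "s \<tau> = r \<tau>"
proof -
  have Z: "ttn_factors n s \<tau> (ev t C)" "ttn (ev t C) \<tau> = F t (ttn C \<tau>)"
    using ev C by (simp_all add: evaluates_def)
  have "ttn (ev t C) \<tau> \<in> carrier_tensor (ttn_dims n r \<tau>)"
    using F ttn_carrier[OF C] by (simp add: Z(2) V_space_ttn_dims)
  then have "ttn_dims n s \<tau> = ttn_dims n r \<tau>"
    using ttn_carrier[OF Z(1)] by (simp add: carrier_tensor_def)
  then show ?thesis by (cases \<tau>) auto
qed

text \<open>The bound \<open>B\<close> for \<open>q = cc * R\<close>; enlarging \<open>cc\<close> to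
  its power \<open>m + 1\<close> gives both terms the same constant.\<close>

lemma register_size_arith:
  fixes R N cc m :: nat
  assumes "1 \<le> cc"
  shows "(cc * R) ^ (m + 1) + N * (cc * R) \<le> cc ^ (m + 1) * (R * (N + R ^ m))"
proof -
  have "cc \<le> cc ^ (m + 1)" using assms self_le_power[of cc "m + 1"] by simp
  then have "N * (cc * R) \<le> cc ^ (m + 1) * (N * R)" by (simp add: mult_le_mono)
  then show ?thesis by (simp add: power_mult_distrib algebra_simps)
qed

lemma storage_arith:
  fixes d R N cc k m nd :: nat
  assumes "nd \<le> 2 * d" "1 \<le> cc"
  shows "nd * k * ((cc * R) ^ (m + 1) + N * (cc * R)) \<le> (2 * k * cc ^ (m + 1)) * (d * R * (N + R ^ m))"
proof -
  note B = register_size_arith[OF assms(2), of R m N]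
  have "nd * k * ((cc * R) ^ (m + 1) + N * (cc * R)) \<le> (2 * d) * k * (cc ^ (m + 1) * (R * (N + R ^ m)))"
    using assms(1) B by (intro mult_le_mono) auto
  then show ?thesis by (simp add: algebra_simps)
qed

text \<open>\<open>P\<close>, the program length, is quadratic in the number of nodes;
  \<open>nd \<le> 2 * d\<close> turns the 11 into \<open>44 = 4 * 11\<close>, and
  \<open>19 = 16 + 3\<close>. One factor \<open>R\<close> comes from the cost bound and one from the
  register size. The factor \<open>l\<close> enters at the end through
  \<open>1 \<le> l\<close>.\<close>

lemma flops_arith:
  fixes d R N cc m nd a b P l :: nat
  assumes "nd \<le> 2 * d" "1 \<le> cc" "1 \<le> nd" "1 \<le> l"
    and P: "P \<le> nd * (2 * (a + b * nd) + 16) + 3"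
  shows "P * (11 * (cc * R) * ((cc * R) ^ (m + 1) + N * (cc * R))) \<le>
    (44 * (2 * (a + b) + 19) * cc ^ (m + 2)) * (l * d\<^sup>2 * R\<^sup>2 * (N + R ^ m))"
proof -
  note B = register_size_arith[OF assms(2), of R m N]
  have "a + b * nd \<le> (a + b) * nd" using assms(3) by (simp add: add_mult_distrib)
  then have "2 * (a + b * nd) + 16 \<le> 2 * ((a + b) * nd) + 16 * nd"
    using assms(3) by (intro add_mono mult_le_mono2) auto
  also have "\<dots> = nd * (2 * (a + b) + 16)" by (simp add: algebra_simps)
  finally have "2 * (a + b * nd) + 16 \<le> nd * (2 * (a + b) + 16)" .
  then have "nd * (2 * (a + b * nd) + 16) \<le> nd * (nd * (2 * (a + b) + 16))" by (rule mult_le_mono2)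
  moreover have "3 \<le> nd * (nd * 3)" using assms(3) by simp
  ultimately have "P \<le> nd * (nd * (2 * (a + b) + 16)) + nd * (nd * 3)" using P by linarith
  also have "\<dots> = nd * nd * (2 * (a + b) + 19)" by (simp add: algebra_simps)
  also have "\<dots> \<le> (2 * d) * (2 * d) * (2 * (a + b) + 19)" using assms(1) by (intro mult_le_mono) auto
  finally have "P * (11 * (cc * R) * ((cc * R) ^ (m + 1) + N * (cc * R))) \<le>
      (2 * d) * (2 * d) * (2 * (a + b) + 19) * (11 * (cc * R) * (cc ^ (m + 1) * (R * (N + R ^ m))))"
    using B by (intro mult_le_mono) auto
  also have "\<dots> = (44 * (2 * (a + b) + 19) * cc ^ (m + 2)) * (1 * d\<^sup>2 * R\<^sup>2 * (N + R ^ m))"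
    by (simp add: power2_eq_square algebra_simps)
  also have "\<dots> \<le> (44 * (2 * (a + b) + 19) * cc ^ (m + 2)) * (l * d\<^sup>2 * R\<^sup>2 * (N + R ^ m))"
    using assms(4) by (intro mult_le_mono) auto
  finally show ?thesis .
qed

lemma real_bound: "x \<le> k * y \<Longrightarrow> real k \<le> \<kappa> \<Longrightarrow> real x \<le> \<kappa> * real y"
  for x k y :: nat
proof -
  assume "x \<le> k * y" "real k \<le> \<kappa>"
  then have "real x \<le> real k * real y" by (metis of_nat_le_iff of_nat_mult)
  also have "\<dots> \<le> \<kappa> * real y" using \<open>real k \<le> \<kappa>\<close> by (intro mult_right_mono) auto
  finally show ?thesis .
qed

theorem lemma4p5:
  fixes m :: nat and c :: real and S :: solver
  shows "\<exists>\<kappa>::real. \<forall>(\<tau> :: 'l tree) (n :: 'l \<Rightarrow> nat) (r :: 'l tree \<Rightarrow> nat) (s :: 'l tree \<Rightarrow> nat).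
    let d = real (card (leaves \<tau>));
        l = real (height \<tau>);
        N = real (Max (n ` leaves \<tau>));
        R = real (Max (r ` subtrees \<tau>))
    in
    is_tree \<tau> \<and> (\<nexists>x. \<tau> = Leaf x) \<and>
    m = Max (length ` {ts. Node ts \<in> subtrees \<tau>}) \<and>
    (\<forall>x\<in>leaves \<tau>. r (Leaf x) \<le> n x) \<and> r \<tau> = 1 \<and>
    (\<forall>\<sigma>\<in>subtrees \<tau>. real (s \<sigma>) \<le> c * R)
    \<longrightarrow>
    (\<exists>P :: 'l instr list. \<forall>F ev qr t0 t1 C0.
      (\<forall>t. \<forall>X\<in>V_space n r \<tau>. F t X \<in> V_space n r \<tau>) \<and>
      (\<forall>t X. is_ttn n r \<tau> X \<longrightarrow> is_ttn n s \<tau> (F t X)) \<and>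
      evaluates n r s \<tau> ev F \<and>
      QR_routine qr \<and>
      ttn_factors n r \<tau> C0 \<and> full_rank_factors \<tau> C0 \<and> orthonormal_rep r \<tau> C0
      \<longrightarrow>
      (let Ms = states (exec qr ev \<tau>) P (init_memory \<tau> t0 t1 C0);
           run = zip P Ms
       in
        (\<forall>(I, M)\<in>set run. legal n r \<tau> I M) \<and>
        (\<forall>\<sigma>\<in>subtrees \<tau>. last Ms (Factor \<sigma>) = ttn_step qr (solve S t0 t1) \<tau> F C0 \<sigma>) \<and>
        (\<forall>M\<in>set Ms. real (storage M) \<le> \<kappa> * (d * R * (N + R ^ m))) \<and>
        real (length [(I, M) \<leftarrow> run. reshaped I M \<noteq> None]) \<le> \<kappa> * (l * d) \<and>
        (\<forall>(I, M)\<in>set run. \<forall>k. reshaped I M = Some k \<longrightarrow> real k \<le> R ^ (m + 1)) \<and>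
        real (\<Sum>(I, M)\<leftarrow>run. flops I M) \<le> \<kappa> * (l * d\<^sup>2 * R\<^sup>2 * (N + R ^ m)) \<and>
        real (length (filter is_eval P)) \<le> \<kappa> * d))"
proof -
  \<comment> \<open>The common bound \<open>cc * R\<close> for the ranks has to be a natural number
    and at least \<open>R\<close>, hence the ceiling and the maximum with 1.\<close>
  define cc where "cc = max 1 (nat \<lceil>c\<rceil>)"
  define k1 where "k1 = 2 * (3 + card {x. slot_ok m (nregs S) x}) * cc ^ (m + 1)"
  define k2 where "k2 = 44 * (2 * ((3 * nregs S + 4) + length S * (4 * m + 14)) + 19) * cc ^ (m + 2)"
  \<comment> \<open>A sum dominates each of the four constants needed. The last two are doubled
    counts per node, from \<open>nodes \<tau> \<le> 2 * d\<close>: four reshapings, and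
    \<open>2 * length S\<close> evaluations. All of them depend only on \<open>m\<close>,
    \<open>c\<close> and \<open>S\<close>.\<close>
  define \<kappa> where "\<kappa> = real (k1 + k2 + 8 + 4 * length S)"
  have cc: "1 \<le> cc" by (simp add: cc_def)
  have \<kappa>: "real k1 \<le> \<kappa>" "real k2 \<le> \<kappa>" "real 8 \<le> \<kappa>" "real (4 * length S) \<le> \<kappa>" by (simp_all add: \<kappa>_def)
  show ?thesis
  \<comment> \<open>The program is chosen before \<open>F\<close>, \<open>ev\<close>,
    \<open>qr\<close>, the times and the initial factors; it depends only on the tree, the ranks
    \<open>r\<close> and the solver.\<close>
  proof (rule exI[of _ \<kappa>], unfold Let_def, intro allI impI, elim conjE,
      rule_tac x = "main_prog r S \<tau>" in exI, intro allI impI, elim conjE, intro conjI)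
    fix \<tau> :: "'l tree" and n :: "'l \<Rightarrow> nat" and r s :: "'l tree \<Rightarrow> nat" and F ev qr t0 t1 C0
    let ?N = "Max (n ` leaves \<tau>)" and ?R = "Max (r ` subtrees \<tau>)" and ?d = "card (leaves \<tau>)"
    assume tree: "is_tree \<tau>" and node: "\<nexists>x. \<tau> = Leaf x"
      and m: "m = Max (length ` {ts. Node ts \<in> subtrees \<tau>})"
      and rn: "\<forall>x\<in>leaves \<tau>. r (Leaf x) \<le> n x" and r1: "r \<tau> = 1"
      and sc: "\<forall>\<sigma>\<in>subtrees \<tau>. real (s \<sigma>) \<le> c * real ?R"
      and F: "\<forall>t. \<forall>X\<in>V_space n r \<tau>. F t X \<in> V_space n r \<tau>"
      and evl: "evaluates n r s \<tau> ev F" and qr: "QR_routine qr"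
      and C0: "ttn_factors n r \<tau> C0" and fr: "full_rank_factors \<tau> C0"
    obtain us where us: "\<tau> = Node us" using node by (cases \<tau>) auto
    \<comment> \<open>\<open>Max\<close> is informative only on finite sets; finiteness follows from
      that of the set of subtrees, \<open>Node\<close> being injective.\<close>
    have "{ts. Node ts \<in> subtrees \<tau>} = Node -` subtrees \<tau>" by auto
    moreover have "finite (Node -` subtrees \<tau>)"
      by (rule finite_vimageI[OF finite_subtrees]) (simp add: inj_on_def)
    ultimately have fin: "finite (length ` {ts. Node ts \<in> subtrees \<tau>})" by simp
    have arity: "length ts \<le> m" if "Node ts \<in> subtrees \<tau>" for ts
      unfolding m using that fin by (intro Max_ge) auto
    have "2 \<le> length us" using tree by (simp add: us)
    then have m1: "1 \<le> m" using arity[of us] by (simp add: us)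
    have rR: "r \<sigma> \<le> ?R" if "\<sigma> \<in> subtrees \<tau>" for \<sigma>
      using that finite_subtrees by (intro Max_ge) auto
    have R1: "1 \<le> ?R" using rR[OF subtrees_refl] r1 by simp
    have sq: "s \<sigma> \<le> cc * ?R" if "\<sigma> \<in> subtrees \<tau>" for \<sigma>
    proof -
      have "c \<le> real cc" unfolding cc_def by linarith
      then have "c * real ?R \<le> real cc * real ?R" by (intro mult_right_mono) auto
      then have "real (s \<sigma>) \<le> real (cc * ?R)" using sc that by fastforce
      then show ?thesis unfolding of_nat_le_iff .
    qed
    have nN: "n x \<le> ?N" if "Leaf x \<in> subtrees \<tau>" for x
      using that finite_leaves by (intro Max_ge) (auto simp: leaf_mem)
    have Rq: "?R \<le> cc * ?R" and q1: "1 \<le> cc * ?R" using cc R1 by simp_all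
    have nd: "nodes \<tau> \<le> 2 * ?d" using nodes_le_leaves[OF tree] by simp
    have l1: "1 \<le> height \<tau>" by (simp add: us)
    \<comment> \<open>The time 0 is an arbitrary sample.\<close>
    have s1: "s \<tau> = 1" using root_rank[OF evl C0, of 0] F r1 by simp
    interpret evaluation n r s \<tau> S m ?N ?R "cc * ?R" qr ev
      using tree arity m1 rR Rq sq q1 R1 nN rn r1 s1 qr full_rank_node[OF C0 fr] evl
      by unfold_locales (simp_all add: leaf_mem evaluates_def)
    let ?P = "main_prog r S \<tau>"
    let ?Ms = "states (exec qr ev \<tau>) ?P (init_memory \<tau> t0 t1 C0)"
    note bounds = run_bounds[where ?t0.0 = t0 and ?t1.0 = t1, OF node C0]
    show "\<forall>(I, M)\<in>set (zip ?P ?Ms). legal n r \<tau> I M"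
      using bounds(1) by (auto simp: good_def)
    show "\<forall>\<sigma>\<in>subtrees \<tau>. last ?Ms (Factor \<sigma>) = ttn_step qr (solve S t0 t1) \<tau> F C0 \<sigma>"
      using run_main_prog[OF node C0 evl] by (simp add: last_states)
    show "\<forall>M\<in>set ?Ms. real (storage M) \<le> \<kappa> * (real ?d * real ?R * (real ?N + real ?R ^ m))"
    proof
      fix M assume "M \<in> set ?Ms"
      then have "storage M \<le> nodes \<tau> * (3 + card {x. slot_ok m (nregs S) x}) * B"
        using bounds(2) card_Regs by (meson mult_le_mono1 order_trans)
      also have "\<dots> \<le> k1 * (?d * ?R * (?N + ?R ^ m))"
        unfolding B_def k1_def using nd cc by (rule storage_arith)
      finally show "real (storage M) \<le> \<kappa> * (real ?d * real ?R * (real ?N + real ?R ^ m))"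
        using real_bound[OF _ \<kappa>(1)] by fastforce
    qed
    show "real (length [(I, M) \<leftarrow> zip ?P ?Ms. reshaped I M \<noteq> None]) \<le> \<kappa> * (real (height \<tau>) * real ?d)"
    proof -
      have "nodes \<tau> * 4 \<le> 8 * (1 * ?d)" using nd by simp
      also have "\<dots> \<le> 8 * (height \<tau> * ?d)" using l1 by (intro mult_le_mono) auto
      finally have "length [(I, M) \<leftarrow> zip ?P ?Ms. reshaped I M \<noteq> None] \<le> 8 * (height \<tau> * ?d)"
        using bounds(3) by linarith
      from real_bound[OF this \<kappa>(3)] show ?thesis by simp
    qed
    show "\<forall>(I, M)\<in>set (zip ?P ?Ms). \<forall>k. reshaped I M = Some k \<longrightarrow> real k \<le> real ?R ^ (m + 1)"
      using bounds(1) by (fastforce simp: good_def simp flip: of_nat_power of_nat_mult)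
    show "real (\<Sum>(I, M)\<leftarrow>zip ?P ?Ms. flops I M) \<le>
        \<kappa> * (real (height \<tau>) * (real ?d)\<^sup>2 * (real ?R)\<^sup>2 * (real ?N + real ?R ^ m))"
    proof -
      have "length ?P \<le> nodes \<tau> * (2 * ((3 * nregs S + 4) + (length S * (4 * m + 14)) * nodes \<tau>) + 16) + 3"
        using length_main_prog by (simp add: solve_len_def eval_len_def mult.commute mult.left_commute)
      from flops_arith[OF nd cc nodes_pos l1 this, of ?R m ?N]
      have "(\<Sum>(I, M)\<leftarrow>zip ?P ?Ms. flops I M) \<le> k2 * (height \<tau> * ?d\<^sup>2 * ?R\<^sup>2 * (?N + ?R ^ m))"
        using bounds(4) unfolding B_def k2_def by (rule order_trans[rotated])
      from real_bound[OF this \<kappa>(2)] show ?thesis by simp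
    qed
    show "real (length (filter is_eval ?P)) \<le> \<kappa> * real ?d"
    proof -
      have "length (filter is_eval ?P) \<le> nodes \<tau> * (2 * length S)"
        using evals_main_prog by (simp add: weight_indicator)
      also have "\<dots> \<le> 2 * ?d * (2 * length S)" using nd by (intro mult_le_mono) auto
      finally have "length (filter is_eval ?P) \<le> 4 * length S * ?d" by (simp add: mult_ac)
      from real_bound[OF this \<kappa>(4)] show ?thesis .
    qed
  qed
qed

end
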